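(* Let $m, n \ge 2$. (i) For any $m$, $CP_{m,n}$ and $COP_{m,n}$ are a pair of dual cones (that is, $CP_{m,n}^* = COP_{m,n}$ and $COP_{m,n}^* = CP_{m,n}$), and $PSD_{m,n}$ and $CD_{m,n}$ are another pair of dual cones (that is, $PSD_{m,n}^* = CD_{m,n}$ and $CD_{m,n}^* = PSD_{m,n}$). (ii) If $m$ is odd, then $CD_{m,n} = S_{m,n}$ and $PSD_{m,n} = \{O_{m,n}\}$, where $O_{m,n}$ is the zero tensor in $S_{m,n}$. (iii) If $m = 2k$ is even, then $$CP_{m,n} \subsetneq CD_{m,n} \subset SOS_{m,n} \subset PSD_{m,n} \subsetneq COP_{m,n},$$ where $\subset$ denotes (not necessarily strict) inclusion. (iv) Suppose that $m$ is even. Then $SOS_{m,n} = PSD_{m,n}$ if either $m = 2$, or $n = 2$, or $m = 4$ and $n = 3$. Otherwise, $SOS_{m,n} \subsetneq PSD_{m,n}$. Furthermore, $CD_{2,n} = SOS_{2,n}$, and $CD_{m,n} \subsetneq SOS_{m,n}$ for $m \ge 4$.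
   Context: $S_{m,n}$ is the space of real symmetric tensors of order $m$ and dimension $n$. For $\mathcal{A} = (a_{i_1\cdots i_m})$, $\mathcal{B} = (b_{i_1\cdots i_m})$ in $S_{m,n}$ and $\mathbf{x}\in\mathbb{R}^n$, write $\mathcal{A}\bullet\mathcal{B} = \sum_{i_1,\dots,i_m=1}^n a_{i_1\cdots i_m}b_{i_1\cdots i_m}$ and $\mathcal{A}\mathbf{x}^m = \sum_{i_1,\dots,i_m=1}^n a_{i_1\cdots i_m}x_{i_1}\cdots x_{i_m}$. For a vector $\mathbf{u}\in\mathbb{R}^n$, $\mathbf{u}^m$ denotes the rank-one symmetric tensor with entries $u_{i_1}\cdots u_{i_m}$. The dual cone of a cone $M\subseteq S_{m,n}$ is $M^* = \{\mathcal{B}\in S_{m,n} : \mathcal{A}\bullet\mathcal{B}\ge 0 \ \forall \mathcal{A}\in M\}$. Definitions of the cones in $S_{m,n}$: - $PSD_{m,n}$ (positive semidefinite): $\mathcal{A}\mathbf{x}^m\ge 0$ for all $\mathbf{x}\in\mathbb{R}^n$. - $COP_{m,n}$ (copositive): $\mathcal{A}\mathbf{x}^m\ge 0$ for all $\mathbf{x}\in\mathbb{R}^n_+$ (the nonnegative orthant). - $SOS_{m,n}$ (sum of squares; only for $m=2k$ even): there are finitely many $\mathcal{C}_1,\dots,\mathcal{C}_r\in S_{k,n}$ with $\mathcal{A}\mathbf{x}^m = \sum_{j=1}^r (\mathcal{C}_j\mathbf{x}^k)^2$ for all $\mathbf{x}\in\mathbb{R}^n$. - $CD_{m,n}$ (completely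 decomposable): $\mathcal{A} = \sum_{j=1}^p \mathbf{u}_j^m$ for finitely many $\mathbf{u}_1,\dots,\mathbf{u}_p\in\mathbb{R}^n$. - $CP_{m,n}$ (completely positive): $\mathcal{A} = \sum_{j=1}^p \mathbf{u}_j^m$ for finitely many $\mathbf{u}_1,\dots,\mathbf{u}_p\in\mathbb{R}^n_+$. *)

theory Defs
  imports "HOL-Analysis.Analysis" "HOL-Combinatorics.Permutations"
begin

text \<open>
  The dimension \<open>n\<close> is the cardinality of the finite index type \<open>'n\<close>; the order \<open>m\<close> is a natural
  number. The entry \<open>a\<^bsub>i1...im\<^esub>\<close> of a tensor \<open>A\<close> of order \<open>m\<close> is \<open>A [i1, ..., im]\<close>. Order-\<open>m\<close> tensors
  vanish on lists of any other length, so that equality of functions is equality of tensors.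
\<close>

type_synonym 'n tensor = "'n list \<Rightarrow> real"

definition sym_tensors :: "nat \<Rightarrow> 'n::finite tensor set" where
  "sym_tensors m = {A. (\<forall>is. length is \<noteq> m \<longrightarrow> A is = 0) \<and>
     (\<forall>is p. length is = m \<longrightarrow> p permutes {..<m} \<longrightarrow> A (permute_list p is) = A is)}"

definition zero_tensor :: "'n::finite tensor" where
  "zero_tensor = (\<lambda>is. 0)"

definition tensor_inner :: "nat \<Rightarrow> 'n::finite tensor \<Rightarrow> 'n tensor \<Rightarrow> real" where
  "tensor_inner m A B = (\<Sum>is | length is = m. A is * B is)"

definition tensor_form :: "nat \<Rightarrow> 'n::finite tensor \<Rightarrow> real ^ 'n \<Rightarrow> real" where
  "tensor_form m A x = (\<Sum>is | length is = m. A is * (\<Prod>i\<leftarrow>is. x $ i))"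

definition rank_one :: "nat \<Rightarrow> real ^ 'n \<Rightarrow> 'n::finite tensor" where
  "rank_one m u = (\<lambda>is. if length is = m then (\<Prod>i\<leftarrow>is. u $ i) else 0)"

definition nonneg_orthant :: "(real ^ 'n::finite) set" where
  "nonneg_orthant = {x. \<forall>i. 0 \<le> x $ i}"

definition dual_cone :: "nat \<Rightarrow> 'n::finite tensor set \<Rightarrow> 'n tensor set" where
  "dual_cone m M = {B \<in> sym_tensors m. \<forall>A\<in>M. 0 \<le> tensor_inner m A B}"

definition PSD :: "nat \<Rightarrow> 'n::finite tensor set" where
  "PSD m = {A \<in> sym_tensors m. \<forall>x. 0 \<le> tensor_form m A x}"

definition COP :: "nat \<Rightarrow> 'n::finite tensor set" where
  "COP m = {A \<in> sym_tensors m. \<forall>x\<in>nonneg_orthant. 0 \<le> tensor_form m A x}"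

text \<open>Meaningful for even \<open>m\<close> only; for odd \<open>m\<close> this set is empty.\<close>

definition SOS :: "nat \<Rightarrow> 'n::finite tensor set" where
  "SOS m = {A \<in> sym_tensors m. \<exists>k. m = 2 * k \<and>
     (\<exists>(r::nat) C. (\<forall>j<r. C j \<in> sym_tensors k) \<and>
        (\<forall>x. tensor_form m A x = (\<Sum>j<r. (tensor_form k (C j) x)\<^sup>2)))}"

definition CD :: "nat \<Rightarrow> 'n::finite tensor set" where
  "CD m = {A \<in> sym_tensors m. \<exists>(p::nat) u. A = (\<lambda>is. \<Sum>j<p. rank_one m (u j) is)}"

definition CP :: "nat \<Rightarrow> 'n::finite tensor set" where
  "CP m = {A \<in> sym_tensors m. \<exists>(p::nat) u. (\<forall>j<p. u j \<in> nonneg_orthant) \<and>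
     A = (\<lambda>is. \<Sum>j<p. rank_one m (u j) is)}"

end

theory Submission
  imports Defs
begin

text \<open>
  Write \<open>A x\<close> for the form of a tensor \<open>A\<close> of order \<open>m\<close>. Three ideas carry the theorem.

  \<^emph>\<open>Duality.\<close> The inner product of \<open>A\<close> with the power \<open>u\<^sup>m\<close> is the value \<open>A u\<close>. Hence the dual of the cone
  of sums of powers of vectors of a set \<open>X\<close> consists of the symmetric tensors whose form is
  nonnegative on \<open>X\<close>, which is one half of both dualities (\<open>dual_power_cone\<close>). The other half says
  that the cone of sums of powers is closed. By Caratheodory's argument a bounded number of summands
  suffices (\<open>caratheodory_conic_sums\<close>); if the entries of \<open>u\<^sup>m\<close> are bounded by one linear functional
  that is nonnegative on the powers, then bounded sums have bounded summands, so they form a compact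
  set. A tensor outside the cone therefore has a nearest point in the cone, and the difference of the
  two is a separating functional (\<open>conic_separation\<close>). Such a functional exists if the vectors are
  nonnegative (the sum of all entries) and if \<open>m\<close> is even (the sum of the diagonal entries). If \<open>m\<close>
  is odd, then \<open>-u\<^sup>m = (-u)\<^sup>m\<close>, so the completely decomposable tensors are a linear space; a tensor
  orthogonal to it has the form zero, and a symmetric tensor with zero form vanishes. So this space
  contains every symmetric tensor, and a form that is odd and nonnegative is zero.

  \<^emph>\<open>Hilbert's cases of equality.\<close> Suppose that every nonzero positive semidefinite form of degree \<open>2k\<close>
  dominates the square of a nonzero form of degree \<open>k\<close> (\<open>dominates_square\<close>). Then each positive
  semidefinite \<open>F\<close> is a sum of squares: among the sums of squares below \<open>F\<close>, which form a compact set,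
  one maximises a suitable sum of point values, and a nonzero remainder would dominate a further square
  (\<open>psd_form_sum_of_squares\<close>). The square exists for quadratic forms by the Cauchy-Schwarz inequality.
  For binary forms it exists since a form without zeros dominates a multiple of \<open>x\<^sup>2\<^sup>k\<close>, and a form with
  a zero is divisible by the square of a linear form. For ternary quartics it is constructed, following
  Choi and Lam, by completing the square with respect to a coordinate axis on which the form vanishes
  (\<open>ternary_quartic_psd_dominates_square\<close>).

  \<^emph>\<open>Strictness.\<close> The Motzkin form (degree at least 6, at least three variables) and the Choi-Lam quartic
  (four variables) vanish at four points given by signs, and are 1 at the centre of these points. A
  form whose square lies below one of them has, at the centre, the mean of its values at the four
  points. So in a representation by squares all summands would vanish at the centre. The remaining
  strict inclusions (for even \<open>m\<close>) are witnessed by \<open>(x\<^sub>i - x\<^sub>j)\<^sup>m\<close>, by \<open>x\<^sub>i x\<^sub>j\<close> times a power of \<open>x\<^sub>i\<close>, and by the square of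
  such a monomial.
\<close>

section \<open>Forms on a real vector space\<close>

text \<open>
  Homogeneous polynomial functions, described without coordinates: spanned by products of \<open>d\<close> linear
  functionals. This makes closure under sums, products and linear substitutions immediate, and it
  makes sense on \<open>real ^ 'n\<close> as well as on the iterated products in which coordinates are split off.
\<close>

inductive is_form :: "nat \<Rightarrow> ('a::real_vector \<Rightarrow> real) \<Rightarrow> bool" where
  is_form_const: "is_form 0 (\<lambda>x. c)"
| is_form_add: "is_form d f \<Longrightarrow> is_form d g \<Longrightarrow> is_form d (\<lambda>x. f x + g x)"
| is_form_lmult: "linear l \<Longrightarrow> is_form d f \<Longrightarrow> is_form (Suc d) (\<lambda>x. l x * f x)"

lemma is_form_0: "is_form 0 f \<Longrightarrow> f = (\<lambda>x. f 0)"
proof -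
  have "is_form d f \<Longrightarrow> d = 0 \<Longrightarrow> f x = f 0" for d x
    by (induction rule: is_form.induct) auto
  then show "is_form 0 f \<Longrightarrow> f = (\<lambda>x. f 0)" by blast
qed

lemma is_form_zero: "is_form d (\<lambda>x::'a::real_vector. 0)"
proof (induction d)
  case (Suc d)
  have "linear (\<lambda>x::'a. 0::real)" by (simp add: linear_iff)
  from is_form_lmult[OF this Suc] show ?case by simp
qed (rule is_form_const)

lemma is_form_cmult: "is_form d f \<Longrightarrow> is_form d (\<lambda>x. c * f x)"
proof (induction rule: is_form.induct)
  case (is_form_const a) show ?case by (rule is_form.is_form_const)
next
  case (is_form_add d f g)
  then show ?case using is_form.is_form_add[of d "\<lambda>x. c * f x" "\<lambda>x. c * g x"]
    by (simp add: algebra_simps)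
next
  case (is_form_lmult l d f)
  from is_form.is_form_lmult[OF is_form_lmult(1,3)] show ?case
    by (simp add: mult.left_commute)
qed

lemma is_form_minus: "is_form d f \<Longrightarrow> is_form d (\<lambda>x. - f x)"
  using is_form_cmult[of d f "-1"] by simp

lemma is_form_diff: "is_form d f \<Longrightarrow> is_form d g \<Longrightarrow> is_form d (\<lambda>x. f x - g x)"
  using is_form_add[OF _ is_form_minus, of d f g] by simp

lemma is_form_mult: "is_form d f \<Longrightarrow> is_form e g \<Longrightarrow> is_form (d + e) (\<lambda>x. f x * g x)"
proof (induction rule: is_form.induct)
  case (is_form_const a) then show ?case using is_form_cmult by simp
next
  case (is_form_add d f g')
  then show ?case using is_form.is_form_add[of "d+e" "\<lambda>x. f x * g x" "\<lambda>x. g' x * g x"]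
    by (simp add: algebra_simps)
next
  case (is_form_lmult l d f)
  then show ?case using is_form.is_form_lmult[of l "d+e" "\<lambda>x. f x * g x"] by (simp add: mult.assoc)
qed

lemma is_form_linear: "linear l \<Longrightarrow> is_form 1 l"
  using is_form_lmult[OF _ is_form_const, of l 1] by simp

lemma is_form_power: "is_form d f \<Longrightarrow> is_form (k * d) (\<lambda>x. f x ^ k)"
proof (induction k)
  case 0 show ?case using is_form_const[of 1] by simp
next
  case (Suc k)
  from is_form_mult[OF Suc.prems Suc.IH[OF Suc.prems]] show ?case by simp
qed

lemma is_form_linear_power: "linear l \<Longrightarrow> is_form k (\<lambda>x. l x ^ k)"
  using is_form_power[OF is_form_linear, of l k] by simp

lemma is_form_sum:
  assumes "\<And>i. i \<in> I \<Longrightarrow> is_form d (f i)"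
  shows "is_form d (\<lambda>x. \<Sum>i\<in>I. f i x)"
  using assms
proof (induction I rule: infinite_finite_induct)
  case (insert a I)
  then show ?case using is_form_add[of d "f a" "\<lambda>x. \<Sum>i\<in>I. f i x"] by simp
qed (simp_all add: is_form_zero)

lemma is_form_compose: "is_form d f \<Longrightarrow> linear T \<Longrightarrow> is_form d (\<lambda>x. f (T x))"
proof (induction rule: is_form.induct)
  case (is_form_const c) show ?case by (rule is_form.is_form_const)
next
  case (is_form_add d f g) then show ?case using is_form.is_form_add by blast
next
  case (is_form_lmult l d f)
  have "linear (\<lambda>x. l (T x))" using linear_compose[OF is_form_lmult(4,1)] by (simp add: o_def)
  then show ?case using is_form.is_form_lmult is_form_lmult by blast
qed

lemma is_form_homogeneous: "is_form d f \<Longrightarrow> f (t *\<^sub>R x) = t ^ d * f x"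
  by (induction rule: is_form.induct) (auto simp: algebra_simps linear_scale)

lemma is_form_at_0: "is_form d f \<Longrightarrow> 0 < d \<Longrightarrow> f 0 = 0"
  using is_form_homogeneous[of d f 0 0] by (simp add: zero_power)

lemma is_form_uminus_arg: "is_form d f \<Longrightarrow> f (- x) = (-1) ^ d * f x"
  using is_form_homogeneous[of d f "-1" x] by simp

lemma is_form_continuous:
  fixes f :: "'a::euclidean_space \<Rightarrow> real"
  shows "is_form d f \<Longrightarrow> continuous_on S f"
proof (induction rule: is_form.induct)
  case (is_form_lmult l d f)
  then show ?case
    by (intro continuous_on_mult[OF linear_continuous_on]) (simp_all add: linear_conv_bounded_linear)
qed (intro continuous_intros; assumption)+

lemma is_form_one_linear: "is_form 1 f \<Longrightarrow> linear f"
proof -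
  have "is_form d f \<Longrightarrow> d = 1 \<Longrightarrow> linear f" for d
  proof (induction rule: is_form.induct)
    case (is_form_add d f g) then show ?case by (simp add: linear_iff algebra_simps)
  next
    case (is_form_lmult l d f)
    then have "is_form 0 f" by simp
    then obtain c where "f = (\<lambda>x. c)" using is_form_0 by blast
    then show ?case using is_form_lmult(1) by (simp add: linear_iff algebra_simps)
  qed simp
  then show "is_form 1 f \<Longrightarrow> linear f" by blast
qed

lemma is_form_two_bilinear:
  assumes "is_form 2 f"
  shows "\<exists>B. (\<forall>v. linear (B v)) \<and> (\<forall>v w. B v w = (B w v :: real)) \<and> (\<forall>v. f v = B v v)"
proof -
  have "is_form d f \<Longrightarrow> d = 2 \<Longrightarrow>
      \<exists>B. (\<forall>v. linear (B v)) \<and> (\<forall>v w. B v w = (B w v :: real)) \<and> (\<forall>v. f v = B v v)" for d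
  proof (induction rule: is_form.induct)
    case (is_form_add d f g)
    then obtain B C where "(\<forall>v. linear (B v)) \<and> (\<forall>v w. B v w = (B w v :: real)) \<and> (\<forall>v. f v = B v v)"
      "(\<forall>v. linear (C v)) \<and> (\<forall>v w. C v w = (C w v :: real)) \<and> (\<forall>v. g v = C v v)" by blast
    then show ?case
      by (intro exI[of _ "\<lambda>v w. B v w + C v w"]) (auto simp: linear_iff algebra_simps)
  next
    case (is_form_lmult l d f)
    then have "linear f" using is_form_one_linear by simp
    then show ?case using is_form_lmult(1)
      by (intro exI[of _ "\<lambda>v w. (l v * f w + l w * f v) / 2"]) (auto simp: linear_iff field_simps)
  qed simp
  then show ?thesis using assms by blast
qed

lemma linear_prod_split:
  fixes l :: "real \<times> 'b::real_vector \<Rightarrow> real"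
  assumes "linear l"
  shows "linear (\<lambda>w. l (0, w))" and "l (x, w) = x * l (1, 0) + l (0, w)"
proof -
  show "linear (\<lambda>w. l (0, w))"
  proof (rule linearI)
    fix a b show "l (0, a + b) = l (0, a) + l (0, b)"
      using linear_add[OF assms, of "(0,a)" "(0,b)"] by simp
  next
    fix r b show "l (0, r *\<^sub>R b) = r *\<^sub>R l (0, b)"
      using linear_scale[OF assms, of r "(0,b)"] by simp
  qed
  have "(x, w) = x *\<^sub>R (1, 0) + (0, w)" by simp
  then have "l (x, w) = l (x *\<^sub>R (1, 0) + (0, w))" by simp
  also have "\<dots> = x * l (1, 0) + l (0, w)"
    by (simp only: linear_add[OF assms] linear_scale[OF assms] real_scaleR_def)
  finally show "l (x, w) = x * l (1, 0) + l (0, w)" .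
qed

text \<open>
  Collecting powers of the first coordinate: each linear factor splits into a multiple of the first
  coordinate and a functional of the remaining ones.
\<close>

lemma is_form_prod_expand:
  fixes F :: "real \<times> 'b::real_vector \<Rightarrow> real"
  assumes "is_form d F"
  shows "\<exists>G. (\<forall>i\<le>d. is_form (d - i) (G i)) \<and> (\<forall>x w. F (x, w) = (\<Sum>i\<le>d. x ^ i * G i w))"
  using assms
proof (induction rule: is_form.induct)
  case (is_form_const c)
  show ?case by (intro exI[of _ "\<lambda>i w. c"]) (auto intro: is_form.is_form_const)
next
  case (is_form_add d f g)
  then obtain F G where F: "\<forall>i\<le>d. is_form (d - i) (F i)" "\<forall>x w. f (x, w) = (\<Sum>i\<le>d. x ^ i * F i w)"
    and G: "\<forall>i\<le>d. is_form (d - i) (G i)" "\<forall>x w. g (x, w) = (\<Sum>i\<le>d. x ^ i * G i w)" by blast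
  show ?case
    by (intro exI[of _ "\<lambda>i w. F i w + G i w"])
       (auto intro: is_form.is_form_add simp: F G algebra_simps sum.distrib)
next
  case (is_form_lmult l d f)
  then obtain F where F: "\<forall>i\<le>d. is_form (d - i) (F i)" "\<forall>x w. f (x, w) = (\<Sum>i\<le>d. x ^ i * F i w)"
    by blast
  define H where "H i w = (if i = 0 then 0 else l (1,0) * F (i - 1) w)
      + (if i = Suc d then 0 else l (0, w) * F i w)" for i w
  note lin = linear_prod_split[OF is_form_lmult(1)]
  have "is_form (Suc d - i) (H i)" if "i \<le> Suc d" for i
  proof -
    have 1: "is_form (Suc d - i) (\<lambda>w. if i = 0 then 0 else l (1,0) * F (i - 1) w)"
    proof (cases i)
      case 0 then show ?thesis using is_form_zero by simp
    next
      case (Suc j) then show ?thesis using F(1) that is_form_cmult[of "d - j" "F j"] by simp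
    qed
    have 2: "is_form (Suc d - i) (\<lambda>w. if i = Suc d then 0 else l (0, w) * F i w)"
    proof (cases "i = Suc d")
      case True then show ?thesis using is_form_zero by simp
    next
      case False
      then have "is_form (Suc (d - i)) (\<lambda>w. l (0, w) * F i w)" using F(1) that
        by (intro is_form.is_form_lmult lin) auto
      then show ?thesis using False that by (simp add: Suc_diff_le)
    qed
    show ?thesis using is_form.is_form_add[OF 1 2] unfolding H_def .
  qed
  moreover have "l (x, w) * f (x, w) = (\<Sum>i\<le>Suc d. x ^ i * H i w)" for x w
  proof -
    have "(\<Sum>i\<le>Suc d. x ^ i * H i w)
        = (\<Sum>i\<le>Suc d. x ^ i * (if i = 0 then 0 else l (1,0) * F (i - 1) w))
        + (\<Sum>i\<le>Suc d. x ^ i * (if i = Suc d then 0 else l (0, w) * F i w))"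
      unfolding H_def by (simp only: distrib_left sum.distrib)
    also have "(\<Sum>i\<le>Suc d. x ^ i * (if i = 0 then 0 else l (1,0) * F (i - 1) w))
        = (\<Sum>i\<le>d. x * l (1,0) * (x ^ i * F i w))"
      by (subst sum.atMost_Suc_shift) (simp add: algebra_simps)
    also have "(\<Sum>i\<le>Suc d. x ^ i * (if i = Suc d then 0 else l (0, w) * F i w))
        = (\<Sum>i\<le>d. l (0,w) * (x ^ i * F i w))"
      by (simp add: mult.left_commute)
    also have "(\<Sum>i\<le>d. x * l (1,0) * (x ^ i * F i w)) + (\<Sum>i\<le>d. l (0,w) * (x ^ i * F i w))
       = l (x, w) * f (x, w)"
      by (simp only: F(2) lin(2)[of x w] sum_distrib_left[symmetric] distrib_right)
    finally show ?thesis by simp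
  qed
  ultimately show ?case by blast
qed

lemma is_linear_fst: "linear (fst :: 'a::real_vector \<times> 'b::real_vector \<Rightarrow> 'a)"
  by (rule linearI) auto
lemma is_linear_snd: "linear (snd :: 'a::real_vector \<times> 'b::real_vector \<Rightarrow> 'b)"
  by (rule linearI) auto

lemma is_form_factor_fst:
  fixes F :: "real \<times> 'b::real_vector \<Rightarrow> real"
  assumes "is_form (Suc d) F" and "\<And>w. F (0, w) = 0"
  shows "\<exists>G. is_form d G \<and> (\<forall>p. F p = fst p * G p)"
proof -
  obtain G where G: "\<And>i. i\<le>Suc d \<Longrightarrow> is_form (Suc d - i) (G i)"
    "\<And>x w. F (x, w) = (\<Sum>i\<le>Suc d. x ^ i * G i w)"
    using is_form_prod_expand[OF assms(1)] by blast
  have G0: "G 0 w = 0" for w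
    using assms(2)[of w] unfolding G(2) by (simp add: sum.atMost_Suc_shift del: sum.atMost_Suc)
  let ?H = "\<lambda>p. \<Sum>i\<le>d. fst p ^ i * G (Suc i) (snd p)"
  have "is_form d ?H"
  proof (rule is_form_sum)
    fix i assume "i \<in> {..d}"
    then have "is_form (i + (d - i)) (\<lambda>p. fst p ^ i * G (Suc i) (snd p))"
      using G(1)[of "Suc i"]
      by (intro is_form_mult is_form_linear_power is_linear_fst is_form_compose[OF _ is_linear_snd]) auto
    then show "is_form d (\<lambda>p. fst p ^ i * G (Suc i) (snd p))" using \<open>i \<in> {..d}\<close> by simp
  qed
  moreover have "F p = fst p * ?H p" for p
  proof -
    have "F p = (\<Sum>i\<le>Suc d. fst p ^ i * G i (snd p))" using G(2)[of "fst p" "snd p"] by simp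
    also have "\<dots> = fst p * ?H p"
      by (subst sum.atMost_Suc_shift) (simp add: G0 sum_distrib_left mult.assoc)
    finally show ?thesis .
  qed
  ultimately show ?thesis by blast
qed

text \<open>
  The complement of a hyperplane is dense, so inequalities obtained after cancelling a linear factor
  extend to its zero set.
\<close>

lemma nonneg_off_hyperplane:
  fixes p :: "'a::euclidean_space \<Rightarrow> real"
  assumes "linear l" "l v \<noteq> (0::real)" "continuous_on UNIV p" "\<And>w. l w \<noteq> 0 \<Longrightarrow> 0 \<le> p w"
  shows "0 \<le> p w"
proof (cases "l w = 0")
  case True
  have "continuous_on UNIV (\<lambda>t::real. p (w + t *\<^sub>R v))"
    by (intro continuous_on_compose2[OF assms(3)] continuous_intros) auto
  then have "((\<lambda>t::real. p (w + t *\<^sub>R v)) \<longlongrightarrow> p (w + 0 *\<^sub>R v)) (at 0)"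
    unfolding continuous_on_def by blast
  moreover have "\<forall>\<^sub>F t in at (0::real). 0 \<le> p (w + t *\<^sub>R v)"
  proof -
    have "t \<noteq> 0 \<Longrightarrow> 0 \<le> p (w + t *\<^sub>R v)" for t
      by (rule assms(4)) (simp add: linear_add[OF assms(1)] linear_scale[OF assms(1)] True assms(2))
    then show ?thesis by (simp add: eventually_at_filter)
  qed
  ultimately have "0 \<le> p (w + 0 *\<^sub>R v)" by (rule tendsto_lowerbound) simp
  then show ?thesis by simp
qed (rule assms(4))

lemma zero_off_hyperplane:
  fixes p :: "'a::euclidean_space \<Rightarrow> real"
  assumes "linear l" "l v \<noteq> (0::real)" "continuous_on UNIV p" "\<And>w. l w \<noteq> 0 \<Longrightarrow> p w = 0"
  shows "p w = 0"
proof -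
  have "0 \<le> - (p w)\<^sup>2"
    by (rule nonneg_off_hyperplane[OF assms(1,2)]) (auto intro!: continuous_intros assms)
  then show ?thesis by simp
qed

text \<open>
  Compare the minimum of \<open>P\<close> with the maximum of \<open>Q\<close> on the unit sphere; both have the same degree.
\<close>

lemma positive_form_dominates:
  fixes P Q :: "'a::euclidean_space \<Rightarrow> real"
  assumes P: "is_form d P" and Q: "is_form d Q" and d: "0 < d" and pos: "\<And>w. w \<noteq> 0 \<Longrightarrow> 0 < P w"
  shows "\<exists>e>0. \<forall>w. e * Q w \<le> P w"
proof -
  have ne: "sphere (0::'a) 1 \<noteq> {}" by simp
  obtain u where u: "u \<in> sphere 0 1" "\<And>w. w \<in> sphere 0 1 \<Longrightarrow> P u \<le> P w"
    using continuous_attains_inf[OF compact_sphere ne is_form_continuous[OF P]] by blast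
  obtain v where v: "v \<in> sphere 0 1" "\<And>w. w \<in> sphere 0 1 \<Longrightarrow> Q w \<le> Q v"
    using continuous_attains_sup[OF compact_sphere ne is_form_continuous[OF Q]] by blast
  have Pu: "0 < P u" using u(1) by (intro pos) auto
  define e where "e = P u / (\<bar>Q v\<bar> + 1)"
  have e: "0 < e" unfolding e_def using Pu by simp
  have "e * Q w \<le> P w" for w
  proof (cases "w = 0")
    case True then show ?thesis using is_form_at_0[OF P d] is_form_at_0[OF Q d] by simp
  next
    case False
    let ?u = "(1 / norm w) *\<^sub>R w"
    have us: "?u \<in> sphere 0 1" using False by simp
    have "w = norm w *\<^sub>R ?u" using False by simp
    have hP: "P w = norm w ^ d * P ?u" and hQ: "Q w = norm w ^ d * Q ?u"
      using is_form_homogeneous[OF P, of "norm w" ?u] is_form_homogeneous[OF Q, of "norm w" ?u] False by auto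
    have "e * Q ?u \<le> e * (\<bar>Q v\<bar> + 1)"
      using e v(2)[OF us] by (intro mult_left_mono) auto
    also have "\<dots> = P u" unfolding e_def by simp
    also have "\<dots> \<le> P ?u" using u(2)[OF us] .
    finally have "norm w ^ d * (e * Q ?u) \<le> norm w ^ d * P ?u"
      by (intro mult_left_mono) auto
    then show ?thesis unfolding hP hQ by (simp add: mult.left_commute)
  qed
  then show ?thesis using e by blast
qed

section \<open>Positive semidefinite binary forms and quadratic forms\<close>

text \<open>
  A linear functional whose kernel is the line spanned by \<open>v \<noteq> 0\<close>.
\<close>

definition det2 :: "real \<times> real \<Rightarrow> real \<times> real \<Rightarrow> real" where
  "det2 v w = fst w * snd v - snd w * fst v"

lemma det2_self: "det2 v v = 0" by (simp add: det2_def)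

lemma linear_det2: "linear (det2 v)"
  unfolding det2_def by (rule linearI) (auto simp: algebra_simps)

lemma det2_nonzero: "v \<noteq> 0 \<Longrightarrow> det2 v (snd v, - fst v) \<noteq> 0"
  unfolding det2_def by (simp add: prod_eq_iff) (metis add.commute power2_eq_square sum_power2_eq_zero_iff)

text \<open>
  Multiplication by the complex number \<open>v\<close> is a linear automorphism of the plane carrying \<open>(1, 0)\<close>
  to \<open>v\<close>; it moves a prescribed zero of a form to the first coordinate axis.
\<close>

lemma plane_frame:
  fixes v :: "real \<times> real"
  assumes "v \<noteq> 0"
  obtains T R :: "real \<times> real \<Rightarrow> real \<times> real"
  where "linear T" "linear R" "\<And>w. T (R w) = w" "\<And>w. R (T w) = w" "T (1, 0) = v"
proof -
  obtain a b where ab: "v = (a, b)" by (cases v)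
  define N where "N = a\<^sup>2 + b\<^sup>2"
  have N: "N \<noteq> 0" using assms ab unfolding N_def by (simp add: sum_power2_eq_zero_iff prod_eq_iff)
  define T :: "real \<times> real \<Rightarrow> real \<times> real" where
    "T p = (fst p * a - snd p * b, fst p * b + snd p * a)" for p
  define R :: "real \<times> real \<Rightarrow> real \<times> real" where
    "R p = ((fst p * a + snd p * b) / N, (snd p * a - fst p * b) / N)" for p
  have "linear T" unfolding T_def by (rule linearI) (auto simp: algebra_simps)
  moreover have "linear R" unfolding R_def
    by (rule linearI) (auto simp: algebra_simps add_divide_distrib diff_divide_distrib)
  moreover have "T (R p) = p" for p
  proof -
    obtain y z where p: "p = (y, z)" by (cases p)
    have "(y * a + z * b) / N * a - (z * a - y * b) / N * b = y * N / N"
      unfolding N_def by (simp add: diff_divide_distrib[symmetric] power2_eq_square algebra_simps)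
    moreover have "(y * a + z * b) / N * b + (z * a - y * b) / N * a = z * N / N"
      unfolding N_def by (simp add: add_divide_distrib[symmetric] power2_eq_square algebra_simps)
    ultimately show ?thesis unfolding T_def R_def p using N by simp
  qed
  moreover have "R (T p) = p" for p
  proof -
    obtain y z where p: "p = (y, z)" by (cases p)
    have 1: "(y * a - z * b) * a + (y * b + z * a) * b = y * N"
      unfolding N_def by (simp add: power2_eq_square algebra_simps)
    have 2: "(y * b + z * a) * a - (y * a - z * b) * b = z * N"
      unfolding N_def by (simp add: power2_eq_square algebra_simps)
    show ?thesis unfolding T_def R_def p fst_conv snd_conv 1 2 using N by simp
  qed
  moreover have "T (1, 0) = v" unfolding T_def ab by simp
  ultimately show ?thesis by (rule that)
qed

text \<open>
  In coordinates in which the zero \<open>v\<close> is \<open>(1, 0)\<close>, every monomial of the form contains the second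
  coordinate, and that coordinate is a multiple of \<open>l\<close>.
\<close>

lemma binary_form_factor:
  fixes f :: "real \<times> real \<Rightarrow> real"
  assumes f: "is_form (Suc d) f" and v: "f v = 0" "v \<noteq> 0"
    and l: "linear l" "l v = 0" "l u \<noteq> (0::real)"
  shows "\<exists>g. is_form d g \<and> (\<forall>w. f w = l w * g w)"
proof -
  obtain T R :: "real \<times> real \<Rightarrow> real \<times> real" where T: "linear T" and R: "linear R"
    and TR: "\<And>w. T (R w) = w" "\<And>w. R (T w) = w" and Tv: "T (1, 0) = v"
    using plane_frame[OF v(2)] by metis
  define sw :: "real \<times> real \<Rightarrow> real \<times> real" where "sw p = (snd p, fst p)" for p
  have sw: "linear sw" unfolding sw_def by (rule linearI) auto
  have Tsw: "linear (\<lambda>p. T (sw p))" using linear_compose[OF sw T] by (simp add: o_def)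
  have Rsw: "linear (\<lambda>w. sw (R w))" using linear_compose[OF R sw] by (simp add: o_def)
  have "f (T (sw (0, s))) = 0" for s
  proof -
    have "T (sw (0, s)) = s *\<^sub>R T (1, 0)" unfolding linear_scale[OF T, symmetric] by (simp add: sw_def)
    then show ?thesis using is_form_homogeneous[OF f, of s v] v(1) Tv by simp
  qed
  then obtain G where G: "is_form d G" "\<And>p. f (T (sw p)) = fst p * G p"
    using is_form_factor_fst[OF is_form_compose[OF f Tsw]] by blast
  define c where "c = l (T (0, 1))"
  have lw: "l w = snd (R w) * c" for w
  proof -
    have "w = T (fst (R w) *\<^sub>R (1, 0) + snd (R w) *\<^sub>R (0, 1))" using TR(1) by simp
    also have "\<dots> = fst (R w) *\<^sub>R v + snd (R w) *\<^sub>R T (0, 1)"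
      by (simp only: linear_add[OF T] linear_scale[OF T] Tv)
    finally have "l w = l (fst (R w) *\<^sub>R v + snd (R w) *\<^sub>R T (0, 1))" by simp
    then show ?thesis by (simp only: linear_add[OF l(1)] linear_scale[OF l(1)] l(2) c_def) simp
  qed
  then have c: "c \<noteq> 0" using l(3) by auto
  have "f w = l w * (1 / c * G (sw (R w)))" for w
    using G(2)[of "sw (R w)"] TR(1)[of w] c unfolding lw by (simp add: sw_def)
  moreover have "is_form d (\<lambda>w. 1 / c * G (sw (R w)))"
    by (intro is_form_cmult is_form_compose[OF G(1) Rsw])
  ultimately show ?thesis by (intro exI[of _ "\<lambda>w. 1 / c * G (sw (R w))"]) simp
qed

text \<open>
  Crossing the line \<open>l = 0\<close> at the zero \<open>v\<close> changes the sign of the factor \<open>l\<close>, so the cofactor \<open>g\<close> must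
  change its sign there too: \<open>g (v + w) * g (v - w) \<le> 0\<close>, and \<open>g v = 0\<close> by continuity. Thus \<open>g\<close> is again
  divisible by \<open>l\<close>.
\<close>

lemma binary_psd_form_factor:
  fixes f :: "real \<times> real \<Rightarrow> real"
  assumes f: "is_form (Suc (Suc d)) f" and psd: "\<And>w. 0 \<le> f w" and v: "f v = 0" "v \<noteq> 0"
    and l: "linear l" "l v = 0" "l u \<noteq> (0::real)"
  shows "\<exists>g. is_form d g \<and> (\<forall>w. f w = (l w)\<^sup>2 * g w) \<and> (\<forall>w. 0 \<le> g w)"
proof -
  obtain g where g: "is_form (Suc d) g" "\<And>w. f w = l w * g w"
    using binary_form_factor[OF f v l] by blast
  have cont: "continuous_on UNIV g" using is_form_continuous[OF g(1)] .
  have "0 \<le> - (g (v + 0) * g (v - 0))"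
  proof (rule nonneg_off_hyperplane[where p = "\<lambda>w. - (g (v + w) * g (v - w))", OF l(1,3)])
    show "continuous_on UNIV (\<lambda>w. - (g (v + w) * g (v - w)))"
      by (intro continuous_intros continuous_on_compose2[OF cont]) auto
    fix w assume w: "l w \<noteq> 0"
    have "0 \<le> l w * g (v + w)" "0 \<le> - l w * g (v - w)"
      using psd[of "v + w"] psd[of "v - w"] unfolding g(2) linear_add[OF l(1)] linear_diff[OF l(1)] l(2) by simp_all
    then have "0 \<le> (l w * g (v + w)) * (- l w * g (v - w))" by (rule mult_nonneg_nonneg)
    then have "0 \<le> (l w)\<^sup>2 * - (g (v + w) * g (v - w))" by (simp add: power2_eq_square mult_ac)
    then show "0 \<le> - (g (v + w) * g (v - w))" using w by (simp add: mult_le_0_iff[of "(l w)\<^sup>2"])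
  qed
  then have "g v = 0" by (auto simp: mult_le_0_iff)
  then obtain h where h: "is_form d h" "\<And>w. g w = l w * h w"
    using binary_form_factor[OF g(1) _ v(2) l] by blast
  have fh: "f w = (l w)\<^sup>2 * h w" for w by (simp add: g(2) h(2) power2_eq_square)
  have "0 \<le> h w" for w
  proof (rule nonneg_off_hyperplane[OF l(1,3) is_form_continuous[OF h(1)]])
    fix w assume "l w \<noteq> 0"
    then show "0 \<le> h w" using psd[of w] unfolding fh by (simp add: zero_le_mult_iff)
  qed
  then show ?thesis using h(1) fh by blast
qed

definition dominates_square :: "nat \<Rightarrow> ('a::real_vector \<Rightarrow> real) \<Rightarrow> bool" where
  "dominates_square k f \<longleftrightarrow> (\<exists>q. is_form k q \<and> (\<exists>x. q x \<noteq> 0) \<and> (\<forall>x. (q x)\<^sup>2 \<le> f x))"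

text \<open>
  Induction on the degree. A zero of \<open>f\<close> splits off the square of a linear form, and this square times
  a square below the cofactor is a square below \<open>f\<close>. Without zeros, \<open>f\<close> is bounded below by a multiple of
  the even power \<open>fst ^ (2 * k)\<close>.
\<close>

lemma binary_psd_dominates_square:
  fixes f :: "real \<times> real \<Rightarrow> real"
  assumes "is_form (2 * k) f" "\<And>w. 0 \<le> f w" "f u \<noteq> 0"
  shows "dominates_square k f"
  using assms
proof (induction k arbitrary: f u)
  case 0
  then have "f = (\<lambda>x. f 0)" using is_form_0 by simp
  then obtain c where c: "f = (\<lambda>x. c)" by blast
  then show ?case using 0 unfolding dominates_square_def
    by (intro exI[of _ "\<lambda>x. sqrt c"]) (auto intro: is_form_const)
next
  case (Suc k)
  show ?case
  proof (cases "\<exists>v. v \<noteq> 0 \<and> f v = 0")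
    case True
    then obtain v where v: "f v = 0" "v \<noteq> 0" by blast
    have "is_form (Suc (Suc (2 * k))) f" using Suc.prems(1) by simp
    then obtain g where g: "is_form (2 * k) g" "\<And>w. f w = (det2 v w)\<^sup>2 * g w" "\<And>w. 0 \<le> g w"
      using binary_psd_form_factor[of "2 * k" f v, OF _ Suc.prems(2) v linear_det2 det2_self det2_nonzero[OF v(2)]] by blast
    have "g u \<noteq> 0" using Suc.prems(3) g(2) by auto
    then obtain q x where q: "is_form k q" "q x \<noteq> 0" "\<And>w. (q w)\<^sup>2 \<le> g w"
      using Suc.IH[OF g(1,3)] unfolding dominates_square_def by blast
    have "\<exists>w. det2 v w * q w \<noteq> 0"
    proof (rule ccontr)
      assume "\<nexists>w. det2 v w * q w \<noteq> 0"
      then have "\<And>w. det2 v w \<noteq> 0 \<Longrightarrow> q w = 0" by auto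
      from zero_off_hyperplane[OF linear_det2 det2_nonzero[OF v(2)] is_form_continuous[OF q(1)] this, of x]
      show False using q(2) by simp
    qed
    moreover have "(det2 v w * q w)\<^sup>2 \<le> f w" for w
      unfolding g(2) power_mult_distrib by (intro mult_left_mono q(3)) simp
    ultimately show ?thesis unfolding dominates_square_def
      using is_form_lmult[OF linear_det2 q(1), of v] by (intro exI[of _ "\<lambda>w. det2 v w * q w"]) blast
  next
    case False
    have pw: "is_form j (\<lambda>w::real\<times>real. fst w ^ j)" for j
      by (rule is_form_linear_power[OF is_linear_fst])
    have "\<And>w. w \<noteq> 0 \<Longrightarrow> 0 < f w" using False Suc.prems(2) by (metis less_eq_real_def)
    from positive_form_dominates[OF Suc.prems(1) pw _ this]
    obtain e where e: "e > 0" "\<And>w. e * fst w ^ (2 * Suc k) \<le> f w" by auto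
    have "(sqrt e * fst w ^ Suc k)\<^sup>2 \<le> f w" for w
      using e(2)[of w] e(1) by (simp only: power_mult_distrib power_mult[symmetric] mult.commute[of "Suc k" 2]) simp
    then show ?thesis unfolding dominates_square_def using e(1)
      by (intro exI[of _ "\<lambda>w. sqrt e * fst w ^ Suc k"] conjI exI[of _ "(1,0)"] is_form_cmult pw) auto
  qed
qed

text \<open>
  With the polar form \<open>B\<close>, this is the Cauchy-Schwarz inequality \<open>(B u w)\<^sup>2 \<le> f u * f w\<close>.
\<close>

lemma quadratic_psd_dominates_square:
  fixes f :: "'a::real_vector \<Rightarrow> real"
  assumes f: "is_form 2 f" and psd: "\<And>w. 0 \<le> f w" and u: "f u \<noteq> 0"
  shows "dominates_square 1 f"
proof -
  obtain B where B: "\<And>v. linear (B v)" "\<And>v w. B v w = (B w v :: real)" "\<And>v. f v = B v v"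
    using is_form_two_bilinear[OF f] by blast
  have fu: "0 < f u" using psd[of u] u by simp
  have "(B u w / sqrt (f u))\<^sup>2 \<le> f w" for w
  proof -
    \<comment> \<open>The minimiser of \<open>f\<close> on the line through \<open>w\<close> in direction \<open>u\<close>.\<close>
    define t where "t = - B u w / f u"
    have B1: "B (w + t *\<^sub>R u) x = B w x + t * B u x" for x
      by (subst B(2)) (simp only: linear_add[OF B(1)] linear_scale[OF B(1)] B(2)[of x] real_scaleR_def)
    have "f (w + t *\<^sub>R u) = B w w + 2 * t * B u w + t\<^sup>2 * B u u"
      unfolding B(3) B1 by (simp only: linear_add[OF B(1)] linear_scale[OF B(1)] B(2)[of w u] real_scaleR_def)
        (simp add: algebra_simps power2_eq_square)
    also have "\<dots> = f w - (B u w)\<^sup>2 / f u"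
      unfolding B(3)[symmetric] t_def using fu by (simp add: field_simps power2_eq_square)
    finally have "(B u w)\<^sup>2 / f u \<le> f w" using psd[of "w + t *\<^sub>R u"] by simp
    then show ?thesis using fu by (simp add: power_divide)
  qed
  moreover have "is_form 1 (\<lambda>w. B u w / sqrt (f u))"
    using is_form_cmult[OF is_form_linear[OF B(1)[of u]], of "1 / sqrt (f u)"] by simp
  moreover have "B u u / sqrt (f u) \<noteq> 0" using fu B(3)[of u] by simp
  ultimately show ?thesis unfolding dominates_square_def by blast
qed

section \<open>Positive semidefinite ternary quartics\<close>

lemma nonneg_cubic_leading_zero:
  fixes a b c d :: real
  assumes "\<And>x. 0 \<le> a * x ^ 3 + b * x\<^sup>2 + c * x + d"
  shows "a = 0"
proof (rule ccontr)
  assume a: "a \<noteq> 0"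
  define M where "M = \<bar>b\<bar> + \<bar>c\<bar> + \<bar>d\<bar>"
  \<comment> \<open>For \<open>\<bar>x\<bar> = X \<ge> 1\<close> the cubic term has absolute value \<open>(M + \<bar>a\<bar>) X\<^sup>2\<close>,
      which exceeds the bound \<open>M X\<^sup>2\<close> on the other terms; the sign of \<open>x\<close> makes it negative.\<close>
  define X where "X = M / \<bar>a\<bar> + 1"
  define x where "x = - sgn a * X"
  have M: "0 \<le> M" unfolding M_def by simp
  have X: "1 \<le> X" unfolding X_def using M by simp
  have x2: "x\<^sup>2 = X\<^sup>2" unfolding x_def using a by (simp add: power_mult_distrib sgn_if)
  have "a * x ^ 3 = - (\<bar>a\<bar> * X) * X\<^sup>2"
    unfolding x_def using a by (cases "0 < a") (auto simp: power3_eq_cube power2_eq_square sgn_if)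
  also have "\<bar>a\<bar> * X = M + \<bar>a\<bar>" unfolding X_def using a by (simp add: distrib_left)
  finally have 1: "a * x ^ 3 = - (M + \<bar>a\<bar>) * X\<^sup>2" .
  have "X \<le> X\<^sup>2" using X by (simp add: power2_eq_square)
  have xX: "\<bar>x\<bar> = X" unfolding x_def using a X by (simp add: abs_mult abs_sgn_eq)
  have "c * x \<le> \<bar>c\<bar> * \<bar>x\<bar>" by (metis abs_ge_self abs_mult)
  also have "\<dots> \<le> \<bar>c\<bar> * X\<^sup>2" unfolding xX using \<open>X \<le> X\<^sup>2\<close> by (intro mult_left_mono) auto
  finally have 2: "c * x \<le> \<bar>c\<bar> * X\<^sup>2" .
  have 3: "b * x\<^sup>2 \<le> \<bar>b\<bar> * X\<^sup>2" unfolding x2 by (intro mult_right_mono) auto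
  have "\<bar>d\<bar> * 1 \<le> \<bar>d\<bar> * X\<^sup>2" using X \<open>X \<le> X\<^sup>2\<close> by (intro mult_left_mono) auto
  then have 4: "d \<le> \<bar>d\<bar> * X\<^sup>2" by simp
  have "a * x ^ 3 + b * x\<^sup>2 + c * x + d \<le> - (M + \<bar>a\<bar>) * X\<^sup>2 + \<bar>b\<bar> * X\<^sup>2 + \<bar>c\<bar> * X\<^sup>2 + \<bar>d\<bar> * X\<^sup>2"
    using 1 2 3 4 by linarith
  also have "\<dots> = - \<bar>a\<bar> * X\<^sup>2" unfolding M_def by (simp add: algebra_simps)
  also have "\<dots> < 0" using a X by simp
  finally show False using assms[of x] by linarith
qed

lemma nonneg_quadratic:
  fixes f g h :: real
  assumes "\<And>x. 0 \<le> x\<^sup>2 * f + 2 * x * g + h"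
  shows "0 \<le> f" and "0 \<le> h" and "g\<^sup>2 \<le> f * h"
proof -
  show h: "0 \<le> h" using assms[of 0] by simp
  show f: "0 \<le> f"
  proof (rule ccontr)
    assume "\<not> 0 \<le> f"
    then have f: "f < 0" by simp
    \<comment> \<open>At this distance the quadratic term outweighs \<open>h\<close>; the sign of \<open>x\<close> makes the mixed term nonpositive.\<close>
    define X where "X = 1 + h / \<bar>f\<bar>"
    have X: "1 \<le> X" unfolding X_def using h by simp
    define x where "x = (if 0 \<le> g then - X else X)"
    have "2 * x * g \<le> 0" unfolding x_def using X by (auto simp: mult_nonneg_nonpos mult_nonpos_nonneg)
    moreover have "x\<^sup>2 * f \<le> X * f" unfolding x_def using X f
      by (intro mult_right_mono_neg) (auto simp: power2_eq_square)
    moreover have "X * f = f - h" unfolding X_def using f by (simp add: field_simps)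
    ultimately show False using assms[of x] f by linarith
  qed
  show "g\<^sup>2 \<le> f * h"
  proof (cases "f = 0")
    case True
    have "g = 0"
    proof (rule ccontr)
      assume g: "g \<noteq> 0"
      have "2 * (- (h + 1) / (2 * g)) * g = - (h + 1)" using g by simp
      then show False using assms[of "- (h + 1) / (2 * g)"] True by simp
    qed
    then show ?thesis using True by simp
  next
    case False
    then have "0 < f" using f by simp
    have "0 \<le> f * ((- g / f)\<^sup>2 * f + 2 * (- g / f) * g + h)"
      by (intro mult_nonneg_nonneg f assms)
    also have "\<dots> = f * h - g\<^sup>2" using \<open>0 < f\<close> by (simp add: field_simps power2_eq_square)
    finally show ?thesis by simp
  qed
qed

lemma dominates_square_compose:
  assumes "dominates_square k (\<lambda>x. F (T x))" "linear T" "linear R" "\<And>x. T (R x) = x" "\<And>x. R (T x) = x"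
  shows "dominates_square k F"
proof -
  obtain q x where q: "is_form k q" "q x \<noteq> 0" "\<And>w. (q w)\<^sup>2 \<le> F (T w)"
    using assms(1) unfolding dominates_square_def by blast
  have "(q (R w))\<^sup>2 \<le> F w" for w using q(3)[of "R w"] assms(4) by simp
  moreover have "q (R (T x)) \<noteq> 0" using q(2) assms(5) by simp
  ultimately show ?thesis unfolding dominates_square_def
    using is_form_compose[OF q(1) assms(3)] by blast
qed

lemma binary_psd_quadratic_zero:
  fixes f :: "real \<times> real \<Rightarrow> real"
  assumes "is_form 2 f" "\<And>w. 0 \<le> f w" "f v = 0" "v \<noteq> 0"
  shows "\<exists>l. linear l \<and> l v = 0 \<and> (\<forall>w. f w = (l w)\<^sup>2)"
proof -
  have "is_form (Suc (Suc 0)) f" using assms(1) by (simp add: numeral_2_eq_2)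
  then obtain g where g: "is_form 0 g" "\<And>w. f w = (det2 v w)\<^sup>2 * g w" "\<And>w. 0 \<le> g w"
    using binary_psd_form_factor[where f = f, OF _ assms(2-4) linear_det2 det2_self det2_nonzero[OF assms(4)]] by blast
  obtain c where c: "g = (\<lambda>x. c)" using is_form_0[OF g(1)] by blast
  have "0 \<le> c" using g(3) c by simp
  then have "f w = (sqrt c * det2 v w)\<^sup>2" for w using g(2) c by (simp add: power_mult_distrib)
  moreover have "linear (\<lambda>w. sqrt c * det2 v w)"
    using is_form_one_linear[OF is_form_cmult[OF is_form_linear[OF linear_det2]]] .
  ultimately show ?thesis by (intro exI[of _ "\<lambda>w. sqrt c * det2 v w"]) (simp add: det2_self)
qed

text \<open>
  A binary form whose square is below \<open>l\<^sup>2 h\<close> vanishes where \<open>l\<close> does, so it is divisible by \<open>l\<close>; the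
  cancelled inequality holds off the line \<open>l = 0\<close> and hence everywhere.
\<close>

lemma divide_by_linear_square:
  fixes g h :: "real \<times> real \<Rightarrow> real"
  assumes l: "linear l" "l v = 0" "l u \<noteq> (0::real)" and v: "v \<noteq> 0"
    and g: "is_form (Suc d) g" and h: "continuous_on UNIV h" and le: "\<And>w. (g w)\<^sup>2 \<le> (l w)\<^sup>2 * h w"
  shows "\<exists>k. is_form d k \<and> (\<forall>w. g w = l w * k w) \<and> (\<forall>w. (k w)\<^sup>2 \<le> h w)"
proof -
  have "g v = 0" using le[of v] l(2) by simp
  then obtain k where k: "is_form d k" "\<And>w. g w = l w * k w"
    using binary_form_factor[OF g _ v l] by blast
  have "0 \<le> h w - (k w)\<^sup>2" for w
  proof (rule nonneg_off_hyperplane[OF l(1,3)])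
    show "continuous_on UNIV (\<lambda>w. h w - (k w)\<^sup>2)"
      by (intro continuous_intros h is_form_continuous[OF k(1)])
    fix w assume "l w \<noteq> 0"
    moreover have "0 \<le> (l w)\<^sup>2 * (h w - (k w)\<^sup>2)"
      using le[of w] unfolding k(2) by (simp add: algebra_simps power_mult_distrib)
    ultimately show "0 \<le> h w - (k w)\<^sup>2" by (simp add: zero_le_mult_iff)
  qed
  then show ?thesis using k by (intro exI[of _ k]) (simp add: algebra_simps)
qed

text \<open>
  The zero on the axis kills the coefficient of \<open>x ^ 4\<close>. On every line parallel to that axis there
  remains a nonnegative cubic polynomial, whose leading coefficient must vanish too.
\<close>

lemma ternary_quartic_expand:
  fixes F :: "real \<times> real \<times> real \<Rightarrow> real"
  assumes F: "is_form 4 F" and psd: "\<And>p. 0 \<le> F p" and z: "F (1, 0) = 0"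
  shows "\<exists>f g h. is_form 2 f \<and> is_form 3 g \<and> is_form 4 h \<and>
    (\<forall>x w. F (x, w) = x\<^sup>2 * f w + 2 * x * g w + h w)"
proof -
  obtain G where G: "\<And>i. i \<le> 4 \<Longrightarrow> is_form (4 - i) (G i)"
    "\<And>x w. F (x, w) = (\<Sum>i\<le>4. x ^ i * G i w)"
    using is_form_prod_expand[OF F] by blast
  have expand: "F (x, w) = G 0 w + x * G 1 w + x\<^sup>2 * G 2 w + x ^ 3 * G 3 w + x ^ 4 * G 4 w" for x w
    unfolding G(2) by (simp add: eval_nat_numeral)
  have "is_form 0 (G 4)" using G(1)[of 4] by simp
  then have G4: "G 4 w = G 4 0" for w using is_form_0 by metis
  have z': "G i 0 = 0" if "i < 4" for i using is_form_at_0[OF G(1)[of i]] that by simp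
  have "G 4 0 = 0" using z expand[of 1 0] z'[of 0] z'[of 1] z'[of 2] z'[of 3] by simp
  then have G4: "G 4 w = 0" for w using G4 by simp
  have G3: "G 3 w = 0" for w
  proof (rule nonneg_cubic_leading_zero)
    fix x show "0 \<le> G 3 w * x ^ 3 + G 2 w * x\<^sup>2 + G 1 w * x + G 0 w"
      using psd[of "(x, w)"] unfolding expand G4 by (simp add: algebra_simps)
  qed
  have "F (x, w) = x\<^sup>2 * G 2 w + 2 * x * (1/2 * G 1 w) + G 0 w" for x w
    unfolding expand G3 G4 by simp
  moreover have "is_form 3 (\<lambda>w. 1/2 * G 1 w)" using is_form_cmult[OF G(1)[of 1], of "1/2"] by simp
  moreover have "is_form 2 (G 2)" "is_form 4 (G 0)" using G(1)[of 2] G(1)[of 0] by auto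
  ultimately show ?thesis by blast
qed

lemma is_form_snd_part: "is_form d f \<Longrightarrow> is_form d (\<lambda>p. f (snd p))"
  by (rule is_form_compose[OF _ is_linear_snd])

text \<open>
  If the discriminant condition \<open>g\<^sup>2 \<le> f h\<close> meets a zero of \<open>f\<close> outside the origin, then \<open>f = l\<^sup>2\<close>. Either
  \<open>l = 0\<close>, so that \<open>F = h\<close> is a binary form, or \<open>g\<close> is divisible by \<open>l\<close> and one completes the square:
  \<open>F = (x l + g / l)\<^sup>2 + (h - (g / l)\<^sup>2)\<close> with a nonnegative second term.
\<close>

lemma ternary_quartic_degenerate:
  fixes F :: "real \<times> real \<times> real \<Rightarrow> real"
  assumes f: "is_form 2 f" and g: "is_form 3 g" and h: "is_form 4 h"
    and F: "\<And>x w. F (x, w) = x\<^sup>2 * f w + 2 * x * g w + h w"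
    and psd: "\<And>p. 0 \<le> F p" and nz: "F u \<noteq> 0" and v: "f v = 0" "v \<noteq> 0"
  shows "dominates_square 2 F"
proof -
  have disc: "0 \<le> f w" "0 \<le> h w" "(g w)\<^sup>2 \<le> f w * h w" for w
    using nonneg_quadratic[of "f w" "g w" "h w"] psd F by metis+
  obtain l where l: "linear l" "l v = 0" "\<And>w. f w = (l w)\<^sup>2"
    using binary_psd_quadratic_zero[OF f disc(1) v] by blast
  show ?thesis
  proof (cases "\<forall>w. l w = 0")
    case True
    then have fg: "f w = 0" "g w = 0" for w using l(3)[of w] disc(3)[of w] True[rule_format, of w] by simp_all
    have "h (snd u) \<noteq> 0" using nz F[of "fst u" "snd u"] fg by simp
    then have "dominates_square 2 h"
      using binary_psd_dominates_square[of 2 h] h disc(2) by simp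
    then obtain q x where q: "is_form 2 q" "q x \<noteq> 0" "\<And>w. (q w)\<^sup>2 \<le> h w"
      unfolding dominates_square_def by blast
    have "(q (snd p))\<^sup>2 \<le> F p" for p
      using q(3)[of "snd p"] F[of "fst p" "snd p"] fg by simp
    moreover have "q (snd (0::real, x)) \<noteq> 0" using q(2) by simp
    ultimately show ?thesis unfolding dominates_square_def using is_form_snd_part[OF q(1)] by blast
  next
    case False
    then obtain w1 where w1: "l w1 \<noteq> 0" by blast
    have "is_form (Suc 2) g" using g by simp
    moreover have "(g w)\<^sup>2 \<le> (l w)\<^sup>2 * h w" for w using disc(3)[of w] unfolding l(3) .
    ultimately obtain g2 where g2: "is_form 2 g2" and gl: "\<And>w. g w = l w * g2 w"
      and le: "\<And>w. (g2 w)\<^sup>2 \<le> h w"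
      using divide_by_linear_square[OF l(1,2) w1 v(2) _ is_form_continuous[OF h]] by blast
    have "(x * l w + g2 w)\<^sup>2 \<le> F (x, w)" for x w
    proof -
      have "F (x, w) = (x * l w + g2 w)\<^sup>2 + (h w - (g2 w)\<^sup>2)"
        unfolding F l(3) gl by (simp add: power2_eq_square algebra_simps)
      then show ?thesis using le[of w] by simp
    qed
    then have "(fst p * l (snd p) + g2 (snd p))\<^sup>2 \<le> F p" for p
      by (metis prod.collapse)
    moreover have "\<exists>p. fst p * l (snd p) + g2 (snd p) \<noteq> 0"
    proof (cases "g2 w1 = 0")
      case True then show ?thesis using w1 by (intro exI[of _ "(1, w1)"]) simp
    next
      case False then show ?thesis by (intro exI[of _ "(0, w1)"]) simp
    qed
    moreover have "is_form 2 (\<lambda>p::real\<times>real\<times>real. fst p * l (snd p) + g2 (snd p))"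
      using is_form_lmult[OF is_linear_fst is_form_snd_part[OF is_form_linear[OF l(1)]]]
      by (intro is_form_add is_form_snd_part[OF g2]) (simp add: numeral_2_eq_2)
    ultimately show ?thesis unfolding dominates_square_def by blast
  qed
qed

text \<open>
  The second zero makes \<open>h\<close> divisible by \<open>z\<^sup>2\<close> and \<open>g\<close> by \<open>z\<close>, where \<open>z\<close> is the last coordinate, so
  \<open>F = x\<^sup>2 f + 2 x z j + z\<^sup>2 k\<close> with binary quadratic forms \<open>f\<close>, \<open>j\<close>, \<open>k\<close>. With \<open>f\<close> positive definite,
  \<open>f F = (x f + z j)\<^sup>2 + z\<^sup>2 (f k - j\<^sup>2)\<close>. If \<open>f k - j\<^sup>2\<close> has no zero, it exceeds a multiple of \<open>f z\<^sup>2\<close> and \<open>F\<close>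
  exceeds a multiple of \<open>z ^ 4\<close>. If it vanishes at \<open>v\<close>, a shear in the variable \<open>x\<close> by a multiple \<open>al\<close> of
  \<open>z\<close> turns \<open>k\<close> into a semidefinite form with the zero \<open>v\<close>, that is, into the square of a linear form \<open>l\<close>, and
  one completes the square with respect to \<open>z l\<close>; for \<open>l = 0\<close>, what remains is \<open>f\<close> times the square of a linear
  form.
\<close>

lemma ternary_quartic_two_zeros:
  fixes F :: "real \<times> real \<times> real \<Rightarrow> real"
  assumes form: "is_form 4 F" and psd: "\<And>p. 0 \<le> F p" and nz: "F u \<noteq> 0"
    and z1: "F (1, 0) = 0" and z2: "F (0, 1, 0) = 0"
  shows "dominates_square 2 F"
proof -
  obtain f g h where f: "is_form 2 f" and g: "is_form 3 g" and h: "is_form 4 h"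
    and F: "\<And>x w. F (x, w) = x\<^sup>2 * f w + 2 * x * g w + h w"
    using ternary_quartic_expand[OF form psd z1] by blast
  show ?thesis
  proof (cases "\<exists>v. f v = 0 \<and> v \<noteq> 0")
    case True
    then show ?thesis using ternary_quartic_degenerate[OF f g h F psd nz] by blast
  next
    case False
    have disc: "0 \<le> f w" "0 \<le> h w" "(g w)\<^sup>2 \<le> f w * h w" for w
      using nonneg_quadratic[of "f w" "g w" "h w"] psd F by metis+
    have fpos: "0 < f w" if "w \<noteq> 0" for w using False disc(1)[of w] that by (metis less_eq_real_def)
    have e: "(1::real, 0::real) \<noteq> 0" by (simp add: prod_eq_iff)
    have sn: "snd (1::real, 0::real) = 0" "snd (0::real, 1::real) \<noteq> 0" by simp_all
    have h0: "h (1, 0) = 0" using z2 F[of 0 "(1,0)"] by simp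
    have g0: "g (1, 0) = 0" using disc(3)[of "(1,0)"] h0 by simp
    have "is_form (Suc (Suc 2)) h" using h by (simp add: numeral_eq_Suc)
    then obtain k where k: "is_form 2 k" "\<And>w. h w = (snd w)\<^sup>2 * k w" "\<And>w. 0 \<le> k w"
      using binary_psd_form_factor[where f = h, OF _ disc(2) h0 e is_linear_snd sn] by blast
    have "is_form (Suc 2) g" using g by simp
    then obtain j where j: "is_form 2 j" "\<And>w. g w = snd w * j w"
      using binary_form_factor[where f = g, OF _ g0 e is_linear_snd sn] by blast
    have D: "0 \<le> f w * k w - (j w)\<^sup>2" for w
    proof (rule nonneg_off_hyperplane[OF is_linear_snd, of "(0,1)"])
      show "continuous_on UNIV (\<lambda>w. f w * k w - (j w)\<^sup>2)"
        by (intro continuous_intros is_form_continuous[OF f] is_form_continuous[OF k(1)] is_form_continuous[OF j(1)])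
      fix w :: "real \<times> real" assume "snd w \<noteq> 0"
      moreover have "0 \<le> (snd w)\<^sup>2 * (f w * k w - (j w)\<^sup>2)"
        using disc(3)[of w] unfolding k(2) j(2) by (simp add: algebra_simps power_mult_distrib)
      ultimately show "0 \<le> f w * k w - (j w)\<^sup>2" by (simp add: zero_le_mult_iff)
    qed simp
    have F': "F (x, w) = x\<^sup>2 * f w + 2 * x * snd w * j w + (snd w)\<^sup>2 * k w" for x w
      unfolding F k(2) j(2) by simp
    show ?thesis
    proof (cases "\<exists>v. v \<noteq> 0 \<and> f v * k v - (j v)\<^sup>2 = 0")
      case False
      have Dpos: "\<And>w. w \<noteq> 0 \<Longrightarrow> 0 < f w * k w - (j w)\<^sup>2" using False D by (metis less_eq_real_def)
      have formD: "is_form (2 + 2) (\<lambda>w. f w * k w - (j w)\<^sup>2)"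
        using is_form_diff[OF is_form_mult[OF f k(1)]] is_form_power[OF j(1), of 2] by simp
      have sndform: "is_form n (\<lambda>w::real\<times>real. snd w ^ n)" for n
        by (rule is_form_linear_power[OF is_linear_snd])
      have formE: "is_form (2 + 2) (\<lambda>w. f w * (snd w)\<^sup>2)" by (rule is_form_mult[OF f sndform])
      obtain e where e: "0 < e" "\<And>w. e * (f w * (snd w)\<^sup>2) \<le> f w * k w - (j w)\<^sup>2"
        using positive_form_dominates[OF formD formE _ Dpos] by auto
      have le: "(sqrt e * (snd w)\<^sup>2)\<^sup>2 \<le> F (x, w)" for x w
      proof (cases "w = 0")
        case True then show ?thesis using psd by simp
      next
        case False
        have "f w * (e * ((snd w)\<^sup>2)\<^sup>2) = (snd w)\<^sup>2 * (e * (f w * (snd w)\<^sup>2))"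
          by (simp add: power2_eq_square)
        also have "\<dots> \<le> (snd w)\<^sup>2 * (f w * k w - (j w)\<^sup>2)" by (intro mult_left_mono e) simp
        also have "\<dots> \<le> (x * f w + snd w * j w)\<^sup>2 + (snd w)\<^sup>2 * (f w * k w - (j w)\<^sup>2)" by simp
        also have "\<dots> = f w * F (x, w)" unfolding F' by (simp add: power2_eq_square algebra_simps)
        finally have "e * ((snd w)\<^sup>2)\<^sup>2 \<le> F (x, w)" using fpos[OF False] by simp
        then show ?thesis using e(1) by (simp add: power_mult_distrib)
      qed
      have "(sqrt e * (snd (snd p))\<^sup>2)\<^sup>2 \<le> F p" for p using le[of "snd p" "fst p"] by simp
      moreover have "sqrt e * (snd (snd (0::real, 0::real, 1)))\<^sup>2 \<noteq> 0" using e(1) by simp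
      ultimately show ?thesis unfolding dominates_square_def
        using is_form_cmult[OF is_form_snd_part[OF sndform[of 2]], of "sqrt e"] by blast
    next
      case True
      then obtain v where v: "v \<noteq> 0" "f v * k v - (j v)\<^sup>2 = 0" by blast
      \<comment> \<open>This choice makes \<open>j + al f\<close> vanish at \<open>v\<close>.\<close>
      define al where "al = - j v / f v"
      define h2 where "h2 w = k w + 2 * al * j w + al\<^sup>2 * f w" for w
      define g2 where "g2 w = j w + al * f w" for w
      have fg: "is_form 2 h2" "is_form 2 g2" unfolding h2_def g2_def
        by (intro is_form_add is_form_cmult f j(1) k(1))+
      have D2: "f w * h2 w - (g2 w)\<^sup>2 = f w * k w - (j w)\<^sup>2" for w
        unfolding h2_def g2_def by (simp add: power2_eq_square algebra_simps)
      have h2v: "h2 v = 0"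
      proof -
        have "g2 v = 0" unfolding g2_def al_def using fpos[OF v(1)] by simp
        then have "f v * h2 v = 0" using D2[of v] v(2) by simp
        then show ?thesis using fpos[OF v(1)] by simp
      qed
      have g2h2: "(g2 w)\<^sup>2 \<le> f w * h2 w" for w using D2[of w] D[of w] by simp
      have h2nn: "0 \<le> h2 w" for w
      proof (cases "w = 0")
        case True then show ?thesis using is_form_at_0[OF fg(1)] by simp
      next
        case False
        have "0 \<le> f w * h2 w" using g2h2[of w] by (meson order_trans zero_le_power2)
        then show ?thesis using fpos[OF False] by (simp add: zero_le_mult_iff)
      qed
      obtain l where l: "linear l" "l v = 0" "\<And>w. h2 w = (l w)\<^sup>2"
        using binary_psd_quadratic_zero[OF fg(1) h2nn h2v v(1)] by blast
      have F2: "F (x, w) = (x - al * snd w)\<^sup>2 * f w + 2 * (x - al * snd w) * snd w * g2 w + (snd w)\<^sup>2 * h2 w" for x w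
        unfolding F' h2_def g2_def by (simp add: power2_eq_square algebra_simps)
      have lX: "linear (\<lambda>p::real\<times>real\<times>real. fst p - al * snd (snd p))"
        by (rule linearI) (auto simp: algebra_simps)
      show ?thesis
      proof (cases "\<forall>w. l w = 0")
        case True
        then have hg: "h2 w = 0" "g2 w = 0" for w
          using l(3)[of w] g2h2[of w] True[rule_format, of w] by simp_all
        have "dominates_square 1 f"
          by (rule quadratic_psd_dominates_square[OF f disc(1), of v]) (use fpos[OF v(1)] in simp)
        then obtain q y where q: "is_form 1 q" "q y \<noteq> 0" "\<And>w. (q w)\<^sup>2 \<le> f w"
          unfolding dominates_square_def by blast
        have "((x - al * snd w) * q w)\<^sup>2 \<le> F (x, w)" for x w
          unfolding F2 hg power_mult_distrib using mult_left_mono[OF q(3)[of w], of "(x - al * snd w)\<^sup>2"] by simp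
        then have "((fst p - al * snd (snd p)) * q (snd p))\<^sup>2 \<le> F p" for p by (metis prod.collapse)
        moreover have "(fst (1 + al * snd y, y) - al * snd (snd (1 + al * snd y, y))) * q (snd (1 + al * snd y, y)) \<noteq> 0"
          using q(2) by simp
        moreover have "is_form 2 (\<lambda>p::real\<times>real\<times>real. (fst p - al * snd (snd p)) * q (snd p))"
          using is_form_lmult[OF lX is_form_snd_part[OF q(1)]] by (simp add: numeral_2_eq_2)
        ultimately show ?thesis unfolding dominates_square_def by blast
      next
        case False
        then obtain w1 where w1: "l w1 \<noteq> 0" by blast
        have "is_form (Suc 1) g2" using fg(2) by (simp add: numeral_2_eq_2)
        moreover have "(g2 w)\<^sup>2 \<le> (l w)\<^sup>2 * f w" for w using g2h2[of w] unfolding l(3) by (simp add: mult.commute)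
        ultimately obtain g4 where g4: "is_form 1 g4" and gl: "\<And>w. g2 w = l w * g4 w"
          and nn: "\<And>w. (g4 w)\<^sup>2 \<le> f w"
          using divide_by_linear_square[OF l(1,2) w1 v(1) _ is_form_continuous[OF f]] by blast
        have "(snd w * l w + (x - al * snd w) * g4 w)\<^sup>2 \<le> F (x, w)" for x w
        proof -
          have "F (x, w) = (snd w * l w + (x - al * snd w) * g4 w)\<^sup>2 + (x - al * snd w)\<^sup>2 * (f w - (g4 w)\<^sup>2)"
            unfolding F2 l(3) gl by (simp add: power2_eq_square algebra_simps)
          then show ?thesis using nn[of w] by simp
        qed
        then have "(snd (snd p) * l (snd p) + (fst p - al * snd (snd p)) * g4 (snd p))\<^sup>2 \<le> F p" for p
          by (metis prod.collapse)
        moreover have "\<exists>p. snd (snd p) * l (snd p) + (fst p - al * snd (snd p)) * g4 (snd p) \<noteq> 0"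
        proof (rule ccontr)
          assume "\<nexists>p. snd (snd p) * l (snd p) + (fst p - al * snd (snd p)) * g4 (snd p) \<noteq> 0"
          then have "\<forall>p. snd (snd p) * l (snd p) + (fst p - al * snd (snd p)) * g4 (snd p) = 0" by blast
          from spec[OF this, of "(al * snd w, w)" for w] have "snd w * l w = 0" for w by simp
          then have off: "l w = 0" if "snd w \<noteq> 0" for w using that by (metis mult_eq_0_iff)
          have "l w1 = 0"
            by (rule zero_off_hyperplane[OF is_linear_snd _ is_form_continuous[OF is_form_linear[OF l(1)]], of "(0, 1)"])
               (use off in simp_all)
          then show False using w1 by simp
        qed
        moreover have "is_form 2 (\<lambda>p::real\<times>real\<times>real. snd (snd p) * l (snd p) + (fst p - al * snd (snd p)) * g4 (snd p))"
          unfolding Suc_1[symmetric]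
          by (intro is_form_add is_form_lmult[OF lX is_form_snd_part[OF g4]]
              is_form_lmult[OF _ is_form_snd_part[OF is_form_linear[OF l(1)]]] linear_compose[OF is_linear_snd is_linear_snd, unfolded o_def])
        ultimately show ?thesis unfolding dominates_square_def by blast
      qed
    qed
  qed
qed

text \<open>
  Here \<open>f F = (x f + g)\<^sup>2 + (f h - g\<^sup>2)\<close>. If \<open>f\<close> is positive definite and \<open>f h - g\<^sup>2\<close> has a zero \<open>v\<close>, then
  \<open>F\<close> has a second zero above \<open>v\<close>, which a linear substitution moves to the second axis. If
  \<open>f h - g\<^sup>2\<close> has no zero, it exceeds a multiple of \<open>f ^ 3\<close>, and \<open>F\<close> exceeds a multiple of \<open>f\<^sup>2\<close>.
\<close>

lemma ternary_quartic_one_zero: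
  fixes F :: "real \<times> real \<times> real \<Rightarrow> real"
  assumes form: "is_form 4 F" and psd: "\<And>p. 0 \<le> F p" and nz: "F u \<noteq> 0"
    and z1: "F (1, 0) = 0"
  shows "dominates_square 2 F"
proof -
  obtain f g h where f: "is_form 2 f" and g: "is_form 3 g" and h: "is_form 4 h"
    and F: "\<And>x w. F (x, w) = x\<^sup>2 * f w + 2 * x * g w + h w"
    using ternary_quartic_expand[OF form psd z1] by blast
  have disc: "0 \<le> f w" "0 \<le> h w" "(g w)\<^sup>2 \<le> f w * h w" for w
    using nonneg_quadratic[of "f w" "g w" "h w"] psd F by metis+
  consider "\<exists>v. f v = 0 \<and> v \<noteq> 0"
    | "\<And>w. w \<noteq> 0 \<Longrightarrow> 0 < f w" "\<exists>v. v \<noteq> 0 \<and> f v * h v - (g v)\<^sup>2 = 0"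
    | "\<And>w. w \<noteq> 0 \<Longrightarrow> 0 < f w" "\<And>w. w \<noteq> 0 \<Longrightarrow> 0 < f w * h w - (g w)\<^sup>2"
    using disc by (metis diff_ge_0_iff_ge less_eq_real_def)
  then show ?thesis
  proof cases
    case 1
    then show ?thesis using ternary_quartic_degenerate[OF f g h F psd nz] by blast
  next
    case 2
    then obtain v where v: "v \<noteq> 0" "f v * h v - (g v)\<^sup>2 = 0" by blast
    \<comment> \<open>The minimiser of \<open>F\<close> on the line above \<open>v\<close>; the minimum is \<open>(f v * h v - (g v)\<^sup>2) / f v = 0\<close>.\<close>
    define a where "a = - g v / f v"
    have fv: "0 < f v" using 2(1) v(1) .
    have "f v * F (a, v) = 0" unfolding F a_def using fv v(2) by (simp add: field_simps power2_eq_square)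
    then have Fv: "F (a, v) = 0" using fv by simp
    obtain T2 R2 :: "real \<times> real \<Rightarrow> real \<times> real" where T2: "linear T2" and R2: "linear R2"
      and TR2: "\<And>w. T2 (R2 w) = w" "\<And>w. R2 (T2 w) = w" and Tv: "T2 (1, 0) = v"
      using plane_frame[OF v(1)] by metis
    define T :: "real \<times> real \<times> real \<Rightarrow> real \<times> real \<times> real" where
      "T p = (fst p + fst (snd p) * a, T2 (snd p))" for p
    define R :: "real \<times> real \<times> real \<Rightarrow> real \<times> real \<times> real" where
      "R p = (fst p - fst (R2 (snd p)) * a, R2 (snd p))" for p
    have lT: "linear T" unfolding T_def
      by (rule linearI) (auto simp: algebra_simps linear_add[OF T2] linear_scale[OF T2])
    have lR: "linear R" unfolding R_def
      by (rule linearI) (auto simp: algebra_simps linear_add[OF R2] linear_scale[OF R2])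
    have TR: "T (R p) = p" and RT: "R (T p) = p" for p unfolding T_def R_def by (simp_all add: TR2)
    have "dominates_square 2 (\<lambda>p. F (T p))"
    proof (rule ternary_quartic_two_zeros[OF is_form_compose[OF form lT] psd])
      show "F (T (R u)) \<noteq> 0" using TR nz by simp
      have "T (1, 0) = (1, 0)" unfolding T_def by (simp add: linear_0[OF T2])
      then show "F (T (1, 0)) = 0" using z1 by simp
      have "T (0, 1, 0) = (a, v)" unfolding T_def by (simp add: Tv)
      then show "F (T (0, 1, 0)) = 0" using Fv by simp
    qed
    then show ?thesis using dominates_square_compose[of 2 F T R] lT lR TR RT by blast
  next
    case 3
    have formD: "is_form 6 (\<lambda>w. f w * h w - (g w)\<^sup>2)"
      using is_form_diff[OF is_form_mult[OF f h], of "\<lambda>w. (g w)\<^sup>2"] is_form_power[OF g, of 2] by simp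
    have formE: "is_form 6 (\<lambda>w. f w ^ 3)" using is_form_power[OF f, of 3] by simp
    obtain e where e: "0 < e" "\<And>w. e * f w ^ 3 \<le> f w * h w - (g w)\<^sup>2"
      using positive_form_dominates[OF formD formE _ 3(2)] by auto
    have le: "(sqrt e * f w)\<^sup>2 \<le> F (x, w)" for x w
    proof (cases "w = 0")
      case True then show ?thesis using psd is_form_at_0[OF f] by simp
    next
      case False
      have "f w * (e * (f w)\<^sup>2) = e * f w ^ 3" by (simp add: power2_eq_square power3_eq_cube)
      also have "\<dots> \<le> f w * h w - (g w)\<^sup>2" by (rule e)
      also have "\<dots> \<le> (x * f w + g w)\<^sup>2 + (f w * h w - (g w)\<^sup>2)" by simp
      also have "\<dots> = f w * F (x, w)" unfolding F by (simp add: power2_eq_square algebra_simps)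
      finally have "e * (f w)\<^sup>2 \<le> F (x, w)" using 3(1)[OF False] by simp
      then show ?thesis using e(1) by (simp add: power_mult_distrib)
    qed
    have "(sqrt e * f (snd p))\<^sup>2 \<le> F p" for p using le[of "snd p" "fst p"] by simp
    moreover have "sqrt e * f (snd (0::real, 1, 0)) \<noteq> 0"
      using e(1) 3(1)[of "(1, 0)"] by (auto simp: zero_prod_def)
    ultimately show ?thesis unfolding dominates_square_def
      using is_form_cmult[OF is_form_snd_part[OF f], of "sqrt e"] by blast
  qed
qed

text \<open>
  Without a zero, \<open>F\<close> exceeds a multiple of the fourth power of the first coordinate; otherwise a linear
  substitution moves a zero to the first axis.
\<close>

lemma ternary_quartic_psd_dominates_square:
  fixes F :: "real \<times> real \<times> real \<Rightarrow> real"
  assumes form: "is_form 4 F" and psd: "\<And>p. 0 \<le> F p" and nz: "F u \<noteq> 0"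
  shows "dominates_square 2 F"
proof (cases "\<exists>p. p \<noteq> 0 \<and> F p = 0")
  case False
  then have pos: "\<And>p. p \<noteq> 0 \<Longrightarrow> 0 < F p" using psd by (metis less_eq_real_def)
  have pw: "is_form j (\<lambda>p::real\<times>real\<times>real. fst p ^ j)" for j
    by (rule is_form_linear_power[OF is_linear_fst])
  obtain e where e: "0 < e" "\<And>p. e * fst p ^ 4 \<le> F p"
    using positive_form_dominates[OF form pw _ pos] by auto
  have "(sqrt e * (fst p)\<^sup>2)\<^sup>2 \<le> F p" for p
    using e(1) e(2)[of p] by (simp add: power_mult_distrib)
  moreover have "sqrt e * (fst (1::real, 0::real\<times>real))\<^sup>2 \<noteq> 0" using e(1) by simp
  ultimately show ?thesis unfolding dominates_square_def using is_form_cmult[OF pw[of 2], of "sqrt e"] by blast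
next
  case True
  then obtain a b c where p: "(a, b, c) \<noteq> 0" "F (a, b, c) = 0" by (metis prod.collapse)
  have "\<exists>(T :: real \<times> real \<times> real \<Rightarrow> real \<times> real \<times> real) R. linear T \<and> linear R \<and> (\<forall>q. T (R q) = q) \<and> (\<forall>q. R (T q) = q) \<and> T (1, 0) = (a, b, c)"
  proof (cases "a = 0")
    case False
    define T :: "real \<times> real \<times> real \<Rightarrow> real \<times> real \<times> real" where
      "T p = (a * fst p, b * fst p + fst (snd p), c * fst p + snd (snd p))" for p
    define R :: "real \<times> real \<times> real \<Rightarrow> real \<times> real \<times> real" where
      "R p = (fst p / a, fst (snd p) - b * (fst p / a), snd (snd p) - c * (fst p / a))" for p
    have "linear T" unfolding T_def by (rule linearI) (auto simp: algebra_simps)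
    moreover have "linear R" unfolding R_def
      by (rule linearI) (auto simp: algebra_simps add_divide_distrib diff_divide_distrib)
    moreover have "T (R q) = q" "R (T q) = q" for q unfolding T_def R_def using False by simp_all
    moreover have "T (1, 0) = (a, b, c)" unfolding T_def by (simp add: zero_prod_def)
    ultimately show ?thesis by blast
  next
    case True
    then have "(b, c) \<noteq> 0" using p(1) by (simp add: prod_eq_iff)
    then obtain T2 R2 :: "real \<times> real \<Rightarrow> real \<times> real" where T2: "linear T2" and R2: "linear R2"
      and TR2: "\<And>w. T2 (R2 w) = w" "\<And>w. R2 (T2 w) = w" and Tv: "T2 (1, 0) = (b, c)"
      using plane_frame by metis
    define T :: "real \<times> real \<times> real \<Rightarrow> real \<times> real \<times> real" where
      "T p = (fst (snd p), T2 (fst p, snd (snd p)))" for p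
    define R :: "real \<times> real \<times> real \<Rightarrow> real \<times> real \<times> real" where
      "R p = (fst (R2 (snd p)), fst p, snd (R2 (snd p)))" for p
    have "linear T" unfolding T_def
    proof (rule linearI)
      fix x y :: "real \<times> real \<times> real"
      show "(fst (snd (x + y)), T2 (fst (x + y), snd (snd (x + y))))
          = (fst (snd x), T2 (fst x, snd (snd x))) + (fst (snd y), T2 (fst y, snd (snd y)))"
        using linear_add[OF T2, of "(fst x, snd (snd x))" "(fst y, snd (snd y))"] by simp
    next
      fix r and x :: "real \<times> real \<times> real"
      show "(fst (snd (r *\<^sub>R x)), T2 (fst (r *\<^sub>R x), snd (snd (r *\<^sub>R x))))
          = r *\<^sub>R (fst (snd x), T2 (fst x, snd (snd x)))"
        using linear_scale[OF T2, of r "(fst x, snd (snd x))"] by simp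
    qed
    moreover have "linear R" unfolding R_def
      by (rule linearI) (auto simp: linear_add[OF R2] linear_scale[OF R2])
    moreover have "T (R q) = q" "R (T q) = q" for q unfolding T_def R_def by (simp_all add: TR2)
    moreover have "T (1, 0) = (a, b, c)" unfolding T_def using True Tv by (simp add: zero_prod_def)
    ultimately show ?thesis by blast
  qed
  then obtain T :: "real \<times> real \<times> real \<Rightarrow> real \<times> real \<times> real" and R where TR: "linear T" "linear R" "\<And>q. T (R q) = q" "\<And>q. R (T q) = q" "T (1, 0) = (a, b, c)"
    by blast
  have "dominates_square 2 (\<lambda>p. F (T p))"
    by (rule ternary_quartic_one_zero[OF is_form_compose[OF form TR(1)] psd, of "R u"])
       (use TR nz p in simp_all)
  then show ?thesis using dominates_square_compose[of 2 F T R] TR(1-4) by blast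
qed

section \<open>Symmetric tensors and their forms\<close>

lemma finite_lists_length: "finite {is::'n::finite list. length is = m}"
  using finite_lists_length_eq[of "UNIV :: 'n set" m] by simp

lemma sum_lists_Suc:
  "(\<Sum>is | length is = Suc m. h is) = (\<Sum>i\<in>UNIV. \<Sum>is | length (is::'n::finite list) = m. (h (i # is) :: real))"
proof -
  have "{is::'n list. length is = Suc m} = (\<lambda>(i, is). i # is) ` (UNIV \<times> {is. length is = m})"
    by (auto simp: length_Suc_conv image_iff)
  then have "(\<Sum>is | length is = Suc m. h is) = (\<Sum>p\<in>UNIV \<times> {is. length is = m}. h ((\<lambda>(i, is). i # is) p))"
    by (simp add: sum.reindex inj_on_def)
  also have "\<dots> = (\<Sum>i\<in>UNIV. \<Sum>is | length (is::'n list) = m. h (i # is))"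
    by (simp add: sum.cartesian_product split_def)
  finally show ?thesis .
qed

lemma lists_length_0: "{is. length is = 0} = {[]}" by auto

lemma tensor_form_0: "tensor_form 0 A x = A []"
  unfolding tensor_form_def lists_length_0 by simp

lemma tensor_form_Suc:
  "tensor_form (Suc m) A x = (\<Sum>i\<in>UNIV. x $ i * tensor_form m (\<lambda>is. A (i # is)) x)"
  unfolding tensor_form_def sum_lists_Suc by (simp add: sum_distrib_left mult_ac)

lemma tensor_form_eq_inner: "tensor_form m A x = tensor_inner m A (rank_one m x)"
  unfolding tensor_form_def tensor_inner_def rank_one_def by (intro sum.cong) auto

lemma linear_vec_nth: "linear (\<lambda>v::real^'n. v $ i)"
  by (rule linearI) auto

lemma is_form_tensor_form: "is_form m (tensor_form m A :: real^'n::finite \<Rightarrow> real)"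
proof (induction m arbitrary: A)
  case 0
  then show ?case unfolding tensor_form_0[abs_def] by (rule is_form_const)
next
  case (Suc m)
  show ?case unfolding tensor_form_Suc[abs_def]
    by (intro is_form_sum is_form_lmult linear_vec_nth Suc)
qed

lemma linear_expand_axis:
  fixes l :: "real^'n::finite \<Rightarrow> real"
  assumes "linear l" shows "l x = (\<Sum>i\<in>UNIV. x $ i * l (axis i 1))"
proof -
  have "l x = l (\<Sum>i\<in>UNIV. x $ i *\<^sub>R axis i 1)"
    using basis_expansion[of x] by (simp add: scalar_mult_eq_scaleR)
  also have "\<dots> = (\<Sum>i\<in>UNIV. x $ i * l (axis i 1))"
    by (simp add: linear_sum[OF assms] linear_scale[OF assms])
  finally show ?thesis .
qed

lemma is_form_imp_tensor_form:
  fixes f :: "real^'n::finite \<Rightarrow> real"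
  shows "is_form d f \<Longrightarrow> \<exists>A. f = tensor_form d A"
proof (induction rule: is_form.induct)
  case (is_form_const c)
  show ?case by (intro exI[of _ "\<lambda>is. c"]) (simp add: tensor_form_0 fun_eq_iff)
next
  case (is_form_add d f g)
  then obtain A B where "f = tensor_form d A" "g = tensor_form d B" by blast
  then show ?case
    by (intro exI[of _ "\<lambda>is. A is + B is"]) (simp add: tensor_form_def fun_eq_iff distrib_right sum.distrib)
next
  case (is_form_lmult l d f)
  then obtain A where A: "f = tensor_form d A" by blast
  have "tensor_form d (\<lambda>is. l (axis i 1) * A is) x = l (axis i 1) * tensor_form d A x" for i x
    unfolding tensor_form_def by (simp add: sum_distrib_left mult_ac)
  then have "l x * f x = tensor_form (Suc d) (\<lambda>is. l (axis (hd is) 1) * A (tl is)) x" for x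
    unfolding tensor_form_Suc A linear_expand_axis[OF is_form_lmult(1), of x]
    by (simp add: sum_distrib_right mult.assoc)
  then show ?case by (intro exI[of _ "\<lambda>is. l (axis (hd is) 1) * A (tl is)"]) (simp add: fun_eq_iff)
qed

text \<open>
  Invariance under permutations of positions means that an entry depends only on the multiset of its
  indices. In this formulation, fixing an index of a symmetric tensor visibly gives a symmetric tensor.
\<close>

lemma sym_tensors_iff_mset:
  "A \<in> sym_tensors m \<longleftrightarrow>
    (\<forall>is. length is \<noteq> m \<longrightarrow> A is = 0) \<and> (\<forall>is js. mset is = mset js \<longrightarrow> A is = A js)"
proof
  assume A: "A \<in> sym_tensors m"
  have "A is = A js" if eq: "mset is = mset js" for "is" js
  proof (cases "length js = m")
    case True
    obtain p where "p permutes {..<length js}" "permute_list p js = is"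
      using mset_eq_permutation[OF eq] by blast
    then show ?thesis using A True unfolding sym_tensors_def by blast
  next
    case False
    then show ?thesis using A mset_eq_length[OF eq] unfolding sym_tensors_def by simp
  qed
  then show "(\<forall>is. length is \<noteq> m \<longrightarrow> A is = 0) \<and> (\<forall>is js. mset is = mset js \<longrightarrow> A is = A js)"
    using A unfolding sym_tensors_def by blast
next
  assume A: "(\<forall>is. length is \<noteq> m \<longrightarrow> A is = 0) \<and> (\<forall>is js. mset is = mset js \<longrightarrow> A is = A js)"
  have "A (permute_list p is) = A is" if "length is = m" "p permutes {..<m}" for "is" p
    using A mset_permute_list[of p "is"] that by blast
  then show "A \<in> sym_tensors m" unfolding sym_tensors_def using A by blast
qed

lemma rank_one_sym: "rank_one m u \<in> sym_tensors m"
proof -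
  have "rank_one m u is = rank_one m u js" if "mset is = mset js" for "is" js
  proof -
    have "mset (map (($) u) is) = mset (map (($) u) js)" using that by simp
    then have "(\<Prod>i\<leftarrow>is. u $ i) = (\<Prod>i\<leftarrow>js. u $ i)" by (metis prod_mset_prod_list)
    then show ?thesis unfolding rank_one_def mset_eq_length[OF that] by simp
  qed
  moreover have "length is \<noteq> m \<Longrightarrow> rank_one m u is = 0" for "is" by (simp add: rank_one_def)
  ultimately show ?thesis unfolding sym_tensors_iff_mset by blast
qed

text \<open>
  The mean over all rearrangements of the index list, written as a mean over lists with the same multiset.
\<close>

definition symmetrize :: "nat \<Rightarrow> 'n::finite tensor \<Rightarrow> 'n tensor" where
  "symmetrize m A is = (if length is = m
     then (\<Sum>js | mset js = mset is. A js) / card {js. mset js = mset is} else 0)"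

lemma symmetrize_sym: "symmetrize m A \<in> sym_tensors m"
proof -
  have "symmetrize m A is = symmetrize m A js" if "mset is = mset js" for "is" js
    unfolding symmetrize_def that mset_eq_length[OF that] ..
  moreover have "length is \<noteq> m \<Longrightarrow> symmetrize m A is = 0" for "is" by (simp add: symmetrize_def)
  ultimately show ?thesis unfolding sym_tensors_iff_mset by blast
qed

text \<open>
  Symmetrization is the orthogonal projection: \<open>B\<close> is constant on each class of rearrangements, and
  replacing \<open>A\<close> by its means over the classes does not change the sum over a class.
\<close>

lemma tensor_inner_symmetrize:
  fixes A B :: "'n::finite tensor"
  assumes B: "B \<in> sym_tensors m"
  shows "tensor_inner m (symmetrize m A) B = tensor_inner m A B"
proof -
  let ?L = "{is::'n list. length is = m}"
  let ?c = "\<lambda>is::'n list. real (card {js. mset js = mset is})"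
  have fin: "finite ?L" by (rule finite_lists_length)
  have cls: "{js. mset js = mset is} = {js\<in>?L. mset js = mset is}" if "is \<in> ?L" for "is"
  proof -
    have "length js = m" if "mset js = mset is" for js
      using mset_eq_length[OF that] \<open>is \<in> ?L\<close> by simp
    then show ?thesis by blast
  qed
  have cpos: "?c is \<noteq> 0" if "is \<in> ?L" for "is"
  proof -
    have "finite {js. mset js = mset is}" unfolding cls[OF that] using fin by simp
    then show ?thesis by auto
  qed
  have "tensor_inner m (symmetrize m A) B = (\<Sum>is\<in>?L. (\<Sum>js | mset js = mset is. A js) / ?c is * B is)"
    unfolding tensor_inner_def symmetrize_def by (intro sum.cong) auto
  also have "\<dots> = (\<Sum>is\<in>?L. \<Sum>js\<in>?L. if mset js = mset is then A js * B js / ?c js else 0)"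
  proof (intro sum.cong refl)
    fix "is" assume i: "is \<in> ?L"
    have "(\<Sum>js | mset js = mset is. A js) / ?c is * B is = (\<Sum>js | mset js = mset is. A js * B is / ?c is)"
      by (simp add: sum_divide_distrib sum_distrib_right)
    also have "\<dots> = (\<Sum>js | mset js = mset is. A js * B js / ?c js)"
    proof (intro sum.cong refl)
      fix js assume j: "js \<in> {js. mset js = mset is}"
      then have m: "mset is = mset js" by simp
      then have "B is = B js" using B unfolding sym_tensors_iff_mset by blast
      then show "A js * B is / ?c is = A js * B js / ?c js" using m by simp
    qed
    also have "\<dots> = (\<Sum>js\<in>?L. if mset js = mset is then A js * B js / ?c js else 0)"
      unfolding cls[OF i] by (rule sum.inter_filter[OF fin])
    finally show "(\<Sum>js | mset js = mset is. A js) / ?c is * B is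
      = (\<Sum>js\<in>?L. if mset js = mset is then A js * B js / ?c js else 0)" .
  qed
  also have "\<dots> = (\<Sum>js\<in>?L. \<Sum>is\<in>?L. if mset js = mset is then A js * B js / ?c js else 0)"
    by (rule sum.swap)
  also have "\<dots> = (\<Sum>js\<in>?L. A js * B js)"
  proof (intro sum.cong refl)
    fix js assume j: "js \<in> ?L"
    have "(\<Sum>is\<in>?L. if mset js = mset is then A js * B js / ?c js else 0)
        = (\<Sum>is | is \<in> ?L \<and> mset is = mset js. A js * B js / ?c js)"
      by (subst sum.inter_filter[OF fin, symmetric]) (simp add: eq_commute)
    also have "\<dots> = ?c js * (A js * B js / ?c js)"
      using cls[OF j] by simp
    also have "\<dots> = A js * B js" using cpos[OF j] by simp
    finally show "(\<Sum>is\<in>?L. if mset js = mset is then A js * B js / ?c js else 0) = A js * B js" .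
  qed
  finally show ?thesis unfolding tensor_inner_def .
qed

lemma tensor_form_symmetrize: "tensor_form m (symmetrize m A) x = tensor_form m A x"
  unfolding tensor_form_eq_inner by (rule tensor_inner_symmetrize[OF rank_one_sym])

lemma is_form_imp_sym_tensor:
  fixes f :: "real^'n::finite \<Rightarrow> real"
  assumes "is_form d f"
  shows "\<exists>A\<in>sym_tensors d. tensor_form d A = f"
proof -
  obtain A where "f = tensor_form d A" using is_form_imp_tensor_form[OF assms] by blast
  then show ?thesis
    by (intro bexI[of _ "symmetrize d A"]) (simp_all add: symmetrize_sym tensor_form_symmetrize fun_eq_iff)
qed

text \<open>
  By symmetry, each of the \<open>Suc m\<close> positions contributes the same partial derivative.
\<close>

lemma tensor_form_derivative:
  fixes A :: "'n::finite tensor"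
  assumes "\<And>is js. mset is = mset js \<Longrightarrow> A is = A js"
  shows "((\<lambda>t. tensor_form (Suc m) A (x + t *\<^sub>R axis i 1)) has_real_derivative
     real (Suc m) * tensor_form m (\<lambda>is. A (i # is)) (x + t *\<^sub>R axis i 1)) (at t)"
  using assms
proof (induction m arbitrary: A)
  case 0
  let ?y = "\<lambda>t. x + t *\<^sub>R axis i 1"
  have *: "((\<lambda>t. ?y t $ l) has_real_derivative (if l = i then 1 else 0)) (at t)" for l
    by (auto intro!: derivative_eq_intros simp: axis_def)
  show ?case unfolding tensor_form_Suc tensor_form_0
    by (rule derivative_eq_intros * refl)+ (simp add: if_distrib[of "\<lambda>z. z * _"] cong: if_cong)
next
  case (Suc m)
  let ?y = "\<lambda>t. x + t *\<^sub>R axis i 1"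
  let ?t = "\<lambda>m l. tensor_form m (\<lambda>is. A (l # is)) (?y t)"
  have *: "((\<lambda>t. ?y t $ l) has_real_derivative (if l = i then 1 else 0)) (at t)" for l
    by (auto intro!: derivative_eq_intros simp: axis_def)
  have IH: "((\<lambda>t. tensor_form (Suc m) (\<lambda>is. A (l # is)) (?y t)) has_real_derivative
      real (Suc m) * tensor_form m (\<lambda>is. A (l # i # is)) (?y t)) (at t)" for l
    by (rule Suc.IH) (rule Suc.prems, simp)
  have swap: "(\<lambda>is. A (l # i # is)) = (\<lambda>is. A (i # l # is))" for l
    by (rule ext, rule Suc.prems) simp
  have "((\<lambda>t. tensor_form (Suc (Suc m)) A (?y t)) has_real_derivative
      (\<Sum>l\<in>UNIV. (if l = i then 1 else 0) * ?t (Suc m) l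
         + real (Suc m) * tensor_form m (\<lambda>is. A (l # i # is)) (?y t) * ?y t $ l)) (at t)"
    unfolding tensor_form_Suc[of "Suc m" A] by (intro DERIV_sum DERIV_mult * IH)
  also have "(\<Sum>l\<in>UNIV. (if l = i then 1 else 0) * ?t (Suc m) l
         + real (Suc m) * tensor_form m (\<lambda>is. A (l # i # is)) (?y t) * ?y t $ l)
     = ?t (Suc m) i + real (Suc m) * (\<Sum>l\<in>UNIV. ?y t $ l * tensor_form m (\<lambda>is. A (i # l # is)) (?y t))"
    unfolding sum.distrib sum_distrib_left swap
    by (simp add: if_distrib[of "\<lambda>z. z * _"] mult_ac cong: if_cong)
  also have "(\<Sum>l\<in>UNIV. ?y t $ l * tensor_form m (\<lambda>is. A (i # l # is)) (?y t)) = ?t (Suc m) i"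
    unfolding tensor_form_Suc ..
  also have "?t (Suc m) i + real (Suc m) * ?t (Suc m) i = real (Suc (Suc m)) * ?t (Suc m) i"
    by (simp add: algebra_simps)
  finally show ?case .
qed

text \<open>
  All partial derivatives of a vanishing form vanish, and these are the forms of the slices of \<open>A\<close>.
\<close>

lemma tensor_form_eq_0_imp:
  fixes A :: "'n::finite tensor"
  assumes "\<And>is js. mset is = mset js \<Longrightarrow> A is = A js" "\<And>x. tensor_form m A x = 0" "length is = m"
  shows "A is = 0"
  using assms
proof (induction m arbitrary: A "is")
  case 0
  show ?case using tensor_form_0[of A 0] "0.prems"(2)[of 0] "0.prems"(3) by simp
next
  case (Suc m)
  obtain i js where "is": "is = i # js" "length js = m" using Suc.prems(3) by (auto simp: length_Suc_conv)
  have "tensor_form m (\<lambda>is. A (i # is)) x = 0" for x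
  proof -
    have "((\<lambda>t. tensor_form (Suc m) A (x + t *\<^sub>R axis i 1)) has_real_derivative
       real (Suc m) * tensor_form m (\<lambda>is. A (i # is)) (x + 0 *\<^sub>R axis i 1)) (at 0)"
      by (rule tensor_form_derivative) (rule Suc.prems(1))
    then have "((\<lambda>t. 0) has_real_derivative real (Suc m) * tensor_form m (\<lambda>is. A (i # is)) x) (at 0)"
      using Suc.prems(2) by simp
    from DERIV_unique[OF this DERIV_const] show ?thesis by simp
  qed
  then show ?case unfolding "is"(1)
    by (intro Suc.IH[of "\<lambda>is. A (i # is)" js] "is"(2) Suc.prems(1)) simp_all
qed

lemma tensor_form_inject:
  assumes "A \<in> sym_tensors m" "B \<in> sym_tensors m" "\<And>x. tensor_form m A x = tensor_form m B x"
  shows "A = B"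
proof
  fix "is"
  show "A is = B is"
  proof (cases "length is = m")
    case True
    have "A is - B is = 0"
    proof (rule tensor_form_eq_0_imp[where m = m])
      show "tensor_form m (\<lambda>is. A is - B is) x = 0" for x
        using assms(3)[of x] unfolding tensor_form_def by (simp add: left_diff_distrib sum_subtractf)
      show "A is - B is = A js - B js" if "mset is = mset js" for "is" js
        using assms(1,2) that unfolding sym_tensors_iff_mset by metis
    qed (rule True)
    then show ?thesis by simp
  qed (use assms in \<open>auto simp: sym_tensors_def\<close>)
qed

lemma sym_tensors_lincomb:
  "A \<in> sym_tensors m \<Longrightarrow> B \<in> sym_tensors m \<Longrightarrow> (\<lambda>is. a * A is + b * B is) \<in> sym_tensors m"
  unfolding sym_tensors_def by simp

lemma sym_tensors_sum:
  "(\<And>j. j \<in> J \<Longrightarrow> A j \<in> sym_tensors m) \<Longrightarrow> (\<lambda>is. \<Sum>j\<in>J. A j is) \<in> sym_tensors m"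
  unfolding sym_tensors_def by simp

lemma tensor_inner_sum_left:
  "tensor_inner m (\<lambda>is. \<Sum>j\<in>J. A j is) B = (\<Sum>j\<in>J. tensor_inner m (A j) B)"
  unfolding tensor_inner_def sum_distrib_right by (rule sum.swap)

lemma tensor_inner_commute: "tensor_inner m A B = tensor_inner m B A"
  unfolding tensor_inner_def by (simp add: mult.commute)

lemma rank_one_scale: "rank_one m (c *\<^sub>R u) is = c ^ m * rank_one m u is"
proof -
  have "prod_list (map (($) (c *\<^sub>R u)) is) = c ^ length is * prod_list (map (($) u) is)"
    by (induction "is") (auto simp: algebra_simps)
  then show ?thesis unfolding rank_one_def by simp
qed

lemma tensor_form_rank_one: "tensor_form m (rank_one m u) x = (u \<bullet> x) ^ m"
proof (induction m)
  case 0 then show ?case unfolding tensor_form_0 rank_one_def by simp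
next
  case (Suc m)
  have *: "(\<lambda>is. rank_one (Suc m) u (i # is)) = (\<lambda>is. u $ i * rank_one m u is)" for i
    unfolding rank_one_def by auto
  have **: "tensor_form m (\<lambda>is. u $ i * rank_one m u is) x = u $ i * tensor_form m (rank_one m u) x" for i
    unfolding tensor_form_def by (simp add: sum_distrib_left mult_ac)
  show ?case unfolding tensor_form_Suc * ** Suc
    by (simp add: inner_vec_def sum_distrib_right mult_ac)
qed

section \<open>The Motzkin form and the Choi-Lam form\<close>

text \<open>
  Divide by \<open>t ^ Suc d\<close> and let \<open>t\<close> tend to infinity: only the leading coefficient survives on the
  left, and the bound tends to 0 as long as the degree exceeds \<open>e\<close>.
\<close>

lemma bounded_growth_coeffs:
  fixes c :: "nat \<Rightarrow> real"
  assumes bound: "\<And>t. (\<Sum>i\<le>d. c i * t ^ i)\<^sup>2 \<le> C * (1 + t\<^sup>2) ^ e"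
  shows "i \<le> d \<Longrightarrow> e < i \<Longrightarrow> c i = 0"
  using assms
proof (induction d arbitrary: i)
  case 0 then show ?case by simp
next
  case (Suc d)
  have top: "c (Suc d) = 0" if "e < Suc d"
  proof (rule ccontr)
    assume nz: "c (Suc d) \<noteq> 0"
    let ?p = "\<lambda>t. \<Sum>i\<le>Suc d. c i * t ^ i"
    have l1: "((\<lambda>t::real. inverse t ^ (Suc d - i)) \<longlongrightarrow> 0) at_top" if "i \<le> d" for i
    proof -
      have "((\<lambda>t::real. inverse t ^ (Suc d - i)) \<longlongrightarrow> 0 ^ (Suc d - i)) at_top"
        by (intro tendsto_power tendsto_inverse_0_at_top filterlim_ident)
      then show ?thesis using that by (simp add: zero_power)
    qed
    have "((\<lambda>t. c (Suc d) + (\<Sum>i\<le>d. c i * inverse t ^ (Suc d - i))) \<longlongrightarrow> c (Suc d) + (\<Sum>i\<le>d. c i * 0)) at_top"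
      by (intro tendsto_add tendsto_const tendsto_sum tendsto_mult l1) auto
    then have "((\<lambda>t. (c (Suc d) + (\<Sum>i\<le>d. c i * inverse t ^ (Suc d - i)))\<^sup>2) \<longlongrightarrow> (c (Suc d) + (\<Sum>i\<le>d. c i * 0))\<^sup>2) at_top"
      by (rule tendsto_power)
    then have L: "((\<lambda>t. (c (Suc d) + (\<Sum>i\<le>d. c i * inverse t ^ (Suc d - i)))\<^sup>2) \<longlongrightarrow> (c (Suc d))\<^sup>2) at_top"
      by simp
    have "((\<lambda>t::real. inverse t ^ 2) \<longlongrightarrow> 0 ^ 2) at_top"
      by (intro tendsto_power tendsto_inverse_0_at_top filterlim_ident)
    then have i2: "((\<lambda>t::real. (inverse t)\<^sup>2) \<longlongrightarrow> 0) at_top" by simp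
    have "((\<lambda>t::real. C * ((inverse t)\<^sup>2 + 1) ^ e * ((inverse t)\<^sup>2) ^ (Suc d - e)) \<longlongrightarrow> C * (0 + 1) ^ e * 0 ^ (Suc d - e)) at_top"
      by (intro tendsto_mult tendsto_power tendsto_add tendsto_const i2)
    then have R: "((\<lambda>t::real. C * ((inverse t)\<^sup>2 + 1) ^ e * ((inverse t)\<^sup>2) ^ (Suc d - e)) \<longlongrightarrow> 0) at_top"
      using that by (simp add: zero_power)
    have "(c (Suc d))\<^sup>2 \<le> 0"
    proof (rule tendsto_le[OF _ R L])
      show "\<forall>\<^sub>F t in at_top. (c (Suc d) + (\<Sum>i\<le>d. c i * inverse t ^ (Suc d - i)))\<^sup>2
          \<le> C * ((inverse t)\<^sup>2 + 1) ^ e * ((inverse t)\<^sup>2) ^ (Suc d - e)"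
      proof (rule eventually_mono[OF eventually_gt_at_top[of 0]])
        fix t :: real assume t: "0 < t"
        have a: "inverse t ^ Suc d * (c i * t ^ i) = c i * inverse t ^ (Suc d - i)" if "i \<le> Suc d" for i
        proof -
          have "inverse t ^ Suc d = inverse t ^ (Suc d - i) * inverse t ^ i"
            using that by (simp add: power_add[symmetric] del: power_Suc)
          then show ?thesis using t by (simp add: power_mult_distrib[symmetric] del: power_Suc)
        qed
        have "inverse t ^ Suc d * ?p t = (\<Sum>i\<le>Suc d. c i * inverse t ^ (Suc d - i))"
          unfolding sum_distrib_left using a by (intro sum.cong) auto
        also have "\<dots> = c (Suc d) + (\<Sum>i\<le>d. c i * inverse t ^ (Suc d - i))" by simp
        finally have p: "inverse t ^ Suc d * ?p t = c (Suc d) + (\<Sum>i\<le>d. c i * inverse t ^ (Suc d - i))" .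
        have "(inverse t ^ Suc d)\<^sup>2 = ((inverse t)\<^sup>2) ^ Suc d" by (simp only: power_mult[symmetric] mult.commute)
        also have "\<dots> = ((inverse t)\<^sup>2) ^ e * ((inverse t)\<^sup>2) ^ (Suc d - e)"
          using that by (simp only: power_add[symmetric]) simp
        finally have q: "(inverse t ^ Suc d)\<^sup>2 = ((inverse t)\<^sup>2) ^ e * ((inverse t)\<^sup>2) ^ (Suc d - e)" .
        have "(inverse t)\<^sup>2 * (1 + t\<^sup>2) = (inverse t)\<^sup>2 + 1"
          using t by (simp add: distrib_left power_mult_distrib[symmetric])
        then have r: "((inverse t)\<^sup>2) ^ e * (1 + t\<^sup>2) ^ e = ((inverse t)\<^sup>2 + 1) ^ e"
          by (simp add: power_mult_distrib[symmetric])
        have "(inverse t ^ Suc d * ?p t)\<^sup>2 \<le> (inverse t ^ Suc d)\<^sup>2 * (C * (1 + t\<^sup>2) ^ e)"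
          unfolding power_mult_distrib by (intro mult_left_mono Suc.prems(3)) simp
        also have "\<dots> = C * (((inverse t)\<^sup>2) ^ e * (1 + t\<^sup>2) ^ e) * ((inverse t)\<^sup>2) ^ (Suc d - e)"
          unfolding q by (simp only: mult_ac)
        finally show "(c (Suc d) + (\<Sum>i\<le>d. c i * inverse t ^ (Suc d - i)))\<^sup>2
          \<le> C * ((inverse t)\<^sup>2 + 1) ^ e * ((inverse t)\<^sup>2) ^ (Suc d - e)" unfolding p r .
      qed
    qed simp
    then show False using nz by simp
  qed
  show ?case
  proof (cases "i = Suc d")
    case True then show ?thesis using top Suc.prems(2) by simp
  next
    case False
    then have i: "i \<le> d" using Suc.prems(1) by simp
    then have "c (Suc d) = 0" using top Suc.prems(2) by simp
    then show ?thesis using Suc.IH[OF i Suc.prems(2)] Suc.prems(3) by simp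
  qed
qed

definition poly_fun :: "(real \<Rightarrow> real) \<Rightarrow> bool" where
  "poly_fun p \<longleftrightarrow> (\<exists>d c. \<forall>t. p t = (\<Sum>i\<le>(d::nat). c i * t ^ i))"

lemma poly_funI: "(\<And>t. p t = (\<Sum>i\<le>(d::nat). c i * t ^ i)) \<Longrightarrow> poly_fun p"
  unfolding poly_fun_def by blast

lemma poly_fun_bounded_growth:
  assumes "poly_fun p" "\<And>t. (p t)\<^sup>2 \<le> C * (1 + t\<^sup>2) ^ e"
  shows "\<exists>c. \<forall>t. p t = (\<Sum>i\<le>e. c i * t ^ i)"
proof -
  obtain d c where p: "\<And>t. p t = (\<Sum>i\<le>d. c i * t ^ i)" using assms(1) unfolding poly_fun_def by blast
  have z: "c i = 0" if "i \<le> d" "e < i" for i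
    using bounded_growth_coeffs[where c = c and d = d and C = C and e = e and i = i] assms(2) p that by simp
  have "p t = (\<Sum>i\<le>e. (if i \<le> d then c i else 0) * t ^ i)" for t
  proof -
    have "p t = (\<Sum>i\<in>{..d} \<inter> {..e}. c i * t ^ i)"
      unfolding p by (rule sum.mono_neutral_right) (use z in auto)
    also have "\<dots> = (\<Sum>i\<le>e. (if i \<le> d then c i else 0) * t ^ i)"
      by (rule sum.mono_neutral_cong_left) auto
    finally show ?thesis .
  qed
  then show ?thesis by (intro exI[of _ "\<lambda>i. if i \<le> d then c i else 0"] allI)
qed

lemma is_form_poly_fun_line:
  assumes "is_form d F"
  shows "poly_fun (\<lambda>t. F (a + t *\<^sub>R b))"
proof -
  have lin: "linear (\<lambda>p::real\<times>real. fst p *\<^sub>R b + snd p *\<^sub>R a)"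
    by (rule linearI) (auto simp: algebra_simps)
  obtain G where "\<And>x w. (\<lambda>p. F (fst p *\<^sub>R b + snd p *\<^sub>R a)) (x, w) = (\<Sum>i\<le>d. x ^ i * G i w)"
    using is_form_prod_expand[OF is_form_compose[OF assms lin]] by blast
  from this[of _ 1] have "F (a + t *\<^sub>R b) = (\<Sum>i\<le>d. G i 1 * t ^ i)" for t
    by (simp add: add.commute mult.commute)
  then show ?thesis by (rule poly_funI)
qed

text \<open>
  A polynomial whose square lies below the dehomogenised Motzkin polynomial is a combination of
  \<open>1\<close>, \<open>x y\<close>, \<open>x y\<^sup>2\<close> and \<open>x\<^sup>2 y\<close>: growth along horizontal and vertical lines bounds the degree in each
  variable by 2, boundedness on the two axes leaves only the constant there, and growth along the
  diagonal excludes \<open>x\<^sup>2 y\<^sup>2\<close>. Each of these monomials but the constant has mean 0 over the four sign changes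
  of \<open>(1, 1)\<close>.
\<close>

lemma motzkin_component:
  fixes q :: "real \<Rightarrow> real \<Rightarrow> real"
  assumes poly: "\<And>a b c d. poly_fun (\<lambda>t. q (a + t * c) (b + t * d))"
    and le: "\<And>x y. (q x y)\<^sup>2 \<le> x ^ 4 * y\<^sup>2 + x\<^sup>2 * y ^ 4 - 3 * x\<^sup>2 * y\<^sup>2 + 1"
  shows "q 1 1 + q 1 (-1) + q (-1) 1 + q (-1) (-1) = 4 * q 0 0"
proof -
  \<comment> \<open>This growth limits the degree in each variable to 2.\<close>
  have lex: "(q x y)\<^sup>2 \<le> (1 + y\<^sup>2)\<^sup>2 * (1 + x\<^sup>2)\<^sup>2" for x y
  proof -
    have "(1 + y\<^sup>2)\<^sup>2 * (1 + x\<^sup>2)\<^sup>2 - (x ^ 4 * y\<^sup>2 + x\<^sup>2 * y ^ 4 - 3 * x\<^sup>2 * y\<^sup>2 + 1)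
      = x ^ 4 * y\<^sup>2 + x\<^sup>2 * y ^ 4 + 7 * x\<^sup>2 * y\<^sup>2 + x ^ 4 * y ^ 4 + x ^ 4 + y ^ 4 + 2 * x\<^sup>2 + 2 * y\<^sup>2"
      by (simp add: power2_eq_square power4_eq_xxxx algebra_simps)
    moreover have "0 \<le> x ^ 4 * y\<^sup>2 + x\<^sup>2 * y ^ 4 + 7 * x\<^sup>2 * y\<^sup>2 + x ^ 4 * y ^ 4 + x ^ 4 + y ^ 4 + 2 * x\<^sup>2 + 2 * y\<^sup>2"
      by (intro add_nonneg_nonneg mult_nonneg_nonneg) auto
    ultimately show ?thesis using le[of x y] by linarith
  qed
  have "\<exists>c. \<forall>x. q x y = (\<Sum>i\<le>2. c i * x ^ i)" for y
    using poly_fun_bounded_growth[OF _ lex] poly[of 0 1 y 0] by simp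
  then obtain A where A: "\<And>x y. q x y = (\<Sum>i\<le>2. A y i * x ^ i)" by metis
  have "\<exists>c. \<forall>y. q x y = (\<Sum>i\<le>2. c i * y ^ i)" for x
  proof (rule poly_fun_bounded_growth)
    show "poly_fun (q x)" using poly[of x 0 0 1] by simp
    show "(q x y)\<^sup>2 \<le> (1 + x\<^sup>2)\<^sup>2 * (1 + y\<^sup>2)\<^sup>2" for y using lex[of x y] by (simp add: mult.commute)
  qed
  then obtain B where B: "\<And>x y. q x y = (\<Sum>i\<le>2. B x i * y ^ i)" by metis
  have "\<exists>c. \<forall>y. q 0 y = (\<Sum>i\<le>0. c i * y ^ i)"
    using poly_fun_bounded_growth[of "q 0" 1 0] poly[of 0 0 0 1] le[of 0] by simp
  then have q0: "q 0 y = q 0 0" for y by auto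
  have "\<exists>c. \<forall>x. q x 0 = (\<Sum>i\<le>0. c i * x ^ i)"
    using poly_fun_bounded_growth[of "\<lambda>x. q x 0" 1 0] poly[of 0 1 0 0] le[of _ 0] by simp
  then have qx0: "q x 0 = q 0 0" for x by auto
  \<comment> \<open>The coefficients of \<open>x\<close> and \<open>x\<^sup>2\<close> are recovered from the values at \<open>x = 0, 1, -1\<close>,
      so they are polynomials of degree at most 2 in \<open>y\<close>.\<close>
  define b where "b i = (B 1 i - B (-1) i) / 2" for i
  define c where "c i = (B 1 i + B (-1) i) / 2" for i
  have qA: "q x y = q 0 0 + (q 1 y - q (-1) y) / 2 * x + ((q 1 y + q (-1) y) / 2 - q 0 0) * x\<^sup>2" for x y
  proof -
    have A2: "q x y = A y 0 + A y 1 * x + A y 2 * x\<^sup>2" for x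
      unfolding A[of x y] by (simp add: eval_nat_numeral)
    have "A y 0 = q 0 0" using A2[of 0] q0[of y] by simp
    moreover have "A y 1 = (q 1 y - q (-1) y) / 2" "A y 2 = (q 1 y + q (-1) y) / 2 - A y 0"
      using A2[of 1] A2[of "-1"] by (simp_all add: field_simps)
    ultimately show ?thesis using A2[of x] by simp
  qed
  have B2: "q x y = B x 0 + B x 1 * y + B x 2 * y\<^sup>2" for x y
    unfolding B[of x y] by (simp add: eval_nat_numeral)
  have B0: "B 1 0 = q 0 0" "B (-1) 0 = q 0 0" using B2[of 1 0] B2[of "-1" 0] qx0[of 1] qx0[of "-1"] by simp_all
  have q: "q x y = q 0 0 + (b 1 * y + b 2 * y\<^sup>2) * x + (c 1 * y + c 2 * y\<^sup>2) * x\<^sup>2" for x y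
    unfolding qA[of x y] B2[of 1 y] B2[of "-1" y] B0 b_def c_def by (simp add: field_simps)
  have "c 2 = 0"
  proof -
    \<comment> \<open>The coefficients of \<open>q t t\<close>; the Motzkin polynomial has degree 6 on the diagonal.\<close>
    define k where "k = (\<lambda>i::nat. if i = 0 then q 0 0 else if i = 2 then b 1 else if i = 3 then b 2 + c 1 else if i = 4 then c 2 else 0)"
    have "(\<Sum>i\<le>4. k i * t ^ i) = q t t" for t
      unfolding q[of t t] k_def by (simp add: eval_nat_numeral algebra_simps)
    moreover have "(q t t)\<^sup>2 \<le> 2 * (1 + t\<^sup>2) ^ 3" for t
    proof -
      have "2 * (1 + t\<^sup>2) ^ 3 - (t ^ 4 * t\<^sup>2 + t\<^sup>2 * t ^ 4 - 3 * t\<^sup>2 * t\<^sup>2 + 1) = 1 + 6 * t\<^sup>2 + 9 * t ^ 4"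
        by (simp add: power2_eq_square power4_eq_xxxx power3_eq_cube algebra_simps)
      moreover have "0 \<le> 1 + 6 * t\<^sup>2 + 9 * t ^ 4" by (intro add_nonneg_nonneg) auto
      ultimately show ?thesis using le[of t t] by linarith
    qed
    ultimately have "k 4 = 0"
      by (intro bounded_growth_coeffs[where d = 4 and C = 2 and e = 3]) simp_all
    then show ?thesis unfolding k_def by simp
  qed
  then show ?thesis using q[of 1 1] q[of 1 "-1"] q[of "-1" 1] q[of "-1" "-1"] by simp
qed

text \<open>
  With \<open>r = \<bar>x y\<bar>\<close>, the inequality \<open>x\<^sup>2 + y\<^sup>2 \<ge> 2 r\<close> reduces the claim to
  \<open>2 r ^ 3 - 3 r\<^sup>2 z\<^sup>2 + z ^ 6 = (z\<^sup>2 - r)\<^sup>2 (z\<^sup>2 + 2 r)\<close>.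
\<close>

lemma motzkin_nonneg:
  fixes x y z :: real
  shows "0 \<le> x ^ 4 * y\<^sup>2 + x\<^sup>2 * y ^ 4 - 3 * x\<^sup>2 * y\<^sup>2 * z\<^sup>2 + z ^ 6"
proof -
  define r where "r = \<bar>x * y\<bar>"
  have r: "0 \<le> r" "r\<^sup>2 = x\<^sup>2 * y\<^sup>2" unfolding r_def by (simp_all add: power_mult_distrib)
  have "0 \<le> (\<bar>x\<bar> - \<bar>y\<bar>)\<^sup>2" by simp
  then have "2 * r \<le> x\<^sup>2 + y\<^sup>2" unfolding r_def by (simp add: power2_diff abs_mult)
  then have "r\<^sup>2 * (2 * r) \<le> r\<^sup>2 * (x\<^sup>2 + y\<^sup>2)" by (intro mult_left_mono) auto
  moreover have "r\<^sup>2 * (x\<^sup>2 + y\<^sup>2) = x ^ 4 * y\<^sup>2 + x\<^sup>2 * y ^ 4"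
    unfolding r by (simp add: power2_eq_square power4_eq_xxxx algebra_simps)
  moreover have "0 \<le> (z\<^sup>2 - r)\<^sup>2 * (z\<^sup>2 + 2 * r)" using r(1) by simp
  moreover have "(z\<^sup>2 - r)\<^sup>2 * (z\<^sup>2 + 2 * r) = r\<^sup>2 * (2 * r) - 3 * r\<^sup>2 * z\<^sup>2 + z ^ 6"
    by (simp add: power2_eq_square eval_nat_numeral algebra_simps)
  ultimately show ?thesis using r(2) by (simp add: mult.assoc)
qed

text \<open>
  With \<open>r = \<bar>x y\<bar>\<close>, apply the arithmetic-geometric mean inequality to \<open>w ^ 4\<close> and \<open>r\<^sup>2\<close>, to \<open>y\<^sup>2\<close> and
  \<open>x\<^sup>2\<close>, and then to \<open>w\<^sup>2\<close> and \<open>z\<^sup>2\<close>.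
\<close>

lemma choi_lam_nonneg:
  fixes w x y z :: real
  shows "0 \<le> w ^ 4 + x\<^sup>2 * y\<^sup>2 + y\<^sup>2 * z\<^sup>2 + z\<^sup>2 * x\<^sup>2 - 4 * (x * y * z * w)"
proof -
  define r where "r = \<bar>x * y\<bar>"
  have r: "0 \<le> r" "r\<^sup>2 = x\<^sup>2 * y\<^sup>2" unfolding r_def by (simp_all add: power_mult_distrib)
  have "0 \<le> (\<bar>x\<bar> - \<bar>y\<bar>)\<^sup>2" by simp
  then have "2 * r \<le> x\<^sup>2 + y\<^sup>2" unfolding r_def by (simp add: power2_diff abs_mult)
  then have 1: "z\<^sup>2 * (2 * r) \<le> z\<^sup>2 * (x\<^sup>2 + y\<^sup>2)" by (intro mult_left_mono) auto
  have 2: "0 \<le> (w\<^sup>2 - r)\<^sup>2" by simp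
  have "0 \<le> (\<bar>z\<bar> - \<bar>w\<bar>)\<^sup>2" by simp
  then have "2 * \<bar>z * w\<bar> \<le> z\<^sup>2 + w\<^sup>2" by (simp add: power2_diff abs_mult)
  then have "2 * r * (2 * \<bar>z * w\<bar>) \<le> 2 * r * (z\<^sup>2 + w\<^sup>2)" using r(1) by (intro mult_left_mono) auto
  moreover have "x * y * z * w \<le> r * \<bar>z * w\<bar>"
    unfolding r_def by (metis abs_ge_self abs_mult mult.assoc)
  ultimately have 3: "4 * (x * y * z * w) \<le> 2 * r * (z\<^sup>2 + w\<^sup>2)" by linarith
  have "(w\<^sup>2 - r)\<^sup>2 = w ^ 4 - 2 * r * w\<^sup>2 + x\<^sup>2 * y\<^sup>2"
    unfolding power2_diff r(2) by (simp add: power2_eq_square power4_eq_xxxx)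
  with 1 2 3 show ?thesis by (simp add: algebra_simps)
qed

text \<open>
  Motzkin's form, multiplied by a power of one of its variables in order to reach a prescribed degree.
\<close>

definition motzkin_form :: "nat \<Rightarrow> 'n \<Rightarrow> 'n \<Rightarrow> 'n \<Rightarrow> real ^ 'n \<Rightarrow> real" where
  "motzkin_form e i j k v = (v $ k) ^ e *
     ((v $ i) ^ 4 * (v $ j)\<^sup>2 + (v $ i)\<^sup>2 * (v $ j) ^ 4 - 3 * (v $ i)\<^sup>2 * (v $ j)\<^sup>2 * (v $ k)\<^sup>2 + (v $ k) ^ 6)"

definition choi_lam_form :: "'n \<Rightarrow> 'n \<Rightarrow> 'n \<Rightarrow> 'n \<Rightarrow> real ^ 'n \<Rightarrow> real" where
  "choi_lam_form i j k l v = (v $ l) ^ 4 + (v $ i)\<^sup>2 * (v $ j)\<^sup>2 + (v $ j)\<^sup>2 * (v $ k)\<^sup>2 + (v $ k)\<^sup>2 * (v $ i)\<^sup>2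
     - 4 * (v $ i * v $ j * v $ k * v $ l)"

lemma is_form_nth_power: "is_form d (\<lambda>v::real^'n. (v $ i) ^ d)"
  by (rule is_form_linear_power[OF linear_vec_nth])

lemma is_form_motzkin: "is_form (e + 6) (motzkin_form e i j k :: real^'n::finite \<Rightarrow> real)"
proof -
  note p = is_form_nth_power[where 'n = 'n]
  have m: "is_form (d1 + d2) (\<lambda>v::real^'n. (v $ a) ^ d1 * (v $ b) ^ d2)" for d1 d2 a b
    by (rule is_form_mult[OF p p])
  have "is_form 6 (\<lambda>v::real^'n. (v $ i) ^ 4 * (v $ j)\<^sup>2)" "is_form 6 (\<lambda>v::real^'n. (v $ i)\<^sup>2 * (v $ j) ^ 4)"
    using m[of 4 2 i j] m[of 2 4 i j] by simp_all
  moreover have "is_form 6 (\<lambda>v::real^'n. 3 * (v $ i)\<^sup>2 * (v $ j)\<^sup>2 * (v $ k)\<^sup>2)"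
    using is_form_cmult[OF is_form_mult[OF m[of 2 2 i j] p[of 2 k]], of 3]
    by (simp add: mult.assoc)
  ultimately show ?thesis unfolding motzkin_form_def[abs_def]
    by (intro is_form_mult p is_form_add is_form_diff) simp_all
qed

lemma is_form_choi_lam: "is_form 4 (choi_lam_form i j k l :: real^'n::finite \<Rightarrow> real)"
proof -
  note p = is_form_nth_power[where 'n = 'n]
  have m: "is_form (d1 + d2) (\<lambda>v::real^'n. (v $ a) ^ d1 * (v $ b) ^ d2)" for d1 d2 a b
    by (rule is_form_mult[OF p p])
  have 1: "is_form 4 (\<lambda>v::real^'n. (v $ a)\<^sup>2 * (v $ b)\<^sup>2)" for a b
    using m[of 2 2 a b] by simp
  have "is_form (1 + 1 + 1 + 1) (\<lambda>v::real^'n. v $ i * v $ j * v $ k * v $ l)"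
    by (intro is_form_mult is_form_linear linear_vec_nth)
  moreover have "1 + 1 + 1 + 1 = (4::nat)" by simp
  ultimately have "is_form 4 (\<lambda>v::real^'n. v $ i * v $ j * v $ k * v $ l)" by metis
  then show ?thesis unfolding choi_lam_form_def[abs_def]
    by (intro is_form_diff is_form_add 1 is_form_cmult p)
qed

lemma motzkin_form_nonneg: "even e \<Longrightarrow> 0 \<le> motzkin_form e i j k v"
  unfolding motzkin_form_def by (intro mult_nonneg_nonneg motzkin_nonneg) (auto simp: zero_le_even_power)

lemma choi_lam_form_nonneg: "0 \<le> choi_lam_form i j k l v"
  unfolding choi_lam_form_def by (rule choi_lam_nonneg)

lemma component_square_le:
  fixes q :: "nat \<Rightarrow> real"
  assumes "j < r" shows "(q j)\<^sup>2 \<le> (\<Sum>j<r. (q j)\<^sup>2)"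
  by (rule member_le_sum) (use assms in auto)

text \<open>
  At \<open>z = 1\<close> the form vanishes for \<open>x, y = \<plusminus>1\<close>, so each \<open>q s\<close> vanishes at these four points and hence
  at \<open>x = y = 0\<close>, where the form has the value 1.
\<close>

lemma motzkin_form_not_sos:
  fixes q :: "nat \<Rightarrow> real ^ 'n::finite \<Rightarrow> real"
  assumes dist: "i \<noteq> j" "j \<noteq> k" "i \<noteq> k"
    and form: "\<And>s. s < r \<Longrightarrow> is_form d (q s)"
    and sos: "\<And>v. motzkin_form e i j k v = (\<Sum>s<r. (q s v)\<^sup>2)"
  shows False
proof -
  define P :: "real \<Rightarrow> real \<Rightarrow> real ^ 'n" where
    "P x y = x *\<^sub>R axis i 1 + y *\<^sub>R axis j 1 + axis k 1" for x y
  have nth: "P x y $ i = x" "P x y $ j = y" "P x y $ k = 1" for x y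
    unfolding P_def using dist by (simp_all add: axis_def)
  have M: "motzkin_form e i j k (P x y) = x ^ 4 * y\<^sup>2 + x\<^sup>2 * y ^ 4 - 3 * x\<^sup>2 * y\<^sup>2 + 1" for x y
    unfolding motzkin_form_def nth by simp
  have zero: "q s (P 0 0) = 0" if s: "s < r" for s
  proof -
    have le: "(q s (P x y))\<^sup>2 \<le> x ^ 4 * y\<^sup>2 + x\<^sup>2 * y ^ 4 - 3 * x\<^sup>2 * y\<^sup>2 + 1" for x y
      using component_square_le[OF s, of "\<lambda>s. q s (P x y)"] unfolding sos[symmetric] M .
    have line: "P (a + t * c) (b + t * d) = P a b + t *\<^sub>R (c *\<^sub>R axis i 1 + d *\<^sub>R axis j 1)" for a b c d t
      unfolding P_def by (simp add: algebra_simps)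
    have "q s (P 1 1) + q s (P 1 (-1)) + q s (P (-1) 1) + q s (P (-1) (-1)) = 4 * q s (P 0 0)"
      by (rule motzkin_component[OF _ le]) (unfold line, rule is_form_poly_fun_line[OF form[OF s]])
    moreover have "q s (P 1 1) = 0" "q s (P 1 (-1)) = 0" "q s (P (-1) 1) = 0" "q s (P (-1) (-1)) = 0"
      using le[of 1 1] le[of 1 "-1"] le[of "-1" 1] le[of "-1" "-1"] by simp_all
    ultimately show ?thesis by simp
  qed
  have "(\<Sum>s<r. (q s (P 0 0))\<^sup>2) = 0" using zero by simp
  then show False using M[of 0 0] sos[of "P 0 0"] by simp
qed

text \<open>
  At \<open>w = 1\<close> the form vanishes at the four points with coordinates \<open>\<plusminus>1\<close> and \<open>x y z = 1\<close>, over which all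
  linear and mixed monomials in \<open>x\<close>, \<open>y\<close>, \<open>z\<close> have mean 0. It also vanishes on the three axes, so \<open>q s\<close>
  contains no pure squares of \<open>x\<close>, \<open>y\<close>, \<open>z\<close>.
\<close>

lemma choi_lam_form_not_sos:
  fixes q :: "nat \<Rightarrow> real ^ 'n::finite \<Rightarrow> real"
  assumes dist: "distinct [i, j, k, l]"
    and form: "\<And>s. s < r \<Longrightarrow> is_form 2 (q s)"
    and sos: "\<And>v. choi_lam_form i j k l v = (\<Sum>s<r. (q s v)\<^sup>2)"
  shows False
proof -
  define P :: "real \<Rightarrow> real \<Rightarrow> real \<Rightarrow> real \<Rightarrow> real ^ 'n" where
    "P x y z w = x *\<^sub>R axis i 1 + y *\<^sub>R axis j 1 + z *\<^sub>R axis k 1 + w *\<^sub>R axis l 1" for x y z w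
  have nth: "P x y z w $ i = x" "P x y z w $ j = y" "P x y z w $ k = z" "P x y z w $ l = w" for x y z w
    unfolding P_def using dist by (auto simp: axis_def)
  have M: "choi_lam_form i j k l (P x y z w)
      = w ^ 4 + x\<^sup>2 * y\<^sup>2 + y\<^sup>2 * z\<^sup>2 + z\<^sup>2 * x\<^sup>2 - 4 * (x * y * z * w)" for x y z w
    unfolding choi_lam_form_def nth by simp
  have zero: "q s (P 0 0 0 1) = 0" if s: "s < r" for s
  proof -
    have le: "(q s (P x y z w))\<^sup>2 \<le> w ^ 4 + x\<^sup>2 * y\<^sup>2 + y\<^sup>2 * z\<^sup>2 + z\<^sup>2 * x\<^sup>2 - 4 * (x * y * z * w)" for x y z w
      using component_square_le[OF s, of "\<lambda>s. q s (P x y z w)"] unfolding sos[symmetric] M .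
    obtain B where B: "\<And>v. linear (B v)" "\<And>v w. B v w = (B w v :: real)" "\<And>v. q s v = B v v"
      using is_form_two_bilinear[OF form[OF s]] by blast
    have Bl: "B (a + b) c = B a c + B b c" "B c (a + b) = B c a + B c b"
      "B (t *\<^sub>R a) c = t * B a c" "B c (t *\<^sub>R a) = t * B c a" for a b c t
      using linear_add[OF B(1)] linear_scale[OF B(1)] B(2) by (metis real_scaleR_def)+
    have "q s (P 1 1 1 1) + q s (P 1 (-1) (-1) 1) + q s (P (-1) 1 (-1) 1) + q s (P (-1) (-1) 1 1)
      = 4 * (q s (P 1 0 0 0) + q s (P 0 1 0 0) + q s (P 0 0 1 0) + q s (P 0 0 0 1))"
      unfolding B(3) P_def Bl by simp
    moreover have "q s (P 1 1 1 1) = 0" "q s (P 1 (-1) (-1) 1) = 0" "q s (P (-1) 1 (-1) 1) = 0"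
      "q s (P (-1) (-1) 1 1) = 0" "q s (P 1 0 0 0) = 0" "q s (P 0 1 0 0) = 0" "q s (P 0 0 1 0) = 0"
      using le[of 1 1 1 1] le[of 1 "-1" "-1" 1] le[of "-1" 1 "-1" 1] le[of "-1" "-1" 1 1]
        le[of 1 0 0 0] le[of 0 1 0 0] le[of 0 0 1 0] by simp_all
    ultimately show ?thesis by simp
  qed
  have "(\<Sum>s<r. (q s (P 0 0 0 1))\<^sup>2) = 0" using zero by simp
  then show False using M[of 0 0 0 1] sos[of "P 0 0 0 1"] by simp
qed

section \<open>Cones of sums of generators\<close>

text \<open>
  Gaussian elimination, one equation of the system at a time.
\<close>

lemma underdetermined_system:
  fixes g :: "'j \<Rightarrow> 'i \<Rightarrow> real"
  assumes "finite I" "finite J" "card I < card J"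
  shows "\<exists>c. (\<exists>j\<in>J. c j \<noteq> 0) \<and> (\<forall>i\<in>I. (\<Sum>j\<in>J. c j * g j i) = 0)"
  using assms
proof (induction I arbitrary: J g rule: finite_induct)
  case empty
  then obtain j where "j \<in> J" by fastforce
  then show ?case by (intro exI[of _ "\<lambda>_. 1"]) auto
next
  case (insert a I)
  show ?case
  proof (cases "\<forall>j\<in>J. g j a = 0")
    case True
    have "card I < card J" using insert by simp
    then obtain c where "\<exists>j\<in>J. c j \<noteq> 0" "\<forall>i\<in>I. (\<Sum>j\<in>J. c j * g j i) = 0"
      using insert.IH[OF insert.prems(1)] by blast
    then show ?thesis using True by (intro exI[of _ c]) auto
  next
    case False
    then obtain k where k: "k \<in> J" "g k a \<noteq> 0" by blast
    let ?J = "J - {k}"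
    have "finite ?J" "card I < card ?J" using insert k by simp_all
    from insert.IH[OF this, of "\<lambda>j i. g j i - g j a / g k a * g k i"]
    obtain c where c: "\<exists>j\<in>?J. c j \<noteq> 0"
      "\<forall>i\<in>I. (\<Sum>j\<in>?J. c j * (g j i - g j a / g k a * g k i)) = 0" by blast
    \<comment> \<open>The coefficient \<open>- s\<close> of the pivot \<open>k\<close> makes the equation with index \<open>a\<close> hold.\<close>
    define s where "s = (\<Sum>j\<in>?J. c j * g j a / g k a)"
    let ?c = "c(k := - s)"
    have split: "(\<Sum>j\<in>J. ?c j * g j i) = - s * g k i + (\<Sum>j\<in>?J. c j * g j i)" for i
      by (subst sum.remove[OF insert.prems(1) k(1)]) (auto intro!: sum.cong)
    have "(\<Sum>j\<in>J. ?c j * g j i) = 0" if "i \<in> insert a I" for i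
    proof (cases "i = a")
      case True
      have "s * g k a = (\<Sum>j\<in>?J. c j * g j a)"
        unfolding s_def sum_distrib_right using k(2) by simp
      then show ?thesis unfolding split True by simp
    next
      case False
      then have "(\<Sum>j\<in>?J. c j * (g j i - g j a / g k a * g k i)) = 0" using c(2) that by blast
      then have "(\<Sum>j\<in>?J. c j * g j i) - s * g k i = 0"
        unfolding s_def sum_distrib_right sum_subtractf[symmetric] by (simp add: algebra_simps)
      then show ?thesis unfolding split by simp
    qed
    moreover have "\<exists>j\<in>J. ?c j \<noteq> 0" using c(1) by auto
    ultimately show ?thesis by blast
  qed
qed

definition conic_sums :: "nat \<Rightarrow> ('i \<Rightarrow> real) set \<Rightarrow> ('i \<Rightarrow> real) set" where
  "conic_sums N G = {f. \<exists>g. (\<forall>j<N. g j \<in> G) \<and> f = (\<lambda>i. \<Sum>j<N. g j i)}"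

text \<open>
  The generators are supported on the finite index set \<open>I\<close>, so they live in a finite-dimensional space
  although the ambient function space, which carries the product topology, is in general not.
\<close>

definition conic_on :: "'i set \<Rightarrow> ('i \<Rightarrow> real) set \<Rightarrow> bool" where
  "conic_on I G \<longleftrightarrow> G \<noteq> {} \<and> (\<forall>g\<in>G. \<forall>i. i \<notin> I \<longrightarrow> g i = 0) \<and> (\<forall>g\<in>G. \<forall>t\<ge>0. (\<lambda>i. t * g i) \<in> G)"

lemma conic_on_zero: "conic_on I G \<Longrightarrow> (\<lambda>i. 0) \<in> G"
proof -
  assume G: "conic_on I G"
  then obtain g where "g \<in> G" unfolding conic_on_def by blast
  then have "(\<lambda>i. 0 * g i) \<in> G" using G unfolding conic_on_def by blast
  then show ?thesis by simp
qed

text \<open>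
  As long as there are more summands than indices, the summands are linearly dependent, and subtracting a
  suitable multiple of the dependency removes one of them while keeping all coefficients nonnegative.
\<close>

lemma caratheodory_sum:
  fixes g :: "'j \<Rightarrow> 'i \<Rightarrow> real"
  assumes I: "finite I" and G: "conic_on I G" and J: "finite J" "\<And>j. j \<in> J \<Longrightarrow> g j \<in> G"
  shows "\<exists>(J' :: 'j set) h. finite J' \<and> card J' \<le> card I \<and> (\<forall>j\<in>J'. h j \<in> G) \<and> (\<forall>i. (\<Sum>j\<in>J. g j i) = (\<Sum>j\<in>J'. h j i))"
  using J
proof (induction "card J" arbitrary: J g rule: less_induct)
  case less
  show ?case
  proof (cases "card J \<le> card I")
    case True then show ?thesis using less.prems by (intro exI[of _ J] exI[of _ g]) blast
  next
    case False
    obtain c0 where c0: "\<exists>j\<in>J. c0 j \<noteq> 0" "\<forall>i\<in>I. (\<Sum>j\<in>J. c0 j * g j i) = 0"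
      using underdetermined_system[OF I less.prems(1), of g] False by auto
    have "\<exists>c. (\<exists>j\<in>J. 0 < c j) \<and> (\<forall>i\<in>I. (\<Sum>j\<in>J. c j * g j i) = 0)"
    proof (cases "\<exists>j\<in>J. 0 < c0 j")
      case True then show ?thesis using c0 by blast
    next
      case False
      then have "\<exists>j\<in>J. 0 < - c0 j" using c0(1) by (metis neg_0_less_iff_less linorder_neqE_linordered_idom)
      moreover have "\<forall>i\<in>I. (\<Sum>j\<in>J. - c0 j * g j i) = 0" using c0(2) by (simp add: sum_negf)
      ultimately show ?thesis by (intro exI[of _ "\<lambda>j. - c0 j"]) blast
    qed
    then obtain c where c: "\<exists>j\<in>J. 0 < c j" "\<And>i. i \<in> I \<Longrightarrow> (\<Sum>j\<in>J. c j * g j i) = 0" by blast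
    have ne: "c ` J \<noteq> {}" "finite (c ` J)" using c(1) less.prems(1) by auto
    obtain k where k: "k \<in> J" "c k = Max (c ` J)" using Max_in[OF ne(2,1)] by (metis imageE)
    have ck: "c j \<le> c k" if "j \<in> J" for j unfolding k(2) using that ne by simp
    have pos: "0 < c k" using c(1) ck by (meson less_le_trans)
    have c': "(\<Sum>j\<in>J. c j * g j i) = 0" for i
    proof (cases "i \<in> I")
      case False
      then have "j \<in> J \<Longrightarrow> g j i = 0" for j using G less.prems(2) unfolding conic_on_def by blast
      then show ?thesis by simp
    qed (rule c(2))
    \<comment> \<open>Subtracting \<open>1 / c k\<close> times the dependency cancels the summand \<open>k\<close>. As \<open>c k\<close> is the largest
        coefficient, the factors of the other summands stay nonnegative.\<close>
    let ?g = "\<lambda>j i. (1 - c j / c k) * g j i"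
    have gG: "?g j \<in> G" if "j \<in> J - {k}" for j
    proof -
      have "0 \<le> 1 - c j / c k" using ck[of j] pos that by (simp add: field_simps)
      moreover have "g j \<in> G" using less.prems(2) that by blast
      ultimately show ?thesis using G unfolding conic_on_def by blast
    qed
    have eq: "(\<Sum>j\<in>J. g j i) = (\<Sum>j\<in>J - {k}. ?g j i)" for i
    proof -
      have "(\<Sum>j\<in>J. ?g j i) = (\<Sum>j\<in>J. g j i) - (\<Sum>j\<in>J. c j * g j i) / c k"
        by (simp add: left_diff_distrib sum_subtractf sum_divide_distrib)
      moreover have "(\<Sum>j\<in>J. ?g j i) = (\<Sum>j\<in>J - {k}. ?g j i)"
        by (subst sum.remove[OF less.prems(1) k(1)]) (use pos in simp)
      ultimately show ?thesis using c' by simp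
    qed
    have "card (J - {k}) < card J" using k(1) less.prems(1) by (rule card_Diff1_less[rotated])
    from less.hyps[OF this, of ?g] gG less.prems(1) show ?thesis unfolding eq by blast
  qed
qed

lemma caratheodory_conic_sums:
  fixes g :: "'j \<Rightarrow> 'i \<Rightarrow> real"
  assumes I: "finite I" and G: "conic_on I G" and J: "finite J" "\<And>j. j \<in> J \<Longrightarrow> g j \<in> G"
  shows "(\<lambda>i. \<Sum>j\<in>J. g j i) \<in> conic_sums (card I) G"
proof -
  have "\<exists>(J' :: 'j set) h. finite J' \<and> card J' \<le> card I \<and> (\<forall>j\<in>J'. h j \<in> G) \<and>
      (\<forall>i. (\<Sum>j\<in>J. g j i) = (\<Sum>j\<in>J'. h j i))"
    by (rule caratheodory_sum[OF I G J(1)]) (rule J(2))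
  then obtain J' :: "'j set" and h where h: "finite J'" "card J' \<le> card I" "\<forall>j\<in>J'. h j \<in> G"
    "\<forall>i. (\<Sum>j\<in>J. g j i) = (\<Sum>j\<in>J'. h j i)" by (elim exE conjE)
  obtain e where e: "bij_betw e {..<card J'} J'"
    using ex_bij_betw_nat_finite[OF h(1)] by (auto simp: atLeast0LessThan)
  define f where "f j = (if j < card J' then h (e j) else (\<lambda>i. 0))" for j
  have "f j \<in> G" for j
    unfolding f_def using h(3) bij_betwE[OF e] conic_on_zero[OF G] by auto
  moreover have "(\<Sum>j\<in>J. g j i) = (\<Sum>j<card I. f j i)" for i
  proof -
    have "(\<Sum>j\<in>J'. h j i) = (\<Sum>j<card J'. h (e j) i)"
      by (rule sum.reindex_bij_betw[OF e, symmetric])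
    also have "\<dots> = (\<Sum>j<card I. f j i)"
      by (rule sum.mono_neutral_cong_left) (use h(2) in \<open>auto simp: f_def\<close>)
    finally show ?thesis using h(4) by simp
  qed
  ultimately show ?thesis unfolding conic_sums_def by (auto intro!: exI[of _ f])
qed

lemma conic_sums_add:
  assumes "finite I" "conic_on I G" "S \<in> conic_sums M G" "S' \<in> conic_sums N G"
  shows "(\<lambda>i. S i + S' i) \<in> conic_sums (card I) G"
proof -
  obtain g where g: "\<And>j. j < M \<Longrightarrow> g j \<in> G" "S = (\<lambda>i. \<Sum>j<M. g j i)"
    using assms(3) unfolding conic_sums_def by blast
  obtain h where h: "\<And>j. j < N \<Longrightarrow> h j \<in> G" "S' = (\<lambda>i. \<Sum>j<N. h j i)"
    using assms(4) unfolding conic_sums_def by blast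
  have "(\<lambda>i. \<Sum>j\<in>{..<M} <+> {..<N}. case_sum g h j i) \<in> conic_sums (card I) G"
    by (rule caratheodory_conic_sums[OF assms(1,2)]) (use g(1) h(1) in auto)
  moreover have "(\<Sum>j\<in>{..<M} <+> {..<N}. case_sum g h j i) = S i + S' i" for i
    unfolding g(2) h(2) by (simp add: sum.Plus)
  ultimately show ?thesis by simp
qed

lemma generator_in_conic_sums_1: "g \<in> G \<Longrightarrow> g \<in> conic_sums 1 G"
  unfolding conic_sums_def by (auto intro!: exI[of _ "\<lambda>j. g"])

lemma conic_sums_scale:
  assumes "conic_on I G" "S \<in> conic_sums N G" "0 \<le> t"
  shows "(\<lambda>i. t * S i) \<in> conic_sums N G"
proof -
  obtain h where h: "\<And>j. j < N \<Longrightarrow> h j \<in> G" "S = (\<lambda>i. \<Sum>j<N. h j i)"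
    using assms(2) unfolding conic_sums_def by blast
  have "\<forall>j<N. (\<lambda>i. t * h j i) \<in> G" using h(1) assms(1,3) unfolding conic_on_def by blast
  then show ?thesis unfolding conic_sums_def h(2) sum_distrib_left
    by (intro CollectI exI[of _ "\<lambda>j i. t * h j i"]) simp
qed

lemma conic_sums_zero: "conic_on I G \<Longrightarrow> (\<lambda>i. 0) \<in> conic_sums N G"
  unfolding conic_sums_def using conic_on_zero by (auto intro!: exI[of _ "\<lambda>j i. 0"])

lemma conic_sums_support: "conic_on I G \<Longrightarrow> S \<in> conic_sums N G \<Longrightarrow> i \<notin> I \<Longrightarrow> S i = 0"
  unfolding conic_sums_def conic_on_def by (auto intro!: sum.neutral)

lemma continuous_on_eval [continuous_intros]: "continuous_on S (\<lambda>f. f i)"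
  by (rule continuous_on_subset[OF continuous_on_product_coordinates]) simp

lemma compact_conic_sums:
  fixes T :: "('i \<Rightarrow> real) set"
  assumes "compact T" shows "compact (conic_sums N T)"
proof (induction N)
  case 0
  have "conic_sums 0 T = {\<lambda>i. 0}" unfolding conic_sums_def by auto
  then show ?case by simp
next
  case (Suc N)
  have im: "conic_sums (Suc N) T = (\<lambda>p i. fst p i + snd p i) ` (conic_sums N T \<times> T)"
  proof (intro equalityI subsetI)
    fix f assume "f \<in> conic_sums (Suc N) T"
    then obtain g where g: "\<forall>j<Suc N. g j \<in> T" "f = (\<lambda>i. \<Sum>j<Suc N. g j i)" unfolding conic_sums_def by blast
    then have "(\<lambda>i. \<Sum>j<N. g j i, g N) \<in> conic_sums N T \<times> T"
      unfolding conic_sums_def by (auto intro!: exI[of _ g])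
    moreover have "f = (\<lambda>p i. fst p i + snd p i) (\<lambda>i. \<Sum>j<N. g j i, g N)" unfolding g(2) by simp
    ultimately show "f \<in> (\<lambda>p i. fst p i + snd p i) ` (conic_sums N T \<times> T)" by (rule rev_image_eqI)
  next
    fix f assume "f \<in> (\<lambda>p i. fst p i + snd p i) ` (conic_sums N T \<times> T)"
    then obtain s h where sh: "s \<in> conic_sums N T" "h \<in> T" "f = (\<lambda>i. s i + h i)" by auto
    then obtain g where g: "\<forall>j<N. g j \<in> T" "s = (\<lambda>i. \<Sum>j<N. g j i)" unfolding conic_sums_def by blast
    have "f = (\<lambda>i. \<Sum>j<Suc N. (g(N := h)) j i)" unfolding sh(3) g(2) by (auto intro!: sum.cong)
    moreover have "\<forall>j<Suc N. (g(N := h)) j \<in> T" using g(1) sh(2) by (auto simp: less_Suc_eq)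
    ultimately show "f \<in> conic_sums (Suc N) T" unfolding conic_sums_def by blast
  qed
  have cont: "continuous_on X (\<lambda>p i. fst p i + snd p i :: real)" for X :: "(('i \<Rightarrow> real) \<times> ('i \<Rightarrow> real)) set"
    by (intro continuous_on_coordinatewise_then_product continuous_on_add
          continuous_on_product_then_coordinatewise[OF continuous_on_fst[OF continuous_on_id]]
          continuous_on_product_then_coordinatewise[OF continuous_on_snd[OF continuous_on_id]])
  show ?case unfolding im by (rule compact_continuous_image[OF cont compact_Times[OF Suc assms]])
qed

lemma compact_function_box:
  fixes S :: "'i \<Rightarrow> real set"
  assumes "\<And>i. compact (S i)" shows "compact {f. \<forall>i. f i \<in> S i}"
proof -
  have "compactin (product_topology (\<lambda>i. euclidean) UNIV) (PiE UNIV S)"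
    unfolding compactin_PiE using assms by simp
  moreover have "PiE UNIV S = {f. \<forall>i. f i \<in> S i}" by (auto simp: PiE_def Pi_def)
  ultimately show ?thesis by (simp add: euclidean_product_topology)
qed

text \<open>
  Let \<open>S\<close> be the point of the cone nearest to \<open>B\<close>. It exists: \<open>S\<close> may be sought among points not farther
  from \<open>B\<close> than the origin, for these the functional \<open>w\<close>, and with it every generator involved, is
  bounded, and sums of boundedly many generators from a compact set form a compact set. Moving from \<open>S\<close> in
  the direction of a generator, or towards the origin, does not decrease the distance; the first-order
  conditions are that \<open>B - S\<close> is nonpositive on the generators and nonnegative on \<open>S\<close>.
\<close>

lemma conic_separation:
  fixes G :: "('i \<Rightarrow> real) set"
  assumes I: "finite I" and G: "conic_on I G"
    and cl: "\<And>b. \<exists>T. compact T \<and> T \<subseteq> G \<and> {g \<in> G. \<forall>i. \<bar>g i\<bar> \<le> b} \<subseteq> T"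
    and pt: "\<And>g i. g \<in> G \<Longrightarrow> \<bar>g i\<bar> \<le> (\<Sum>i\<in>I. w i * g i)"
    and B: "\<And>i. i \<notin> I \<Longrightarrow> B i = 0" "B \<notin> conic_sums (card I) G"
  shows "\<exists>S \<in> conic_sums (card I) G. (\<forall>g\<in>G. (\<Sum>i\<in>I. (B i - S i) * g i) \<le> 0) \<and> 0 < (\<Sum>i\<in>I. (B i - S i) * B i)"
proof -
  let ?N = "card I" and ?l = "\<lambda>f. \<Sum>i\<in>I. w i * f i" and ?D = "\<lambda>S. \<Sum>i\<in>I. (B i - S i)\<^sup>2"
  define D0 where "D0 = (\<Sum>i\<in>I. (B i)\<^sup>2)"
  \<comment> \<open>A bound for the functional \<open>w\<close> on all points that are as close to \<open>B\<close> as the origin is.\<close>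
  define b where "b = (\<Sum>i\<in>I. \<bar>w i\<bar> * (\<bar>B i\<bar> + sqrt D0))"
  have D0: "0 \<le> D0" unfolding D0_def by (simp add: sum_nonneg)
  have b: "0 \<le> b" unfolding b_def using D0 by (auto intro!: sum_nonneg)
  obtain T where T: "compact T" "T \<subseteq> G" "{g \<in> G. \<forall>i. \<bar>g i\<bar> \<le> b} \<subseteq> T" using cl by blast
  have inT: "S \<in> conic_sums ?N T" if S: "S \<in> conic_sums ?N G" and le: "?D S \<le> D0" for S
  proof -
    obtain h where h: "\<And>j. j < ?N \<Longrightarrow> h j \<in> G" "S = (\<lambda>i. \<Sum>j<?N. h j i)"
      using S unfolding conic_sums_def by blast
    have Si: "\<bar>S i\<bar> \<le> \<bar>B i\<bar> + sqrt D0" if "i \<in> I" for i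
    proof -
      have "(B i - S i)\<^sup>2 \<le> ?D S" by (rule member_le_sum[OF that]) (use I in auto)
      then have "\<bar>B i - S i\<bar> \<le> sqrt D0" using le by (intro real_le_rsqrt) simp
      then show ?thesis by linarith
    qed
    have "?l S \<le> b" unfolding b_def
    proof (rule sum_mono)
      fix i assume i: "i \<in> I"
      have "w i * S i \<le> \<bar>w i\<bar> * \<bar>S i\<bar>" by (metis abs_ge_self abs_mult)
      also have "\<dots> \<le> \<bar>w i\<bar> * (\<bar>B i\<bar> + sqrt D0)" by (intro mult_left_mono Si i) simp
      finally show "w i * S i \<le> \<bar>w i\<bar> * (\<bar>B i\<bar> + sqrt D0)" .
    qed
    moreover have "?l S = (\<Sum>j<?N. ?l (h j))"
      unfolding h(2) sum_distrib_left by (rule sum.swap)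
    moreover have "0 \<le> ?l (h j)" if "j < ?N" for j
      using pt[OF h(1)[OF that]] abs_ge_zero order_trans by blast
    ultimately have "?l (h j) \<le> b" if "j < ?N" for j
      using member_le_sum[of j "{..<?N}" "\<lambda>j. ?l (h j)"] that by force
    then have "h j \<in> T" if "j < ?N" for j
      using T(3) h(1) pt that by (blast intro: order_trans)
    then show ?thesis unfolding conic_sums_def h(2) by blast
  qed
  have z: "(\<lambda>i. 0) \<in> conic_sums ?N G" by (rule conic_sums_zero[OF G])
  have Dz: "?D (\<lambda>i. 0) = D0" unfolding D0_def by simp
  have "conic_sums ?N T \<noteq> {}" using inT[OF z] Dz by auto
  moreover have "continuous_on X ?D" for X by (intro continuous_intros)
  ultimately obtain S where S: "S \<in> conic_sums ?N T" "\<And>S'. S' \<in> conic_sums ?N T \<Longrightarrow> ?D S \<le> ?D S'"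
    using continuous_attains_inf[OF compact_conic_sums[OF T(1)]] by meson
  have SG: "S \<in> conic_sums ?N G" using S(1) T(2) unfolding conic_sums_def by blast
  have min: "?D S \<le> ?D S'" if "S' \<in> conic_sums ?N G" for S'
  proof (cases "?D S' \<le> D0")
    case True then show ?thesis using S(2) inT that by blast
  next
    case False
    have "?D S \<le> D0" using S(2)[OF inT[OF z]] Dz by simp
    then show ?thesis using False by simp
  qed
  let ?R = "\<lambda>i. B i - S i"
  have key: "(\<Sum>i\<in>I. ?R i * g i) \<le> 0"
    if step: "\<And>t. 0 \<le> t \<Longrightarrow> t \<le> 1 \<Longrightarrow> (\<lambda>i. S i + t * g i) \<in> conic_sums ?N G" for g
  proof (rule ccontr)
    define a n where "a = (\<Sum>i\<in>I. ?R i * g i)" and "n = (\<Sum>i\<in>I. (g i)\<^sup>2)"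
    assume "\<not> (\<Sum>i\<in>I. ?R i * g i) \<le> 0"
    then have a: "0 < a" unfolding a_def by simp
    have n: "0 \<le> n" unfolding n_def by (simp add: sum_nonneg)
    \<comment> \<open>The squared distance changes by \<open>- 2 t a + t\<^sup>2 n\<close>, which is negative for this small \<open>t\<close>.\<close>
    define t where "t = a / (n + a + 1)"
    have t: "0 < t" "t \<le> 1" unfolding t_def using a n by simp_all
    have "?D (\<lambda>i. S i + t * g i) = (\<Sum>i\<in>I. (?R i)\<^sup>2 - 2 * t * (?R i * g i) + t\<^sup>2 * (g i)\<^sup>2)"
      by (intro sum.cong refl) (simp add: power2_eq_square algebra_simps)
    also have "\<dots> = ?D S - 2 * t * a + t\<^sup>2 * n"
      unfolding a_def n_def by (simp add: sum.distrib sum_subtractf sum_distrib_left)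
    finally have "2 * t * a \<le> t\<^sup>2 * n" using min[OF step[of t]] t by simp
    then have "2 * a \<le> t * n" using t(1) by (simp add: power2_eq_square mult.assoc)
    also have "t * n \<le> a" unfolding t_def using a n by (simp add: field_simps)
    finally show False using a by simp
  qed
  have "(\<Sum>i\<in>I. ?R i * g i) \<le> 0" if g: "g \<in> G" for g
  proof (rule key)
    fix t :: real assume "0 \<le> t"
    then have "(\<lambda>i. t * g i) \<in> G" using G g unfolding conic_on_def by blast
    then show "(\<lambda>i. S i + t * g i) \<in> conic_sums ?N G" by (rule conic_sums_add[OF I G SG generator_in_conic_sums_1])
  qed
  moreover have "0 < (\<Sum>i\<in>I. ?R i * B i)"
  proof -
    \<comment> \<open>Moving towards the origin stays in the cone.\<close>
    have "(\<Sum>i\<in>I. ?R i * - S i) \<le> 0"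
    proof (rule key)
      fix t :: real assume "0 \<le> t" "t \<le> 1"
      then have "(\<lambda>i. (1 - t) * S i) \<in> conic_sums ?N G" by (intro conic_sums_scale[OF G SG]) simp
      then show "(\<lambda>i. S i + t * - S i) \<in> conic_sums ?N G" by (simp add: algebra_simps)
    qed
    then have S0: "0 \<le> (\<Sum>i\<in>I. ?R i * S i)" by (simp add: sum_negf)
    obtain i where i: "B i \<noteq> S i" using B(2) SG by (metis ext)
    then have "i \<in> I" using B(1) conic_sums_support[OF G SG] by metis
    then have "0 < (\<Sum>i\<in>I. (?R i)\<^sup>2)" using i I by (intro sum_pos2[of _ i]) auto
    also have "(\<Sum>i\<in>I. (?R i)\<^sup>2) = (\<Sum>i\<in>I. ?R i * B i) - (\<Sum>i\<in>I. ?R i * S i)"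
      unfolding sum_subtractf[symmetric] by (intro sum.cong refl) (simp add: power2_eq_square algebra_simps)
    finally show ?thesis using S0 by simp
  qed
  ultimately show ?thesis using SG by blast
qed

text \<open>
  In finite dimension a linear space is determined by its annihilator; the indices are eliminated one by one.
\<close>

lemma subspace_double_annihilator:
  fixes W :: "('i \<Rightarrow> real) set"
  assumes "finite I" "W \<noteq> {}" "\<And>u v a b. u \<in> W \<Longrightarrow> v \<in> W \<Longrightarrow> (\<lambda>i. a * u i + b * v i) \<in> W"
    and "\<And>R. (\<And>w. w \<in> W \<Longrightarrow> (\<Sum>i\<in>I. R i * w i) = 0) \<Longrightarrow> (\<Sum>i\<in>I. R i * B i) = 0"
  shows "\<exists>w\<in>W. \<forall>i\<in>I. w i = B i"
  using assms
proof (induction I arbitrary: W B rule: finite_induct)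
  case empty then show ?case by blast
next
  case (insert a I)
  note lin = insert.prems(2) and ann = insert.prems(3)
  show ?case
  proof (cases "\<forall>w\<in>W. w a = 0")
    case True
    have "B a = 0"
      using ann[of "\<lambda>i. if i = a then 1 else 0"] True insert.hyps
      by (simp add: if_distrib[of "\<lambda>z. z * _"] cong: if_cong)
    have "\<exists>w\<in>W. \<forall>i\<in>I. w i = B i"
    proof (rule insert.IH[OF insert.prems(1) lin])
      fix R assume R: "\<And>w. w \<in> W \<Longrightarrow> (\<Sum>i\<in>I. R i * w i) = 0"
      have "(\<Sum>i\<in>insert a I. R i * B i) = 0" using True R insert.hyps by (intro ann) simp
      then show "(\<Sum>i\<in>I. R i * B i) = 0" using \<open>B a = 0\<close> insert.hyps by simp
    qed
    then show ?thesis using True \<open>B a = 0\<close> by auto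
  next
    case False
    then obtain w0 where w0: "w0 \<in> W" "w0 a \<noteq> 0" by blast
    define v where "v = (\<lambda>i. 1 / w0 a * w0 i + 0 * w0 i)"
    have v: "v \<in> W" "v a = 1" using lin[OF w0(1) w0(1), of "1 / w0 a" 0] w0(2) by (simp_all add: v_def)
    let ?W = "{w \<in> W. w a = 0}" and ?B = "\<lambda>i. B i - B a * v i"
    have "\<exists>w\<in>?W. \<forall>i\<in>I. w i = ?B i"
    proof (rule insert.IH)
      have "(\<lambda>i. 0 * v i + 0 * v i) \<in> W" using lin[OF v(1) v(1)] .
      then show "?W \<noteq> {}" by auto
      show "(\<lambda>i. p * u i + q * w i) \<in> ?W" if "u \<in> ?W" "w \<in> ?W" for u w p q
        using that lin by simp
      fix R assume R: "\<And>w. w \<in> ?W \<Longrightarrow> (\<Sum>i\<in>I. R i * w i) = 0"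
      define s where "s = (\<Sum>i\<in>I. R i * v i)"
      let ?R = "R(a := - s)"
      have split: "(\<Sum>i\<in>insert a I. ?R i * f i) = - s * f a + (\<Sum>i\<in>I. R i * f i)" for f
        using insert.hyps by (auto intro!: sum.cong)
      have "(\<Sum>i\<in>insert a I. ?R i * w i) = 0" if w: "w \<in> W" for w
      proof -
        have "(\<lambda>i. 1 * w i + - w a * v i) \<in> ?W" using lin[OF w v(1), of 1 "- w a"] v(2) by simp
        from R[OF this] have "(\<Sum>i\<in>I. R i * w i) - w a * s = 0"
          unfolding s_def sum_distrib_left sum_subtractf[symmetric] by (simp add: algebra_simps)
        then show ?thesis unfolding split by simp
      qed
      from ann[OF this] have "(\<Sum>i\<in>I. R i * B i) - B a * s = 0" unfolding split by simp
      then show "(\<Sum>i\<in>I. R i * ?B i) = 0"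
        unfolding s_def sum_distrib_left sum_subtractf[symmetric] by (simp add: algebra_simps)
    qed
    then obtain w where w: "w \<in> W" "w a = 0" "\<And>i. i \<in> I \<Longrightarrow> w i = ?B i" by blast
    have "(\<lambda>i. 1 * w i + B a * v i) \<in> W" by (rule lin[OF w(1) v(1)])
    moreover have "\<forall>i\<in>insert a I. 1 * w i + B a * v i = B i" using w v(2) by auto
    ultimately show ?thesis by (intro bexI[of _ "\<lambda>i. 1 * w i + B a * v i"])
  qed
qed

section \<open>From dominated squares to sums of squares\<close>

lemma sum_lists_append:
  "(\<Sum>is | length (is::'n::finite list) = a + b. (h is :: real))
    = (\<Sum>u | length u = a. \<Sum>v | length v = b. h (u @ v))"
proof (induction a arbitrary: h)
  case 0 then show ?case by simp
next
  case (Suc a)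
  show ?case by (simp add: sum_lists_Suc Suc del: length_Suc_conv)
qed

text \<open>
  The tensor product of \<open>C\<close> with itself. It represents the square of the form of \<open>C\<close> but is in general not
  symmetric; sums of such tensors are the Gram matrices of sums of squares.
\<close>

definition tensor_square :: "nat \<Rightarrow> 'n::finite tensor \<Rightarrow> 'n tensor" where
  "tensor_square k C is = (if length is = 2 * k then C (take k is) * C (drop k is) else 0)"

lemma tensor_form_square: "tensor_form (2 * k) (tensor_square k C) x = (tensor_form k C x)\<^sup>2"
proof -
  have "tensor_form (2 * k) (tensor_square k C) x
    = (\<Sum>u | length u = k. \<Sum>v | length v = k. tensor_square k C (u @ v) * (\<Prod>i\<leftarrow>u @ v. x $ i))"
    unfolding tensor_form_def mult_2 by (rule sum_lists_append)
  also have "\<dots> = (\<Sum>u | length u = k. \<Sum>v | length v = k.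
      (C u * (\<Prod>i\<leftarrow>u. x $ i)) * (C v * (\<Prod>i\<leftarrow>v. x $ i)))"
    by (intro sum.cong refl) (simp add: tensor_square_def mult_2 mult_ac)
  also have "\<dots> = (tensor_form k C x)\<^sup>2"
    unfolding tensor_form_def power2_eq_square sum_product ..
  finally show ?thesis .
qed

lemma tensor_form_sum: "tensor_form m (\<lambda>is. \<Sum>j\<in>J. A j is) x = (\<Sum>j\<in>J. tensor_form m (A j) x)"
  unfolding tensor_form_eq_inner by (rule tensor_inner_sum_left)

lemma tensor_form_add: "tensor_form m (\<lambda>is. A is + B is) x = tensor_form m A x + tensor_form m B x"
  unfolding tensor_form_def by (simp add: distrib_right sum.distrib)

lemma tensor_form_cmult: "tensor_form m (\<lambda>is. c * A is) x = c * tensor_form m A x"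
  unfolding tensor_form_def by (simp add: sum_distrib_left mult_ac)

lemma continuous_on_tensor_form: "continuous_on S (\<lambda>A. tensor_form m A x)"
  unfolding tensor_form_def by (intro continuous_intros)

lemma closed_sym_tensors: "closed (sym_tensors m)"
proof -
  have "sym_tensors m = (\<Inter>is\<in>{is. length is \<noteq> m}. {A::'a tensor. A is = 0}) \<inter>
     (\<Inter>is\<in>{is. length is = m}. \<Inter>p\<in>{p. p permutes {..<m}}. {A. A (permute_list p is) = A is})"
    unfolding sym_tensors_def by blast
  moreover have "closed {A::'a tensor. A is = 0}" for "is"
    by (intro closed_Collect_eq continuous_intros)
  moreover have "closed {A::'a tensor. A is = A js}" for "is" js
    by (intro closed_Collect_eq continuous_intros)
  ultimately show ?thesis by (auto intro!: closed_Int closed_INT)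
qed

lemma compact_sym_tensors_box:
  "compact {C \<in> sym_tensors k. \<forall>is. \<bar>C is\<bar> \<le> (b::real)}"
proof -
  have box: "\<bar>x\<bar> \<le> b \<longleftrightarrow> x \<in> {- b..b}" for x by auto
  have eq: "{C \<in> sym_tensors k. \<forall>is. \<bar>C is\<bar> \<le> b} = {C. \<forall>is. C is \<in> {- b..b}} \<inter> sym_tensors k"
    by (simp only: box) blast
  show ?thesis unfolding eq
    by (rule compact_Int_closed[OF compact_function_box[of "\<lambda>_. {- b..b}"] closed_sym_tensors]) simp
qed

text \<open>
  Finitely many point evaluations determine a symmetric tensor, with a uniform estimate. On the compact set
  of tensors of norm 1, some point value is nonzero for each tensor; compactness reduces to finitely many
  points and bounds the sum of the absolute values there from below. Homogeneity does the rest.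
\<close>

lemma norming_points:
  "\<exists>X e. finite X \<and> 0 < e \<and>
    (\<forall>C\<in>sym_tensors k. \<forall>is. e * \<bar>C is\<bar> \<le> (\<Sum>x\<in>X. \<bar>tensor_form k (C :: 'n::finite tensor) x\<bar>))"
proof -
  let ?L = "{is :: 'n list. length is = k}"
  let ?n = "\<lambda>C. \<Sum>is\<in>?L. \<bar>C is\<bar>"
  \<comment> \<open>Sphere of the norm given by the sum of absolute values; the box condition is implied and gives compactness.\<close>
  define Sph where "Sph = {C \<in> sym_tensors k. \<forall>is. \<bar>C is\<bar> \<le> 1} \<inter> {C :: 'n tensor. ?n C = 1}"
  have fin: "finite ?L" by (rule finite_lists_length)
  have le: "\<bar>C is\<bar> \<le> ?n C" if "C \<in> sym_tensors k" for C "is"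
  proof (cases "length is = k")
    case True then show ?thesis by (intro member_le_sum[of "is" ?L "\<lambda>is. \<bar>C is\<bar>"]) (use fin in auto)
  next
    case False then show ?thesis using that by (simp add: sym_tensors_def sum_nonneg)
  qed
  have comp: "compact Sph" unfolding Sph_def
    by (intro compact_Int_closed compact_sym_tensors_box closed_Collect_eq continuous_intros)
  have cover: "Sph \<subseteq> (\<Union>x\<in>UNIV. {C. tensor_form k C x \<noteq> 0})"
  proof
    fix C assume C: "C \<in> Sph"
    show "C \<in> (\<Union>x\<in>UNIV. {C. tensor_form k C x \<noteq> 0})"
    proof (rule ccontr)
      assume "C \<notin> (\<Union>x\<in>UNIV. {C. tensor_form k C x \<noteq> 0})"
      then have z: "tensor_form k C x = 0" for x by blast
      have "C is = 0" if "is \<in> ?L" for "is"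
      proof (rule tensor_form_eq_0_imp[where m = k])
        show "C is = C js" if "mset is = mset js" for "is" js
          using C that unfolding Sph_def sym_tensors_iff_mset by blast
      qed (use z that in auto)
      then have "?n C = 0" by simp
      then show False using C unfolding Sph_def by simp
    qed
  qed
  have "open {C. tensor_form k C x \<noteq> 0}" for x :: "real^'n"
    by (intro open_Collect_neq continuous_on_tensor_form continuous_intros)
  from compactE_image[OF comp this cover]
  obtain X :: "(real^'n) set" where X: "finite X" "Sph \<subseteq> (\<Union>x\<in>X. {C. tensor_form k C x \<noteq> 0})"
    by (metis (no_types, lifting))
  let ?P = "\<lambda>C. \<Sum>x\<in>X. \<bar>tensor_form k C x\<bar>"
  have pos: "0 < ?P C" if C: "C \<in> Sph" for C
  proof -
    obtain x where "x \<in> X" "tensor_form k C x \<noteq> 0" using X(2) C by blast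
    then show ?thesis using X(1) by (intro sum_pos2[of _ x]) auto
  qed
  have "\<exists>e>0. \<forall>C\<in>Sph. e \<le> ?P C"
  proof (cases "Sph = {}")
    case True then show ?thesis by (intro exI[of _ 1]) simp
  next
    case False
    have "continuous_on Sph ?P" by (intro continuous_intros continuous_on_tensor_form)
    from continuous_attains_inf[OF comp False this] pos show ?thesis by blast
  qed
  then obtain e where e: "0 < e" "\<And>C. C \<in> Sph \<Longrightarrow> e \<le> ?P C" by blast
  have "e * \<bar>C is\<bar> \<le> ?P C" if C: "C \<in> sym_tensors k" for C "is"
  proof (cases "?n C = 0")
    case True
    then have "C is = 0" using le[OF C, of "is"] by simp
    then show ?thesis by (simp add: sum_nonneg)
  next
    case False
    then have n: "0 < ?n C" by (simp add: less_le sum_nonneg)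
    define D where "D = (\<lambda>is. 1 / ?n C * C is + 0 * C is)"
    have D: "D \<in> sym_tensors k" unfolding D_def by (rule sym_tensors_lincomb[OF C C])
    have Ds: "?n D = 1"
    proof -
      have "?n D = (\<Sum>is\<in>?L. \<bar>C is\<bar> / ?n C)"
        unfolding D_def using n by (intro sum.cong refl) (simp add: abs_mult)
      then show ?thesis unfolding sum_divide_distrib[symmetric] using n by simp
    qed
    have "D \<in> Sph" unfolding Sph_def using D Ds le[OF D] by simp
    then have "e \<le> ?P D" by (rule e(2))
    also have "?P D = ?P C / ?n C"
    proof -
      have "tensor_form k D x = 1 / ?n C * tensor_form k C x" for x
        unfolding D_def mult_zero_left add_0_right by (rule tensor_form_cmult)
      then show ?thesis using n by (simp add: abs_mult sum_divide_distrib)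
    qed
    finally have "e * ?n C \<le> ?P C" using n by (simp add: field_simps)
    moreover have "e * \<bar>C is\<bar> \<le> e * ?n C" using le[OF C] e(1) by (intro mult_left_mono) auto
    ultimately show ?thesis by linarith
  qed
  then show ?thesis using X(1) e(1) by blast
qed

text \<open>
  Among the sums of squares below \<open>F\<close>, take one with the largest sum of values at the norming points. The
  maximum is attained, since all squares that occur are below \<open>F\<close>, which bounds their tensors through the
  norming points. If something were left of \<open>F\<close>, the remainder would dominate the square of some \<open>q \<noteq> 0\<close>, and
  adding this square would increase the maximum, because \<open>q\<close> does not vanish at all norming points.
\<close>

lemma psd_form_sum_of_squares:
  fixes F :: "real^'n::finite \<Rightarrow> real"
  assumes H: "\<And>f :: real^'n \<Rightarrow> real. is_form (2 * k) f \<Longrightarrow> (\<And>x. 0 \<le> f x) \<Longrightarrow> (\<exists>u. f u \<noteq> 0) \<Longrightarrow> dominates_square k f"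
    and F: "is_form (2 * k) F" and psd: "\<And>x. 0 \<le> F x"
  shows "\<exists>(r::nat) C. (\<forall>j<r. C j \<in> sym_tensors k) \<and> (\<forall>x. F x = (\<Sum>j<r. (tensor_form k (C j) x)\<^sup>2))"
proof -
  let ?I = "{is :: 'n list. length is = 2 * k}"
  let ?N = "card ?I"
  let ?G = "tensor_square k ` (sym_tensors k :: 'n tensor set)"
  have I: "finite ?I" by (rule finite_lists_length)
  have G: "conic_on ?I ?G"
    unfolding conic_on_def
  proof (intro conjI ballI allI impI)
    have "(\<lambda>is. 0) \<in> (sym_tensors k :: 'n tensor set)" unfolding sym_tensors_def by simp
    then show "?G \<noteq> {}" by blast
    fix g assume g: "g \<in> ?G"
    show "g is = 0" if "is \<notin> ?I" for "is" using g that by (auto simp: tensor_square_def)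
    fix t :: real assume t: "0 \<le> t"
    obtain C where C: "C \<in> sym_tensors k" "g = tensor_square k C" using g by blast
    define D where "D = (\<lambda>is. sqrt t * C is + 0 * C is)"
    have "D \<in> sym_tensors k" unfolding D_def by (rule sym_tensors_lincomb[OF C(1) C(1)])
    moreover have "(\<lambda>is. t * g is) = tensor_square k D"
      unfolding C(2) tensor_square_def[abs_def] D_def using t by (auto simp: fun_eq_iff)
    ultimately show "(\<lambda>is. t * g is) \<in> ?G" by (metis imageI)
  qed
  obtain X :: "(real^'n) set" and e where X: "finite X" "0 < e"
    "\<And>C is. C \<in> sym_tensors k \<Longrightarrow> e * \<bar>C is\<bar> \<le> (\<Sum>x\<in>X. \<bar>tensor_form k C x\<bar>)"
    using norming_points[of k, where 'n = 'n] by blast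
  \<comment> \<open>The norming points turn \<open>(tensor_form k C x)\<^sup>2 \<le> F x\<close> into the bound \<open>b\<close> for the entries of \<open>C\<close>.\<close>
  define b where "b = (\<Sum>x\<in>X. sqrt (F x)) / e"
  define T where "T = tensor_square k ` {C \<in> (sym_tensors k :: 'n tensor set). \<forall>is. \<bar>C is\<bar> \<le> b}"
  have T: "compact T"
    unfolding T_def
  proof (rule compact_continuous_image[OF _ compact_sym_tensors_box])
    have "continuous_on S (\<lambda>C. tensor_square k C is)" for S :: "'n tensor set" and "is"
      by (cases "length is = 2 * k") (simp_all add: tensor_square_def[abs_def] continuous_intros)
    then show "continuous_on S (tensor_square k)" for S :: "'n tensor set"
      by (rule continuous_on_coordinatewise_then_product)
  qed
  define K where "K = conic_sums ?N T \<inter> {S. \<forall>x. tensor_form (2 * k) S x \<le> F x}"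
  have TG: "T \<subseteq> ?G" unfolding T_def by blast
  have formS: "\<exists>C. (\<forall>j<?N. C j \<in> sym_tensors k) \<and> S = (\<lambda>i. \<Sum>j<?N. tensor_square k (C j) i) \<and>
      (\<forall>x. tensor_form (2 * k) S x = (\<Sum>j<?N. (tensor_form k (C j) x)\<^sup>2))"
    if S: "S \<in> conic_sums ?N ?G" for S
  proof -
    obtain h where h: "\<forall>j<?N. h j \<in> ?G" "S = (\<lambda>i. \<Sum>j<?N. h j i)"
      using S unfolding conic_sums_def by blast
    have "\<forall>j. \<exists>C. j < ?N \<longrightarrow> C \<in> sym_tensors k \<and> h j = tensor_square k C" using h(1) by blast
    then obtain C where C: "\<And>j. j < ?N \<Longrightarrow> C j \<in> sym_tensors k \<and> h j = tensor_square k (C j)" by metis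
    have S': "S = (\<lambda>i. \<Sum>j<?N. tensor_square k (C j) i)" unfolding h(2) using C by simp
    have "tensor_form (2 * k) S x = (\<Sum>j<?N. (tensor_form k (C j) x)\<^sup>2)" for x
      unfolding S' tensor_form_sum tensor_form_square ..
    then show ?thesis using C S' by (intro exI[of _ C]) simp
  qed
  have inK: "S \<in> K" if S: "S \<in> conic_sums ?N ?G" and le: "\<And>x. tensor_form (2 * k) S x \<le> F x" for S
  proof -
    obtain C where C: "\<forall>j<?N. C j \<in> sym_tensors k" "S = (\<lambda>i. \<Sum>j<?N. tensor_square k (C j) i)"
      "\<forall>x. tensor_form (2 * k) S x = (\<Sum>j<?N. (tensor_form k (C j) x)\<^sup>2)" using formS[OF S] by blast
    have "tensor_square k (C j) \<in> T" if j: "j < ?N" for j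
    proof -
      have "\<bar>tensor_form k (C j) x\<bar> \<le> sqrt (F x)" for x
      proof -
        have "(tensor_form k (C j) x)\<^sup>2 \<le> F x"
          using component_square_le[OF j, of "\<lambda>j. tensor_form k (C j) x"] le[of x] C(3) by (metis order_trans)
        then show ?thesis by (intro real_le_rsqrt) simp
      qed
      then have "e * \<bar>C j is\<bar> \<le> (\<Sum>x\<in>X. sqrt (F x))" for "is"
        using X(3)[of "C j" "is"] C(1) j by (meson order_trans sum_mono)
      then have "\<bar>C j is\<bar> \<le> b" for "is" unfolding b_def using X(2) by (simp add: field_simps)
      then show ?thesis unfolding T_def using C(1) j by blast
    qed
    then have "S \<in> conic_sums ?N T" unfolding conic_sums_def C(2)
      by (auto intro!: exI[of _ "\<lambda>j. tensor_square k (C j)"])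
    then show ?thesis unfolding K_def using le by blast
  qed
  have "compact K" unfolding K_def
    by (intro compact_Int_closed compact_conic_sums T closed_Collect_all closed_Collect_le
        continuous_on_tensor_form continuous_on_const)
  moreover have "(\<lambda>i. 0) \<in> K"
    by (rule inK[OF conic_sums_zero[OF G]]) (use psd in \<open>simp add: tensor_form_def\<close>)
  then have "K \<noteq> {}" by blast
  moreover have "continuous_on K (\<lambda>S. \<Sum>x\<in>X. tensor_form (2 * k) S x)"
    by (intro continuous_on_sum continuous_on_tensor_form)
  ultimately obtain S where S: "S \<in> K"
    "\<And>S'. S' \<in> K \<Longrightarrow> (\<Sum>x\<in>X. tensor_form (2 * k) S' x) \<le> (\<Sum>x\<in>X. tensor_form (2 * k) S x)"
    using continuous_attains_sup[of K "\<lambda>S. \<Sum>x\<in>X. tensor_form (2 * k) S x"] by blast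
  have SG: "S \<in> conic_sums ?N ?G" using S(1) TG unfolding K_def conic_sums_def by blast
  have SF: "tensor_form (2 * k) S x \<le> F x" for x using S(1) unfolding K_def by blast
  have "F x = tensor_form (2 * k) S x" for x
  proof (rule ccontr)
    assume "F x \<noteq> tensor_form (2 * k) S x"
    then have "dominates_square k (\<lambda>x. F x - tensor_form (2 * k) S x)"
      by (intro H is_form_diff F is_form_tensor_form) (use SF in auto)
    then obtain q y where q: "is_form k q" "q y \<noteq> 0" "\<And>x. (q x)\<^sup>2 \<le> F x - tensor_form (2 * k) S x"
      unfolding dominates_square_def by blast
    obtain C where C: "C \<in> sym_tensors k" "tensor_form k C = q" using is_form_imp_sym_tensor[OF q(1)] by blast
    define S' where "S' = (\<lambda>i. S i + tensor_square k C i)"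
    have S': "tensor_form (2 * k) S' x = tensor_form (2 * k) S x + (q x)\<^sup>2" for x
      unfolding S'_def tensor_form_add tensor_form_square C(2) ..
    have "S' \<in> K"
    proof (rule inK)
      show "S' \<in> conic_sums ?N ?G" unfolding S'_def
        by (rule conic_sums_add[OF I G SG generator_in_conic_sums_1]) (use C(1) in blast)
      show "tensor_form (2 * k) S' x \<le> F x" for x unfolding S' using q(3)[of x] by simp
    qed
    from S(2)[OF this] have "(\<Sum>x\<in>X. (q x)\<^sup>2) \<le> 0" unfolding S' by (simp add: sum.distrib)
    then have "\<forall>x\<in>X. q x = 0" using X(1) sum_nonneg_eq_0_iff[of X "\<lambda>x. (q x)\<^sup>2"]
      by (metis (no_types, lifting) order_antisym power_eq_0_iff sum_nonneg zero_le_power2)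
    then have "e * \<bar>C is\<bar> \<le> 0" for "is" using X(3)[OF C(1), of "is"] unfolding C(2) by simp
    then have "C is = 0" for "is" using X(2) by (simp add: mult_le_0_iff)
    then have "tensor_form k C y = 0" unfolding tensor_form_def by simp
    then show False using q(2) C(2) by simp
  qed
  moreover obtain C where "\<forall>j<?N. C j \<in> sym_tensors k"
    "\<forall>x. tensor_form (2 * k) S x = (\<Sum>j<?N. (tensor_form k (C j) x)\<^sup>2)" using formS[OF SG] by blast
  ultimately show ?thesis by (intro exI[of _ ?N] exI[of _ C]) simp
qed

section \<open>Sums of powers and duality\<close>

lemma compact_rank_one_image:
  fixes X :: "(real^'n::finite) set"
  assumes "closed X" shows "compact (rank_one m ` (X \<inter> cball 0 r))"
proof (rule compact_continuous_image)
  have p: "continuous_on S (\<lambda>u. \<Prod>i\<leftarrow>is. u $ i)" for "is" :: "'n list" and S :: "(real^'n) set"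
    by (induction "is") (auto intro!: continuous_intros)
  have "continuous_on S (\<lambda>u. rank_one m u is)" for "is" :: "'n list" and S :: "(real^'n) set"
    by (cases "length is = m") (simp_all add: rank_one_def p)
  then show "continuous_on (X \<inter> cball 0 r) (rank_one m)"
    by (rule continuous_on_coordinatewise_then_product)
  show "compact (X \<inter> cball 0 r)" by (rule closed_Int_compact[OF assms compact_cball])
qed

text \<open>
  The diagonal entry at \<open>i\<close> is \<open>(u $ i) ^ m\<close>, which is at least \<open>\<bar>u $ i\<bar>\<close> in absolute value once this exceeds 1.
\<close>

lemma rank_one_bounded_imp:
  fixes u :: "real^'n::finite"
  assumes m: "1 \<le> m" and b: "\<And>is. \<bar>rank_one m u is\<bar> \<le> b"
  shows "norm u \<le> real CARD('n) * max 1 b"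
proof -
  have "\<bar>u $ i\<bar> \<le> max 1 b" for i
  proof (rule ccontr)
    assume "\<not> \<bar>u $ i\<bar> \<le> max 1 b"
    then have u: "1 < \<bar>u $ i\<bar>" "b < \<bar>u $ i\<bar>" by auto
    have "\<bar>u $ i\<bar> ^ 1 \<le> \<bar>u $ i\<bar> ^ m" using u(1) m by (intro power_increasing) auto
    also have "\<dots> = \<bar>rank_one m u (replicate m i)\<bar>" unfolding rank_one_def by (simp add: power_abs)
    also have "\<dots> \<le> b" by (rule b)
    finally show False using u(2) by simp
  qed
  then have "(\<Sum>i\<in>UNIV. \<bar>u $ i\<bar>) \<le> (\<Sum>i\<in>(UNIV::'n set). max 1 b)" by (intro sum_mono)
  moreover have "norm u \<le> (\<Sum>i\<in>UNIV. \<bar>u $ i\<bar>)" by (rule norm_le_l1_cart)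
  ultimately show ?thesis by simp
qed

lemma conic_rank_one:
  fixes X :: "(real^'n::finite) set"
  assumes m: "1 \<le> m" and X: "X \<noteq> {}" "\<And>t x. 0 \<le> t \<Longrightarrow> x \<in> X \<Longrightarrow> t *\<^sub>R x \<in> X"
  shows "conic_on {is. length is = m} (rank_one m ` X)"
  unfolding conic_on_def
proof (intro conjI ballI allI impI)
  show "rank_one m ` X \<noteq> {}" using X(1) by blast
  fix g assume g: "g \<in> rank_one m ` X"
  show "g is = 0" if "is \<notin> {is. length is = m}" for "is" using g that by (auto simp: rank_one_def)
  fix t :: real assume t: "0 \<le> t"
  obtain u where u: "u \<in> X" "g = rank_one m u" using g by blast
  have "(\<lambda>is. t * g is) = rank_one m (root m t *\<^sub>R u)"
    unfolding u(2) rank_one_scale using t m by (simp add: fun_eq_iff rank_one_scale)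
  moreover have "root m t *\<^sub>R u \<in> X" using X(2)[of "root m t" u] u(1) t by (simp add: real_root_ge_zero)
  ultimately show "(\<lambda>is. t * g is) \<in> rank_one m ` X" by simp
qed

lemma conic_sums_rank_one_iff:
  "S \<in> conic_sums N (rank_one m ` X) \<longleftrightarrow> (\<exists>u. (\<forall>j<N. u j \<in> X) \<and> S = (\<lambda>is. \<Sum>j<N. rank_one m (u j) is))"
proof
  assume "S \<in> conic_sums N (rank_one m ` X)"
  then obtain g where g: "\<forall>j<N. g j \<in> rank_one m ` X" "S = (\<lambda>i. \<Sum>j<N. g j i)" unfolding conic_sums_def by blast
  then have "\<forall>j. \<exists>u. j < N \<longrightarrow> u \<in> X \<and> g j = rank_one m u" by blast
  then obtain u where u: "\<And>j. j < N \<Longrightarrow> u j \<in> X \<and> g j = rank_one m (u j)" by metis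
  then show "\<exists>u. (\<forall>j<N. u j \<in> X) \<and> S = (\<lambda>is. \<Sum>j<N. rank_one m (u j) is)"
    unfolding g(2) by (intro exI[of _ u]) simp
next
  assume "\<exists>u. (\<forall>j<N. u j \<in> X) \<and> S = (\<lambda>is. \<Sum>j<N. rank_one m (u j) is)"
  then obtain u where u: "\<forall>j<N. u j \<in> X" "S = (\<lambda>is. \<Sum>j<N. rank_one m (u j) is)" by blast
  then show "S \<in> conic_sums N (rank_one m ` X)"
    unfolding conic_sums_def by (auto intro!: exI[of _ "\<lambda>j. rank_one m (u j)"])
qed

lemma conic_sums_rank_one_sym: "S \<in> conic_sums N (rank_one m ` X) \<Longrightarrow> S \<in> sym_tensors m"
  unfolding conic_sums_rank_one_iff by (auto intro!: sym_tensors_sum rank_one_sym)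

definition power_cone :: "nat \<Rightarrow> (real^'n::finite) set \<Rightarrow> 'n tensor set" where
  "power_cone m X = {S. \<exists>(p::nat) u. (\<forall>j<p. u j \<in> X) \<and> S = (\<lambda>is. \<Sum>j<p. rank_one m (u j) is)}"

lemma CD_eq_power_cone: "CD m = power_cone m UNIV"
  unfolding CD_def power_cone_def by (auto intro!: sym_tensors_sum rank_one_sym)

lemma CP_eq_power_cone: "CP m = power_cone m nonneg_orthant"
  unfolding CP_def power_cone_def by (auto intro!: sym_tensors_sum rank_one_sym)

lemma power_cone_sym: "power_cone m X \<subseteq> sym_tensors m"
  unfolding power_cone_def by (auto intro!: sym_tensors_sum rank_one_sym)

lemma rank_one_in_power_cone: "x \<in> X \<Longrightarrow> rank_one m x \<in> power_cone m X"
  unfolding power_cone_def by (auto intro!: exI[of _ 1] exI[of _ "\<lambda>_. x"])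

lemma dual_power_cone:
  "dual_cone m (power_cone m X) = {A \<in> sym_tensors m. \<forall>x\<in>X. 0 \<le> tensor_form m A x}"
proof (intro equalityI subsetI)
  fix A assume A: "A \<in> dual_cone m (power_cone m X)"
  then have "0 \<le> tensor_form m A x" if "x \<in> X" for x
    using rank_one_in_power_cone[OF that, of m] unfolding dual_cone_def tensor_form_eq_inner
    by (metis (mono_tags, lifting) mem_Collect_eq tensor_inner_commute)
  then show "A \<in> {A \<in> sym_tensors m. \<forall>x\<in>X. 0 \<le> tensor_form m A x}" using A unfolding dual_cone_def by simp
next
  fix A assume A: "A \<in> {A \<in> sym_tensors m. \<forall>x\<in>X. 0 \<le> tensor_form m A x}"
  have "0 \<le> tensor_inner m B A" if B: "B \<in> power_cone m X" for B
  proof -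
    obtain p u where u: "\<forall>j<(p::nat). u j \<in> X" "B = (\<lambda>is. \<Sum>j<p. rank_one m (u j) is)"
      using B unfolding power_cone_def by blast
    have "tensor_inner m B A = (\<Sum>j<p. tensor_form m A (u j))"
      unfolding u(2) tensor_inner_sum_left tensor_form_eq_inner by (simp add: tensor_inner_commute)
    then show ?thesis using u(1) A by (auto intro!: sum_nonneg)
  qed
  then show "A \<in> dual_cone m (power_cone m X)" using A unfolding dual_cone_def by simp
qed

text \<open>
  The functional \<open>w\<close> bounds all entries of the powers of vectors in \<open>X\<close> and thereby makes the cone of sums of
  powers closed. If \<open>B\<close> lies outside this cone and \<open>S\<close> is the separating point, then the form of \<open>S - B\<close> is
  nonnegative on \<open>X\<close>, while the inner product of \<open>S - B\<close> with \<open>B\<close> is negative.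
\<close>

lemma dual_nonneg_forms:
  fixes X :: "(real^'n::finite) set"
  assumes m: "1 \<le> m" and X: "X \<noteq> {}" "\<And>t x. 0 \<le> t \<Longrightarrow> x \<in> X \<Longrightarrow> t *\<^sub>R x \<in> X" "closed X"
    and pt: "\<And>u is. u \<in> X \<Longrightarrow> length is = m \<Longrightarrow>
      \<bar>rank_one m u is\<bar> \<le> (\<Sum>is | length is = m. w is * rank_one m u is)"
  shows "dual_cone m {A \<in> sym_tensors m. \<forall>x\<in>X. 0 \<le> tensor_form m A x} = power_cone m X"
proof (intro equalityI subsetI)
  fix B assume B: "B \<in> power_cone m X"
  have "0 \<le> tensor_inner m A B" if "A \<in> sym_tensors m" "\<forall>x\<in>X. 0 \<le> tensor_form m A x" for A
  proof -
    have "A \<in> dual_cone m (power_cone m X)" unfolding dual_power_cone using that by simp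
    then have "0 \<le> tensor_inner m B A" using B unfolding dual_cone_def by simp
    then show ?thesis using tensor_inner_commute[of m A B] by simp
  qed
  then show "B \<in> dual_cone m {A \<in> sym_tensors m. \<forall>x\<in>X. 0 \<le> tensor_form m A x}"
    using B power_cone_sym[of m X] unfolding dual_cone_def by blast
next
  fix B assume B: "B \<in> dual_cone m {A \<in> sym_tensors m. \<forall>x\<in>X. 0 \<le> tensor_form m A x}"
  let ?I = "{is :: 'n list. length is = m}"
  have Bs: "B \<in> sym_tensors m" using B unfolding dual_cone_def by simp
  have "B \<in> conic_sums (card ?I) (rank_one m ` X)"
  proof (rule ccontr)
    assume nB: "B \<notin> conic_sums (card ?I) (rank_one m ` X)"
    have "\<exists>S\<in>conic_sums (card ?I) (rank_one m ` X).
        (\<forall>g\<in>rank_one m ` X. (\<Sum>i\<in>?I. (B i - S i) * g i) \<le> 0) \<and> 0 < (\<Sum>i\<in>?I. (B i - S i) * B i)"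
    proof (rule conic_separation[OF finite_lists_length conic_rank_one[OF m X(1,2)] _ _ _ nB])
      fix b :: real
      let ?T = "rank_one m ` (X \<inter> cball 0 (real CARD('n) * max 1 b))"
      have "compact ?T" by (rule compact_rank_one_image[OF X(3)])
      moreover have "?T \<subseteq> rank_one m ` X" by blast
      moreover have "{g \<in> rank_one m ` X. \<forall>i. \<bar>g i\<bar> \<le> b} \<subseteq> ?T"
      proof
        fix g assume "g \<in> {g \<in> rank_one m ` X. \<forall>i. \<bar>g i\<bar> \<le> b}"
        then obtain u where u: "u \<in> X" "g = rank_one m u" "\<And>i. \<bar>rank_one m u i\<bar> \<le> b" by blast
        have "norm u \<le> real CARD('n) * max 1 b" by (rule rank_one_bounded_imp[OF m u(3)])
        then show "g \<in> ?T" using u(1,2) by simp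
      qed
      ultimately show "\<exists>T. compact T \<and> T \<subseteq> rank_one m ` X \<and> {g \<in> rank_one m ` X. \<forall>i. \<bar>g i\<bar> \<le> b} \<subseteq> T"
        by blast
    next
      fix g :: "'n tensor" and "is"
      assume "g \<in> rank_one m ` X"
      then obtain u where u: "u \<in> X" "g = rank_one m u" by blast
      have nn: "\<bar>rank_one m u js\<bar> \<le> (\<Sum>i\<in>?I. w i * rank_one m u i)" if "length js = m" for js
        by (rule pt[OF u(1) that])
      show "\<bar>g is\<bar> \<le> (\<Sum>i\<in>?I. w i * g i)"
      proof (cases "length is = m")
        case True then show ?thesis unfolding u(2) by (rule nn)
      next
        case False
        have "\<bar>rank_one m u (replicate m undefined)\<bar> \<le> (\<Sum>i\<in>?I. w i * rank_one m u i)" by (rule nn) simp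
        then show ?thesis unfolding u(2) using False by (simp add: rank_one_def)
      qed
    next
      show "B i = 0" if "i \<notin> ?I" for i using Bs that unfolding sym_tensors_def by simp
    qed
    then obtain S where S: "S \<in> conic_sums (card ?I) (rank_one m ` X)"
      "\<And>u. u \<in> X \<Longrightarrow> (\<Sum>i\<in>?I. (B i - S i) * rank_one m u i) \<le> 0" "0 < (\<Sum>i\<in>?I. (B i - S i) * B i)"
      by blast
    define A where "A = (\<lambda>is. 1 * S is + -1 * B is)"
    have As: "A \<in> sym_tensors m" unfolding A_def
      by (rule sym_tensors_lincomb[OF conic_sums_rank_one_sym[OF S(1)] Bs])
    have inner: "tensor_inner m A C = - (\<Sum>i\<in>?I. (B i - S i) * C i)" for C
      unfolding tensor_inner_def A_def sum_negf[symmetric] by (intro sum.cong refl) (simp add: algebra_simps)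
    have "0 \<le> tensor_form m A x" if "x \<in> X" for x
      using S(2)[OF that] unfolding tensor_form_eq_inner inner by simp
    then have "0 \<le> tensor_inner m A B" using B As unfolding dual_cone_def by blast
    then show False using S(3) unfolding inner by simp
  qed
  then show "B \<in> power_cone m X" unfolding conic_sums_rank_one_iff power_cone_def by blast
qed

lemma COP_dual_form: "COP m = {A \<in> sym_tensors m. \<forall>x\<in>nonneg_orthant. 0 \<le> tensor_form m A x}"
  unfolding COP_def ..

lemma PSD_dual_form: "PSD m = {A \<in> sym_tensors m. \<forall>x\<in>UNIV. 0 \<le> tensor_form m A x}"
  unfolding PSD_def by simp

lemma dual_CP: "dual_cone m (CP m) = COP m"
  unfolding CP_eq_power_cone COP_dual_form by (rule dual_power_cone)

lemma dual_CD: "dual_cone m (CD m) = PSD m"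
  unfolding CD_eq_power_cone PSD_dual_form by (rule dual_power_cone)

text \<open>
  All entries of a power of a nonnegative vector are nonnegative, so each is bounded by their sum.
\<close>

lemma dual_COP: 
  assumes "1 \<le> m" shows "dual_cone m (COP m :: 'n::finite tensor set) = CP m"
  unfolding CP_eq_power_cone COP_dual_form
proof (rule dual_nonneg_forms[OF assms, where w = "\<lambda>is. 1"])
  show "(nonneg_orthant :: (real^'n) set) \<noteq> {}"
    unfolding nonneg_orthant_def by (auto intro!: exI[of _ 0])
  show "t *\<^sub>R x \<in> nonneg_orthant" if "0 \<le> t" "x \<in> nonneg_orthant" for t and x :: "real^'n"
    using that unfolding nonneg_orthant_def by simp
  have "closed {x :: real^'n. \<forall>i. 0 \<le> x $ i}"
    by (intro closed_Collect_all closed_Collect_le continuous_intros)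
  then show "closed (nonneg_orthant :: (real^'n) set)" unfolding nonneg_orthant_def .
  fix u :: "real^'n" and "is" :: "'n list"
  assume u: "u \<in> nonneg_orthant" and l: "length is = m"
  have "0 \<le> (\<Prod>i\<leftarrow>js. u $ i)" for js
    using u unfolding nonneg_orthant_def by (induction js) auto
  then have nn: "0 \<le> rank_one m u js" for js unfolding rank_one_def by simp
  have "rank_one m u is \<le> (\<Sum>js | length js = m. rank_one m u js)"
    by (rule member_le_sum) (use nn l finite_lists_length in auto)
  then show "\<bar>rank_one m u is\<bar> \<le> (\<Sum>is | length is = m. 1 * rank_one m u is)" using nn by simp
qed

text \<open>
  For even \<open>m\<close> the diagonal entries \<open>(u $ i) ^ m\<close> are nonnegative, and an arbitrary entry is bounded by the
  largest of them. The weight \<open>w\<close> selects the diagonal, that is, the constant index lists.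
\<close>

lemma dual_PSD_even:
  assumes "1 \<le> m" "even m" shows "dual_cone m (PSD m :: 'n::finite tensor set) = CD m"
  unfolding CD_eq_power_cone PSD_dual_form
proof (rule dual_nonneg_forms[OF assms(1), where w = "\<lambda>is. if is = replicate m (hd is) then 1 else 0"])
  let ?w = "\<lambda>is::'n list. if is = replicate m (hd is) then 1 else 0 :: real"
  fix u :: "real^'n" and "is" :: "'n list"
  assume l: "length is = m"
  have ne: "range (\<lambda>i. \<bar>u $ i\<bar>) \<noteq> {}" "finite (range (\<lambda>i. \<bar>u $ i\<bar>))" by auto
  obtain k where k: "\<bar>u $ k\<bar> = Max (range (\<lambda>i. \<bar>u $ i\<bar>))" using Max_in[OF ne(2,1)] by (metis imageE)
  have max: "\<bar>u $ i\<bar> \<le> \<bar>u $ k\<bar>" for i unfolding k using ne by simp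
  have const: "rank_one m u (replicate m i) = (u $ i) ^ m" for i unfolding rank_one_def by simp
  have nn: "0 \<le> ?w js * rank_one m u js" for js
  proof (cases "js = replicate m (hd js)")
    case True
    then have "rank_one m u js = (u $ hd js) ^ m" using const by metis
    then show ?thesis using assms(2) by (simp add: zero_le_even_power)
  qed simp
  have "\<bar>\<Prod>i\<leftarrow>js. u $ i\<bar> \<le> \<bar>u $ k\<bar> ^ length js" for js
    by (induction js) (auto simp: abs_mult intro!: mult_mono max)
  from this[of "is"] have "\<bar>rank_one m u is\<bar> \<le> \<bar>u $ k\<bar> ^ m" unfolding rank_one_def using l by simp
  also have "\<dots> = (u $ k) ^ m" using assms(2) by (simp add: power_even_abs)
  also have "\<dots> = ?w (replicate m k) * rank_one m u (replicate m k)"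
    unfolding const using assms(1) by simp
  also have "\<dots> \<le> (\<Sum>js | length js = m. ?w js * rank_one m u js)"
    by (rule member_le_sum[of "replicate m k" _ "\<lambda>js. ?w js * rank_one m u js"])
       (use nn finite_lists_length in auto)
  finally show "\<bar>rank_one m u is\<bar> \<le> (\<Sum>is | length is = m. ?w is * rank_one m u is)" .
qed auto

lemma PSD_odd:
  assumes "odd m" shows "PSD m = {zero_tensor}"
proof (intro equalityI subsetI)
  fix A assume A: "A \<in> PSD m"
  have "tensor_form m A x = tensor_form m zero_tensor x" for x
  proof -
    have "tensor_form m A (- x) = - tensor_form m A x"
      using is_form_uminus_arg[OF is_form_tensor_form, of m A x] assms by simp
    then have "tensor_form m A x = 0" using A unfolding PSD_def
      by (metis (mono_tags, lifting) mem_Collect_eq neg_0_le_iff_le order_antisym)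
    then show ?thesis unfolding tensor_form_def zero_tensor_def by simp
  qed
  moreover have "zero_tensor \<in> sym_tensors m" unfolding sym_tensors_def zero_tensor_def by simp
  ultimately have "A = zero_tensor" using A unfolding PSD_def by (intro tensor_form_inject) auto
  then show "A \<in> {zero_tensor}" by simp
next
  fix A assume "A \<in> {zero_tensor}"
  then show "A \<in> PSD m" unfolding PSD_def sym_tensors_def zero_tensor_def tensor_form_def by simp
qed

text \<open>
  Odd powers absorb scalars of either sign, so sums of powers form a linear space. A tensor that annihilates
  it has the form 0, so its symmetrization is 0 and it annihilates every symmetric tensor.
\<close>

lemma CD_odd:
  assumes m: "odd m" shows "CD m = (sym_tensors m :: 'n::finite tensor set)"
proof (intro equalityI subsetI)
  fix B assume "B \<in> (CD m :: 'n tensor set)" then show "B \<in> sym_tensors m" unfolding CD_def by simp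
next
  fix B :: "'n tensor" assume B: "B \<in> sym_tensors m"
  let ?I = "{is :: 'n list. length is = m}"
  let ?W = "conic_sums (card ?I) (rank_one m ` (UNIV :: (real^'n) set))"
  have m1: "1 \<le> m" using m by (cases m) auto
  have con: "conic_on ?I (rank_one m ` (UNIV :: (real^'n) set))" by (rule conic_rank_one[OF m1]) auto
  have scale: "(\<lambda>is. a * S is) \<in> ?W" if S: "S \<in> ?W" for a S
  proof -
    obtain u where u: "S = (\<lambda>is. \<Sum>j<card ?I. rank_one m (u j) is)"
      using S unfolding conic_sums_rank_one_iff by blast
    have "(\<lambda>is. a * S is) = (\<lambda>is. \<Sum>j<card ?I. rank_one m (root m a *\<^sub>R u j) is)"
      unfolding u rank_one_scale sum_distrib_left using odd_real_root_pow[OF m] by simp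
    then show ?thesis unfolding conic_sums_rank_one_iff by (intro exI[of _ "\<lambda>j. root m a *\<^sub>R u j"]) simp
  qed
  have "\<exists>w\<in>?W. \<forall>i\<in>?I. w i = B i"
  proof (rule subspace_double_annihilator[OF finite_lists_length])
    show "?W \<noteq> {}" using conic_sums_zero[OF con] by blast
    show "(\<lambda>i. a * u i + b * v i) \<in> ?W" if "u \<in> ?W" "v \<in> ?W" for u v a b
      by (rule conic_sums_add[OF finite_lists_length con scale[OF that(1)] scale[OF that(2)]])
    fix R assume R: "\<And>w. w \<in> ?W \<Longrightarrow> (\<Sum>i\<in>?I. R i * w i) = 0"
    have R0: "tensor_form m R x = 0" for x
    proof -
      have "rank_one m x \<in> conic_sums 1 (range (rank_one m))" by (rule generator_in_conic_sums_1) simp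
      from R[OF conic_sums_add[OF finite_lists_length con conic_sums_zero[OF con] this, simplified]] show ?thesis unfolding tensor_form_eq_inner tensor_inner_def .
    qed
    have "symmetrize m R is = 0" if len: "length is = m" for "is"
    proof (rule tensor_form_eq_0_imp[OF _ _ len])
      show "symmetrize m R is = symmetrize m R js" if "mset is = mset js" for "is" js
        using symmetrize_sym[of m R] that unfolding sym_tensors_iff_mset by blast
    qed (simp add: tensor_form_symmetrize R0)
    then have "tensor_inner m (symmetrize m R) B = 0" unfolding tensor_inner_def by simp
    then have "tensor_inner m R B = 0" using tensor_inner_symmetrize[OF B] by simp
    then show "(\<Sum>i\<in>?I. R i * B i) = 0" unfolding tensor_inner_def .
  qed
  then obtain w where w: "w \<in> ?W" "\<And>i. length i = m \<Longrightarrow> w i = B i" by blast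
  have "w i = B i" for i
  proof (cases "length i = m")
    case False
    then show ?thesis using B conic_sums_rank_one_sym[OF w(1)] unfolding sym_tensors_def by simp
  qed (rule w(2))
  then have "B \<in> ?W" using w(1) by presburger
  then show "B \<in> CD m" unfolding CD_eq_power_cone power_cone_def conic_sums_rank_one_iff by blast
qed

lemma dual_PSD:
  assumes "1 \<le> m" shows "dual_cone m (PSD m :: 'n::finite tensor set) = CD m"
proof (cases "even m")
  case True then show ?thesis by (rule dual_PSD_even[OF assms])
next
  case False
  then show ?thesis unfolding PSD_odd[OF False] CD_odd[OF False] dual_cone_def
    by (simp add: zero_tensor_def tensor_inner_def)
qed

section \<open>Comparison of the cones\<close>

lemma binary_psd_dominates_square_vec:
  fixes f :: "real^'n::finite \<Rightarrow> real"
  assumes n: "CARD('n) = 2" and f: "is_form (2 * k) f" "\<And>x. 0 \<le> f x" "f u \<noteq> 0"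
  shows "dominates_square k f"
proof -
  obtain i j :: 'n where ij: "UNIV = {i, j}" "i \<noteq> j" using n by (meson card_2_iff)
  define T :: "real \<times> real \<Rightarrow> real^'n" where "T p = fst p *\<^sub>R axis i 1 + snd p *\<^sub>R axis j 1" for p
  define R :: "real^'n \<Rightarrow> real \<times> real" where "R v = (v $ i, v $ j)" for v
  have T: "linear T" unfolding T_def by (rule linearI) (auto simp: algebra_simps)
  have R: "linear R" unfolding R_def by (rule linearI) auto
  have TR: "T (R v) = v" for v
  proof -
    have "T (R v) $ l = v $ l" for l
      using ij UNIV_I[of l] unfolding T_def R_def by (auto simp: axis_def)
    then show ?thesis by (simp add: vec_eq_iff)
  qed
  have RT: "R (T p) = p" for p
    using ij(2) unfolding T_def R_def by (auto simp: axis_def)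
  have "dominates_square k (\<lambda>p. f (T p))"
    by (rule binary_psd_dominates_square[OF is_form_compose[OF f(1) T] f(2), of "R u"]) (simp add: TR f(3))
  then show ?thesis using dominates_square_compose[of k f T R] T R TR RT by blast
qed

lemma ternary_quartic_psd_dominates_square_vec:
  fixes f :: "real^'n::finite \<Rightarrow> real"
  assumes n: "CARD('n) = 3" and f: "is_form 4 f" "\<And>x. 0 \<le> f x" "f u \<noteq> 0"
  shows "dominates_square 2 f"
proof -
  obtain i j k :: 'n where ij: "UNIV = {i, j, k}" "i \<noteq> j" "j \<noteq> k" "i \<noteq> k" using n by (metis card_3_iff)
  define T :: "real \<times> real \<times> real \<Rightarrow> real^'n" where
    "T p = fst p *\<^sub>R axis i 1 + fst (snd p) *\<^sub>R axis j 1 + snd (snd p) *\<^sub>R axis k 1" for p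
  define R :: "real^'n \<Rightarrow> real \<times> real \<times> real" where "R v = (v $ i, v $ j, v $ k)" for v
  have T: "linear T" unfolding T_def by (rule linearI) (auto simp: algebra_simps)
  have R: "linear R" unfolding R_def by (rule linearI) auto
  have TR: "T (R v) = v" for v
  proof -
    have "T (R v) $ l = v $ l" for l
      using ij UNIV_I[of l] unfolding T_def R_def by (auto simp: axis_def)
    then show ?thesis by (simp add: vec_eq_iff)
  qed
  have RT: "R (T p) = p" for p
    using ij(2-) unfolding T_def R_def by (auto simp: axis_def)
  have "dominates_square 2 (\<lambda>p. f (T p))"
    by (rule ternary_quartic_psd_dominates_square[OF is_form_compose[OF f(1) T] f(2), of "R u"]) (simp add: TR f(3))
  then show ?thesis using dominates_square_compose[of 2 f T R] T R TR RT by blast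
qed

lemma SOS_iff:
  "A \<in> SOS (2 * k) \<longleftrightarrow> A \<in> sym_tensors (2 * k) \<and>
     (\<exists>(r::nat) C. (\<forall>j<r. C j \<in> sym_tensors k) \<and>
        (\<forall>x. tensor_form (2 * k) A x = (\<Sum>j<r. (tensor_form k (C j) x)\<^sup>2)))"
  unfolding SOS_def by simp

lemma SOS_subset_PSD: "SOS m \<subseteq> PSD m"
  unfolding SOS_def PSD_def by (auto simp: sum_nonneg)

lemma tensor_form_power_sum:
  "tensor_form m (\<lambda>is. \<Sum>j<p. rank_one m (u j) is) x = (\<Sum>j<(p::nat). (u j \<bullet> x) ^ m)"
  unfolding tensor_form_sum tensor_form_rank_one ..

lemma CD_subset_SOS: "CD (2 * k) \<subseteq> SOS (2 * k)"
proof
  fix A assume A: "A \<in> CD (2 * k)"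
  then obtain p u where u: "A = (\<lambda>is. \<Sum>j<(p::nat). rank_one (2 * k) (u j) is)" unfolding CD_def by blast
  have "tensor_form (2 * k) A x = (\<Sum>j<p. (tensor_form k (rank_one k (u j)) x)\<^sup>2)" for x
    unfolding u tensor_form_power_sum tensor_form_rank_one
    by (simp add: power_mult[symmetric] mult.commute)
  moreover have "A \<in> sym_tensors (2 * k)" using A unfolding CD_def by blast
  ultimately show "A \<in> SOS (2 * k)" unfolding SOS_iff
    by (intro conjI exI[of _ p] exI[of _ "\<lambda>j. rank_one k (u j)"]) (simp_all add: rank_one_sym)
qed

text \<open>
  Tensors of order 1 are vectors, and the square of \<open>u \<bullet> x\<close> is the form of the power of \<open>u\<close> of order 2.
\<close>

lemma SOS_2_subset_CD: "SOS 2 \<subseteq> (CD 2 :: 'n::finite tensor set)"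
proof
  fix A :: "'n tensor" assume "A \<in> SOS 2"
  then have "A \<in> SOS (2 * 1)" by simp
  then obtain r C where A: "A \<in> sym_tensors 2"
    and C: "\<And>x. tensor_form 2 A x = (\<Sum>j<(r::nat). (tensor_form 1 (C j) x)\<^sup>2)"
    unfolding SOS_iff by auto
  define u :: "nat \<Rightarrow> real^'n" where "u j = (\<chi> i. C j [i])" for j
  have lin: "tensor_form 1 (C j) x = u j \<bullet> x" for j x
    unfolding One_nat_def tensor_form_Suc tensor_form_0 inner_vec_def u_def by (simp add: mult.commute)
  have "A = (\<lambda>is. \<Sum>j<r. rank_one 2 (u j) is)"
    by (rule tensor_form_inject[OF A sym_tensors_sum[OF rank_one_sym]])
       (simp only: tensor_form_power_sum C lin)
  then show "A \<in> CD 2" using A unfolding CD_def by blast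
qed

lemma PSD_eq_SOS:
  assumes "m = 2 * k" "m = 2 \<or> CARD('n::finite) = 2 \<or> (m = 4 \<and> CARD('n) = 3)"
  shows "SOS m = (PSD m :: 'n tensor set)"
proof (rule antisym[OF SOS_subset_PSD], rule subsetI)
  fix A :: "'n tensor" assume A: "A \<in> PSD m"
  have dom: "dominates_square k f"
    if f: "is_form (2 * k) f" "\<And>x. 0 \<le> f x" "\<exists>u. f u \<noteq> 0" for f :: "real^'n \<Rightarrow> real"
  proof -
    obtain u where u: "f u \<noteq> 0" using f(3) by blast
    consider "k = 1" | "CARD('n) = 2" | "k = 2" "CARD('n) = 3" using assms by auto
    then show ?thesis
    proof cases
      case 1 then show ?thesis using quadratic_psd_dominates_square[of f u] f(1,2) u by simp
    next
      case 2 then show ?thesis using binary_psd_dominates_square_vec[of k f u] f(1,2) u by simp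
    next
      case 3 then show ?thesis using ternary_quartic_psd_dominates_square_vec[of f u] f(1,2) u by simp
    qed
  qed
  have "\<exists>(r::nat) C. (\<forall>j<r. C j \<in> sym_tensors k) \<and>
      (\<forall>x. tensor_form (2 * k) A x = (\<Sum>j<r. (tensor_form k (C j) x)\<^sup>2))"
    by (rule psd_form_sum_of_squares[OF dom is_form_tensor_form]) (use A assms(1) in \<open>auto simp: PSD_def\<close>)
  then show "A \<in> SOS m" using A unfolding assms(1) SOS_iff PSD_def by blast
qed

lemma form_tensor_not_SOS:
  fixes f :: "real^'n::finite \<Rightarrow> real"
  assumes "is_form (2 * k) f" "\<And>x. 0 \<le> f x"
    and "\<And>r q. (\<And>s. s < (r::nat) \<Longrightarrow> is_form k (q s)) \<Longrightarrow> (\<And>v. f v = (\<Sum>s<r. (q s v)\<^sup>2)) \<Longrightarrow> False"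
  shows "SOS (2 * k) \<subset> (PSD (2 * k) :: 'n tensor set)"
proof -
  obtain A :: "'n tensor" where A: "A \<in> sym_tensors (2 * k)" "tensor_form (2 * k) A = f"
    using is_form_imp_sym_tensor[OF assms(1)] by blast
  have "A \<in> PSD (2 * k)" unfolding PSD_def using A assms(2) by simp
  moreover have "A \<notin> SOS (2 * k)"
  proof
    assume "A \<in> SOS (2 * k)"
    then obtain r C where C: "\<And>x. tensor_form (2 * k) A x = (\<Sum>j<(r::nat). (tensor_form k (C j) x)\<^sup>2)"
      unfolding SOS_iff by blast
    show False
      by (rule assms(3)[of r "\<lambda>s. tensor_form k (C s)"]) (use C A(2) is_form_tensor_form in auto)
  qed
  ultimately show ?thesis using SOS_subset_PSD by blast
qed

lemma SOS_psubset_PSD: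
  assumes m: "m = 2 * k" "2 \<le> m" "m \<noteq> 2"
    and n: "2 \<le> CARD('n::finite)" "CARD('n) \<noteq> 2" "\<not> (m = 4 \<and> CARD('n) = 3)"
  shows "SOS m \<subset> (PSD m :: 'n tensor set)"
proof (cases "m = 4")
  case True
  then have "4 \<le> card (UNIV :: 'n set)" using n by simp
  then obtain S :: "'n set" where S: "card S = 4" by (meson obtain_subset_with_card_n)
  then obtain l where l: "distinct l" "set l = S" "length l = 4"
    using finite_distinct_list[of S] by (metis card.infinite distinct_card zero_neq_numeral)
  obtain a b c d where abcd: "l = [a, b, c, d]"
    using l(3) by (auto simp: length_Suc_conv eval_nat_numeral)
  have k: "k = 2" using True m by simp
  show ?thesis unfolding m(1)
  proof (rule form_tensor_not_SOS[where f = "choi_lam_form a b c d"])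
    show "is_form (2 * k) (choi_lam_form a b c d)" using is_form_choi_lam[of a b c d] k by simp
    show "0 \<le> choi_lam_form a b c d x" for x by (rule choi_lam_form_nonneg)
    show False if "\<And>s. s < r \<Longrightarrow> is_form k (q s)" "\<And>v. choi_lam_form a b c d v = (\<Sum>s<r. (q s v)\<^sup>2)" for r :: nat and q
      using choi_lam_form_not_sos[of a b c d r q] that l(1) unfolding abcd k by blast
  qed
next
  case False
  then have m6: "6 \<le> m" using m by auto
  have "3 \<le> card (UNIV :: 'n set)" using n by simp
  then obtain S :: "'n set" where S: "card S = 3" by (meson obtain_subset_with_card_n)
  then obtain a b c :: 'n where abc: "a \<noteq> b" "b \<noteq> c" "a \<noteq> c" unfolding card_3_iff by blast
  show ?thesis unfolding m(1)
  proof (rule form_tensor_not_SOS[where f = "motzkin_form (m - 6) a b c"])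
    show "is_form (2 * k) (motzkin_form (m - 6) a b c)" using is_form_motzkin[of "m - 6" a b c] m6 m(1) by simp
    have "even (m - 6)" using m(1) by simp
    then show "0 \<le> motzkin_form (m - 6) a b c x" for x by (rule motzkin_form_nonneg)
    show False if "\<And>s. s < r \<Longrightarrow> is_form k (q s)" "\<And>v. motzkin_form (m - 6) a b c v = (\<Sum>s<r. (q s v)\<^sup>2)" for r :: nat and q
      using motzkin_form_not_sos[OF abc that] .
  qed
qed

lemma two_indices:
  assumes "2 \<le> CARD('n::finite)" obtains i j :: "'n::finite" where "i \<noteq> j"
proof (rule ccontr)
  assume "\<not> thesis"
  then have "i = j" for i j :: 'n using that by blast
  then have "(UNIV :: 'n set) = {undefined}" by blast
  then have "CARD('n) = card {undefined :: 'n}" by (rule arg_cong)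
  then show False using assms by simp
qed

lemma power_sum_zero:
  fixes a :: "nat \<Rightarrow> real"
  assumes "even m" "(\<Sum>s<p. (a s) ^ m) = 0" "s < p" "0 < m"
  shows "a s = 0"
proof -
  have "\<forall>s\<in>{..<p}. (a s) ^ m = 0"
    using assms(1,2) sum_nonneg_eq_0_iff[of "{..<p}" "\<lambda>s. (a s) ^ m"] by (simp add: zero_le_even_power)
  then show ?thesis using assms(3,4) by simp
qed

text \<open>
  The power \<open>v\<^sup>m\<close> of \<open>v = e\<^sub>i - e\<^sub>j\<close> has a form that vanishes at \<open>e\<^sub>i + e\<^sub>j\<close>. If it were a sum of powers of
  nonnegative vectors, these would be orthogonal to \<open>e\<^sub>i + e\<^sub>j\<close> and hence to \<open>e\<^sub>i\<close>, where the form is 1.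
\<close>

lemma CP_psubset_CD:
  assumes m: "even m" "2 \<le> m" and n: "2 \<le> CARD('n::finite)"
  shows "CP m \<subset> (CD m :: 'n tensor set)"
proof -
  obtain i j :: 'n where ij: "i \<noteq> j" using two_indices[OF n] .
  define v :: "real^'n" where "v = axis i 1 - axis j 1"
  have v: "v $ i = 1" "v $ j = - 1" unfolding v_def using ij by (simp_all add: axis_def)
  have "rank_one m v \<in> CD m" unfolding CD_eq_power_cone by (rule rank_one_in_power_cone) simp
  moreover have "rank_one m v \<notin> CP m"
  proof
    assume "rank_one m v \<in> CP m"
    then obtain p u where u: "\<And>s. s < (p::nat) \<Longrightarrow> u s \<in> nonneg_orthant"
      "rank_one m v = (\<lambda>is. \<Sum>s<p. rank_one m (u s) is)" unfolding CP_def by blast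
    have form: "(v \<bullet> x) ^ m = (\<Sum>s<p. (u s \<bullet> x) ^ m)" for x
      using tensor_form_rank_one[of m v x] unfolding u(2) tensor_form_power_sum by simp
    have "v \<bullet> (axis i 1 + axis j 1) = 0"
      by (simp add: inner_axis inner_add_right v)
    then have "(\<Sum>s<p. (u s \<bullet> (axis i 1 + axis j 1)) ^ m) = 0" using form[of "axis i 1 + axis j 1"] m(2) by (simp add: zero_power)
    from power_sum_zero[OF m(1) this] m(2)
    have "u s \<bullet> (axis i 1 + axis j 1) = 0" if "s < p" for s using that by simp
    then have "u s $ i + u s $ j = 0" if "s < p" for s using that by (simp add: inner_axis inner_add_right)
    moreover have "0 \<le> u s $ i" "0 \<le> u s $ j" if "s < p" for s using u(1)[OF that] unfolding nonneg_orthant_def by auto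
    ultimately have "u s $ i = 0" if "s < p" for s using that by (metis add_nonneg_eq_0_iff)
    then have "(\<Sum>s<p. (u s \<bullet> axis i 1) ^ m) = 0" using m(2) by (simp add: inner_axis)
    moreover have "v \<bullet> axis i 1 = 1" by (simp add: inner_axis v)
    ultimately show False using form[of "axis i 1"] by simp
  qed
  moreover have "CP m \<subseteq> (CD m :: 'n tensor set)" unfolding CP_def CD_def by blast
  ultimately show ?thesis by blast
qed

text \<open>
  Witness: \<open>x\<^sub>i ^ (m - 1) x\<^sub>j\<close>, which is negative at \<open>e\<^sub>j - e\<^sub>i\<close> because \<open>m - 1\<close> is odd.
\<close>

lemma PSD_psubset_COP:
  assumes m: "even m" "2 \<le> m" and n: "2 \<le> CARD('n::finite)"
  shows "PSD m \<subset> (COP m :: 'n tensor set)"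
proof -
  obtain i j :: 'n where ij: "i \<noteq> j" using two_indices[OF n] .
  define f :: "real^'n \<Rightarrow> real" where "f v = (v $ i) ^ (m - 1) * v $ j" for v
  have "is_form (m - 1 + 1) f" unfolding f_def[abs_def]
    by (intro is_form_mult is_form_nth_power is_form_linear linear_vec_nth)
  then have "is_form m f" using m(2) by simp
  then obtain A :: "'n tensor" where A: "A \<in> sym_tensors m" "tensor_form m A = f"
    using is_form_imp_sym_tensor by blast
  have "A \<in> COP m" unfolding COP_def nonneg_orthant_def A(2) using A by (simp add: f_def)
  moreover have "A \<notin> PSD m"
  proof
    assume "A \<in> PSD m"
    then have "0 \<le> f (axis j 1 - axis i 1)" unfolding PSD_def A(2)[symmetric] by blast
    moreover have "f (axis j 1 - axis i 1) = - 1"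
      unfolding f_def using ij m by (simp add: axis_def)
    ultimately show False by simp
  qed
  moreover have "PSD m \<subseteq> (COP m :: 'n tensor set)" unfolding PSD_def COP_def by blast
  ultimately show ?thesis by blast
qed

text \<open>
  Witness: the square of \<open>x\<^sub>i ^ (k - 1) x\<^sub>j\<close>. It vanishes at \<open>e\<^sub>i\<close> and at \<open>e\<^sub>j\<close>, so in a sum of even powers
  of linear functionals every functional would vanish at both, but the form is 1 at \<open>e\<^sub>i + e\<^sub>j\<close>. The zero at
  \<open>e\<^sub>j\<close> is where \<open>k > 1\<close> enters.
\<close>

lemma CD_psubset_SOS:
  assumes m: "even m" "4 \<le> m" and n: "2 \<le> CARD('n::finite)"
  shows "CD m \<subset> (SOS m :: 'n tensor set)"
proof -
  obtain k where k: "m = 2 * k" using m(1) by blast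
  obtain i j :: 'n where ij: "i \<noteq> j" using two_indices[OF n] .
  define g :: "real^'n \<Rightarrow> real" where "g v = (v $ i) ^ (k - 1) * v $ j" for v
  have "is_form (k - 1 + 1) g" unfolding g_def[abs_def]
    by (intro is_form_mult is_form_nth_power is_form_linear linear_vec_nth)
  then have g: "is_form k g" using m(2) k by simp
  then obtain C :: "'n tensor" where C: "C \<in> sym_tensors k" "tensor_form k C = g"
    using is_form_imp_sym_tensor by blast
  obtain A :: "'n tensor" where A: "A \<in> sym_tensors m" "tensor_form m A = (\<lambda>v. (g v)\<^sup>2)"
    using is_form_imp_sym_tensor[OF is_form_power[OF g, of 2]] k by blast
  have "tensor_form (2 * k) A x = (\<Sum>s<1::nat. (tensor_form k C x)\<^sup>2)" for x
    using A(2) C(2) k by simp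
  then have "A \<in> SOS m" unfolding k SOS_iff using A(1) C(1) k
    by (intro conjI exI[of _ "1::nat"] exI[of _ "\<lambda>_. C"]) simp_all
  moreover have "A \<notin> CD m"
  proof
    assume "A \<in> CD m"
    then obtain p u where u: "A = (\<lambda>is. \<Sum>s<(p::nat). rank_one m (u s) is)" unfolding CD_def by blast
    have form: "(g x)\<^sup>2 = (\<Sum>s<p. (u s \<bullet> x) ^ m)" for x
      using A(2) unfolding u tensor_form_power_sum[abs_def] by metis
    have z: "u s \<bullet> x = 0" if "g x = 0" "s < p" for s x
      using power_sum_zero[OF m(1), of "\<lambda>s. u s \<bullet> x" p s] form[of x] that m(2) by simp
    have "g (axis i 1) = 0" "g (axis j 1) = 0"
      unfolding g_def using ij m(2) k by (simp_all add: axis_def zero_power)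
    then have "u s \<bullet> (axis i 1 + axis j 1) = 0" if "s < p" for s
      using z[of "axis i 1" s] z[of "axis j 1" s] that by (simp add: inner_add_right)
    then have "(g (axis i 1 + axis j 1))\<^sup>2 = 0" unfolding form using m(2) by simp
    moreover have "g (axis i 1 + axis j 1) = 1" unfolding g_def using ij by (simp add: axis_def)
    ultimately show False by simp
  qed
  ultimately show ?thesis using CD_subset_SOS[of k] k by blast
qed

theorem theorem2p1:
  fixes m :: nat
  assumes "2 \<le> m" and "2 \<le> CARD('n::finite)"
  shows
    "(dual_cone m (CP m :: 'n tensor set) = COP m \<and>
      dual_cone m (COP m :: 'n tensor set) = CP m \<and>
      dual_cone m (PSD m :: 'n tensor set) = CD m \<and>
      dual_cone m (CD m :: 'n tensor set) = PSD m)
   \<and> (odd m \<longrightarrow>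
      (CD m :: 'n tensor set) = sym_tensors m \<and>
      (PSD m :: 'n tensor set) = {zero_tensor})
   \<and> (even m \<longrightarrow>
      (CP m :: 'n tensor set) \<subset> CD m \<and>
      (CD m :: 'n tensor set) \<subseteq> SOS m \<and>
      (SOS m :: 'n tensor set) \<subseteq> PSD m \<and>
      (PSD m :: 'n tensor set) \<subset> COP m)
   \<and> (even m \<longrightarrow>
      (if m = 2 \<or> CARD('n) = 2 \<or> (m = 4 \<and> CARD('n) = 3)
       then (SOS m :: 'n tensor set) = PSD m
       else (SOS m :: 'n tensor set) \<subset> PSD m))
   \<and> (CD 2 :: 'n tensor set) = SOS 2
   \<and> (even m \<and> 4 \<le> m \<longrightarrow> (CD m :: 'n tensor set) \<subset> SOS m)"
proof (intro conjI impI)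
  have m1: "1 \<le> m" using assms(1) by simp
  show "dual_cone m (CP m :: 'n tensor set) = COP m" by (rule dual_CP)
  show "dual_cone m (COP m :: 'n tensor set) = CP m" by (rule dual_COP[OF m1])
  show "dual_cone m (PSD m :: 'n tensor set) = CD m" by (rule dual_PSD[OF m1])
  show "dual_cone m (CD m :: 'n tensor set) = PSD m" by (rule dual_CD)
  show "(CD m :: 'n tensor set) = sym_tensors m" if "odd m" by (rule CD_odd[OF that])
  show "(PSD m :: 'n tensor set) = {zero_tensor}" if "odd m" by (rule PSD_odd[OF that])
  show "(CP m :: 'n tensor set) \<subset> CD m" if "even m" by (rule CP_psubset_CD[OF that assms])
  show "(CD m :: 'n tensor set) \<subseteq> SOS m" if "even m" using CD_subset_SOS that by (auto elim!: evenE)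
  show "(SOS m :: 'n tensor set) \<subseteq> PSD m" by (rule SOS_subset_PSD)
  show "(PSD m :: 'n tensor set) \<subset> COP m" if "even m" by (rule PSD_psubset_COP[OF that assms])
  show "if m = 2 \<or> CARD('n) = 2 \<or> (m = 4 \<and> CARD('n) = 3)
       then (SOS m :: 'n tensor set) = PSD m
       else (SOS m :: 'n tensor set) \<subset> PSD m" if even: "even m"
  proof -
    obtain k where k: "m = 2 * k" using even by blast
    show ?thesis using PSD_eq_SOS[OF k, where 'n = 'n] SOS_psubset_PSD[OF k assms(1) _ assms(2)] by auto
  qed
  show "(CD 2 :: 'n tensor set) = SOS 2"
    using CD_subset_SOS[of 1] SOS_2_subset_CD by auto
  show "(CD m :: 'n tensor set) \<subset> SOS m" if "even m \<and> 4 \<le> m"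
    using CD_psubset_SOS[OF _ _ assms(2)] that by blast
qed

end
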